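(* Let $c=-\tfrac{21}{4}$ and $h=-\tfrac{3}{32}$, and let $M_1=L(c,h)$ be the irreducible lowest-weight module over the Ramond superalgebra $\mathrm{NS}^{\mathrm{untw}}$ with central charge $c$ and lowest $L_0$-eigenvalue $h$. Let $\Theta: M_1\to M_1$ be the odd linear map induced by $\mathbf{m}\,w\mapsto \mathbf{m}\,G_0 w$, where $w$ is in the lowest graded piece and $\mathbf m$ is a monomial in the negative modes. For $\tau\in\mathbb{C}$ with $\operatorname{Im}\tau>0$ put $$F(\tau)=\operatorname{Tr}_{M_1} G_0\,\Theta\, q^{L_0-c/24},\qquad q=e^{2\pi i\tau}.$$ Then $$F(\tau)=\frac{\eta(\tau)^3}{4},$$ where $\eta(\tau)=q^{1/24}\prod_{n=1}^\infty(1-q^n)$ is the Dedekind eta function.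
   Context: All vector spaces are over $\mathbb{C}$. The Ramond superalgebra $\mathrm{NS}^{\mathrm{untw}}$ is the Lie superalgebra with basis $L_n$ ($n\in\mathbb{Z}$), $G_m$ ($m\in\mathbb{Z}$), $C$. Here $L_n$ and $C$ are even, $G_m$ is odd, and $C$ is central. The (super)commutation relations are $$[L_m,L_n]=(m-n)L_{m+n}+\tfrac{m^3-m}{12}\delta_{m,-n}C,\qquad [G_m,L_n]=\left(m-\tfrac n2\right)G_{m+n},$$ $$[G_m,G_n]=2L_{m+n}+\tfrac13\left(m^2-\tfrac14\right)\delta_{m,-n}C.$$ Here $[G_m,G_n]=G_mG_n+G_nG_m$. In particular $G_0^2=L_0-C/24$. Let $\mathrm{NS}^{\mathrm{untw}}_+=\mathbb{C}C\oplus\bigoplus_{n\ge 0}\mathbb{C}L_n\oplus\bigoplus_{m\ge 0}\mathbb{C}G_m$. For $c,h\in\mathbb{C}$ with $h\ne c/24$, let $S_{c,h}=\mathbb{C}v_{c,h}+\mathbb{C}G_0v_{c,h}$ be the $1|1$-dimensional $\mathrm{NS}^{\mathrm{untw}}_+$-module with $v_{c,h}$ even, on which $C=c$, $L_0=h$, and all $L_n,G_n$ with $n>0$ act as zero (so $G_0^2=h-c/24$). For $c=-21/4$, $h=-3/32$ one has $c/24=-7/32\neq h$. The generalised Verma module is $M(c,h)=U(\mathrm{NS}^{\mathrm{untw}})\otimes_{U(\mathrm{NS}^{\mathrm{untw}}_+)}S_{c,h}$, and $L(c,h)$ is its irreducible quotient, where irreducibility is in the category of $\mathbb{Z}_2$-graded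 modules. That is, $L(c,h)$ is the quotient of $M(c,h)$ by its maximal proper $\mathbb{Z}_2$-graded submodule. The map $\Theta$ is defined on $M(c,h)$ by $\mathbf{m}\,w\mapsto\mathbf{m}\,G_0w$, where $\mathbf{m}$ is a monomial in the $L_n,G_n$ with $n<0$ and $w\in S_{c,h}$. It commutes (in the ordinary sense, without signs) with the action of $\mathrm{NS}^{\mathrm{untw}}$ and descends to $L(c,h)$. $\operatorname{Tr}$ is the ordinary trace (not the supertrace). The trace is the sum of $q^{\lambda-c/24}$ times the trace of $G_0\Theta$ on the finite-dimensional $L_0$-eigenspace of $M_1$ of eigenvalue $\lambda$, over all eigenvalues $\lambda$. For real $a$, $q^a$ means $e^{2\pi i a\tau}$. *)

theory Defs
  imports "HOL-Analysis.Analysis" "HOL-Library.Poly_Mapping"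
begin

section \<open>Finitely supported formal complex linear combinations\<close>

definition pscale :: "complex \<Rightarrow> ('k \<Rightarrow>\<^sub>0 complex) \<Rightarrow> ('k \<Rightarrow>\<^sub>0 complex)"
  where "pscale k p = Poly_Mapping.map ((*) k) p"

lemma lookup_pscale [simp]: "Poly_Mapping.lookup (pscale k p) x = k * Poly_Mapping.lookup p x"
  unfolding pscale_def by (simp add: map.rep_eq when_def)

interpretation pm: vector_space "pscale :: complex \<Rightarrow> ('k \<Rightarrow>\<^sub>0 complex) \<Rightarrow> _"
  by unfold_locales (auto intro!: poly_mapping_eqI simp: lookup_add algebra_simps)

lemma pscale_single [simp]: "pscale k (Poly_Mapping.single x a) = Poly_Mapping.single x (k * a)"
  by (rule poly_mapping_eqI) (simp add: lookup_single when_def)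

definition pushforward :: "('k \<Rightarrow> 'l) \<Rightarrow> ('k \<Rightarrow>\<^sub>0 complex) \<Rightarrow> ('l \<Rightarrow>\<^sub>0 complex)"
  where "pushforward f p = (\<Sum>x\<in>Poly_Mapping.keys p. Poly_Mapping.single (f x) (Poly_Mapping.lookup p x))"

lemma pushforward_superset:
  assumes "finite A" "Poly_Mapping.keys p \<subseteq> A"
  shows "pushforward f p = (\<Sum>x\<in>A. Poly_Mapping.single (f x) (Poly_Mapping.lookup p x))"
  unfolding pushforward_def using assms
  by (intro sum.mono_neutral_left) (auto simp: in_keys_iff)

lemma pushforward_add: "pushforward f (p + q) = pushforward f p + pushforward f q"
proof -
  let ?A = "Poly_Mapping.keys p \<union> Poly_Mapping.keys q"
  have "Poly_Mapping.keys (p + q) \<subseteq> ?A" by (rule Poly_Mapping.keys_add)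
  then show ?thesis
    by (simp add: pushforward_superset[of ?A] lookup_add single_add sum.distrib)
qed

lemma pushforward_pscale: "pushforward f (pscale k p) = pscale k (pushforward f p)"
proof -
  have "Poly_Mapping.keys (pscale k p) \<subseteq> Poly_Mapping.keys p" by (auto simp: in_keys_iff)
  then show ?thesis
    by (simp add: pushforward_superset[of "Poly_Mapping.keys p"] pm.scale_sum_right)
qed

lemma pushforward_single [simp]:
  "pushforward f (Poly_Mapping.single x a) = Poly_Mapping.single (f x) a"
  by (simp add: pushforward_superset[of "{x}"])

lemma linear_pushforward: "Vector_Spaces.linear pscale pscale (pushforward f)"
  by unfold_locales (auto simp: pushforward_add pushforward_pscale algebra_simps)

lemma module_hom_pushforward: "module_hom pscale pscale (pushforward f)"
  using linear_pushforward by (simp add: Vector_Spaces.linear_iff_module_hom)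

lemma pm_in_span_singles: "p \<in> pm.span ((\<lambda>x. Poly_Mapping.single x 1) ` Poly_Mapping.keys p)"
proof -
  have "p = (\<Sum>x\<in>Poly_Mapping.keys p. pscale (Poly_Mapping.lookup p x) (Poly_Mapping.single x 1))"
    by (intro poly_mapping_eqI)
       (auto simp: lookup_sum lookup_single when_def in_keys_iff)
  then show ?thesis
    by (metis (no_types, lifting) imageI pm.span_base pm.span_scale pm.span_sum)
qed

lemma pm_span_singles: "pm.span (range (\<lambda>x. Poly_Mapping.single x 1)) = UNIV"
  using pm_in_span_singles by (metis UNIV_eq_I image_mono in_mono pm.span_mono subset_UNIV)

lemma equivp_diff_subspace:
  assumes "module.subspace s I" "module s"
  shows "equivp (\<lambda>x y. x - y \<in> I)"
proof (rule equivpI)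
  interpret module s by fact
  have *: "subspace I" by fact
  show "reflp (\<lambda>x y. x - y \<in> I)" using * by (auto simp: reflp_def subspace_0)
  show "symp (\<lambda>x y. x - y \<in> I)" using subspace_neg[OF *] by (fastforce simp: symp_def)
  show "transp (\<lambda>x y. x - y \<in> I)" using subspace_add[OF *]
    by (fastforce simp: transp_def)
qed


section \<open>The Ramond superalgebra\<close>

datatype ramond_gen = Lgen int | Ggen int | Cgen

fun odd_gen :: "ramond_gen \<Rightarrow> bool" where
  "odd_gen (Ggen m) = True"
| "odd_gen _ = False"

text \<open>The superbracket on basis elements, with values in the vector space on the basis.\<close>

fun ramond_bracket :: "ramond_gen \<Rightarrow> ramond_gen \<Rightarrow> (ramond_gen \<Rightarrow>\<^sub>0 complex)" where
  "ramond_bracket (Lgen m) (Lgen n) =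
     Poly_Mapping.single (Lgen (m + n)) (of_int (m - n)) +
     Poly_Mapping.single Cgen (if m = - n then of_int (m ^ 3 - m) / 12 else 0)"
| "ramond_bracket (Ggen m) (Lgen n) =
     Poly_Mapping.single (Ggen (m + n)) (of_int m - of_int n / 2)"
| "ramond_bracket (Lgen n) (Ggen m) =
     - Poly_Mapping.single (Ggen (m + n)) (of_int m - of_int n / 2)"
| "ramond_bracket (Ggen m) (Ggen n) =
     Poly_Mapping.single (Lgen (m + n)) 2 +
     Poly_Mapping.single Cgen (if m = - n then (of_int m ^ 2 - 1 / 4) / 3 else 0)"
| "ramond_bracket Cgen _ = 0"
| "ramond_bracket _ Cgen = 0"


section \<open>Its universal enveloping algebra\<close>

text \<open>The tensor algebra of the superalgebra is the free associative algebra on its basis, i.e.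
  the monoid algebra of the free monoid of words. Monoids are written additively here, so that
  the convolution product of finitely supported functions is available.\<close>

datatype word = Word (letters: "ramond_gen list")

instantiation word :: monoid_add
begin
definition zero_word :: word where "zero_word = Word []"
definition plus_word :: "word \<Rightarrow> word \<Rightarrow> word" where "plus_word v w = Word (letters v @ letters w)"
instance by standard (auto simp: zero_word_def plus_word_def)
end

type_synonym tensor_alg = "word \<Rightarrow>\<^sub>0 complex"

definition tgen :: "ramond_gen \<Rightarrow> tensor_alg"
  where "tgen x = Poly_Mapping.single (Word [x]) 1"

definition tlin :: "(ramond_gen \<Rightarrow>\<^sub>0 complex) \<Rightarrow> tensor_alg"
  where "tlin = pushforward (\<lambda>x. Word [x])"

definition ramond_relator :: "ramond_gen \<Rightarrow> ramond_gen \<Rightarrow> tensor_alg" where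
  "ramond_relator x y =
     tgen x * tgen y - (if odd_gen x \<and> odd_gen y then - 1 else 1) * (tgen y * tgen x)
     - tlin (ramond_bracket x y)"

definition ramond_ideal :: "tensor_alg set"
  where "ramond_ideal = pm.span {a * ramond_relator x y * b | a x y b. True}"

lemma pscale_conv_mult: "pscale k (p :: tensor_alg) = Poly_Mapping.single 0 k * p"
  unfolding pscale_def by (rule mult_map_scale_conv_mult)

lemma pscale_mult_left: "pscale k p * (q :: tensor_alg) = pscale k (p * q)"
  by (simp add: pscale_conv_mult mult.assoc)

lemma single_zero_commute:
  "Poly_Mapping.single 0 k * p = p * Poly_Mapping.single (0 :: word) (k :: complex)"
proof -
  have "p \<in> pm.span (range (\<lambda>x. Poly_Mapping.single x 1))" by (simp add: pm_span_singles)
  then show ?thesis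
  proof (induction rule: pm.span_induct_alt)
    case base then show ?case by simp
  next
    case (step c x y)
    then show ?case by (auto simp: distrib_left distrib_right mult_single mult.commute)
  qed
qed

lemma pscale_mult_right: "p * pscale k (q :: tensor_alg) = pscale k (p * q)"
  by (metis mult.assoc pscale_conv_mult single_zero_commute)

lemma ramond_ideal_mult:
  assumes "p \<in> ramond_ideal" shows "a * p \<in> ramond_ideal" "p * a \<in> ramond_ideal"
proof -
  show "a * p \<in> ramond_ideal"
    using assms unfolding ramond_ideal_def
  proof (induction rule: pm.span_induct_alt)
    case base then show ?case by (simp add: pm.span_zero)
  next
    case (step c x y)
    then obtain a' u v b where "x = a' * ramond_relator u v * b" by blast
    then have "a * x = (a * a') * ramond_relator u v * b" by (simp add: mult.assoc)
    then have "a * x \<in> pm.span {a * ramond_relator x y * b | a x y b. True}"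
      by (intro pm.span_base) blast
    with step show ?case
      by (simp add: distrib_left pscale_mult_right pm.span_add pm.span_scale)
  qed
  show "p * a \<in> ramond_ideal"
    using assms unfolding ramond_ideal_def
  proof (induction rule: pm.span_induct_alt)
    case base then show ?case by (simp add: pm.span_zero)
  next
    case (step c x y)
    then obtain a' u v b where "x = a' * ramond_relator u v * b" by blast
    then have "x * a = a' * ramond_relator u v * (b * a)" by (simp add: mult.assoc)
    then have "x * a \<in> pm.span {a * ramond_relator x y * b | a x y b. True}"
      by (intro pm.span_base) blast
    with step show ?case
      by (simp add: distrib_right pscale_mult_left pm.span_add pm.span_scale)
  qed
qed

definition ramond_cong :: "tensor_alg \<Rightarrow> tensor_alg \<Rightarrow> bool"
  where "ramond_cong p q \<longleftrightarrow> p - q \<in> ramond_ideal"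

lemma subspace_ramond_ideal: "pm.subspace ramond_ideal"
  unfolding ramond_ideal_def by (rule pm.subspace_span)

lemma equivp_ramond_cong: "equivp ramond_cong"
  using equivp_diff_subspace[OF subspace_ramond_ideal pm.module_axioms]
  unfolding ramond_cong_def .

quotient_type ramond_U = tensor_alg / ramond_cong
  by (rule equivp_ramond_cong)

lemma ramond_cong_refl [simp]: "ramond_cong p p"
  by (rule equivp_reflp[OF equivp_ramond_cong])

instantiation ramond_U :: "{ring, monoid_mult}"
begin
lift_definition zero_ramond_U :: ramond_U is 0 .
lift_definition one_ramond_U :: ramond_U is 1 .
lift_definition plus_ramond_U :: "ramond_U \<Rightarrow> ramond_U \<Rightarrow> ramond_U" is "(+)"
  unfolding ramond_cong_def using pm.subspace_add[OF subspace_ramond_ideal] by (simp add: add_diff_add)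
lift_definition minus_ramond_U :: "ramond_U \<Rightarrow> ramond_U \<Rightarrow> ramond_U" is "(-)"
  unfolding ramond_cong_def by (drule (1) pm.subspace_diff[OF subspace_ramond_ideal]) (simp add: algebra_simps)
lift_definition uminus_ramond_U :: "ramond_U \<Rightarrow> ramond_U" is "uminus"
  unfolding ramond_cong_def by (drule pm.subspace_neg[OF subspace_ramond_ideal]) simp
lift_definition times_ramond_U :: "ramond_U \<Rightarrow> ramond_U \<Rightarrow> ramond_U" is "(*)"
proof -
  fix p p' q q' assume "ramond_cong p p'" "ramond_cong q q'"
  then have "p * (q - q') + (p - p') * q' \<in> ramond_ideal"
    unfolding ramond_cong_def
    by (intro pm.subspace_add[OF subspace_ramond_ideal] ramond_ideal_mult)
  then show "ramond_cong (p * q) (p' * q')"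
    unfolding ramond_cong_def by (simp add: algebra_simps)
qed
instance
  by standard (transfer; simp add: algebra_simps)+
end

lift_definition Uscale :: "complex \<Rightarrow> ramond_U \<Rightarrow> ramond_U" is pscale
  unfolding ramond_cong_def by (drule pm.subspace_scale[OF subspace_ramond_ideal])
    (simp add: pm.scale_right_diff_distrib)

lift_definition Ugen :: "ramond_gen \<Rightarrow> ramond_U" is tgen .

interpretation U: vector_space Uscale
  by unfold_locales (transfer; simp add: pm.scale_left_distrib pm.scale_right_distrib)+

lift_definition Ulin :: "(ramond_gen \<Rightarrow>\<^sub>0 complex) \<Rightarrow> ramond_U" is tlin .

lemma Ugen_relation:
  "Ugen x * Ugen y = (if odd_gen x \<and> odd_gen y then - 1 else 1) * (Ugen y * Ugen x)
     + Ulin (ramond_bracket x y)"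
proof -
  have "1 * ramond_relator x y * 1 \<in> ramond_ideal"
    unfolding ramond_ideal_def by (rule pm.span_base) blast
  then show ?thesis
    by (transfer fixing: x y) (auto simp: ramond_cong_def ramond_relator_def algebra_simps)
qed

lemma Ulin_single: "Ulin (Poly_Mapping.single x a) = Uscale a (Ugen x)"
  by transfer (simp add: tlin_def tgen_def)

lemma Ulin_add: "Ulin (p + q) = Ulin p + Ulin q"
  by transfer (simp add: tlin_def pushforward_add)

lemma Ulin_zero: "Ulin 0 = 0"
  using Ulin_add[of 0 0] by simp

definition Umon :: "ramond_gen list \<Rightarrow> ramond_U"
  where "Umon xs = prod_list (map Ugen xs)"

lemma Umon_abs: "Umon xs = abs_ramond_U (Poly_Mapping.single (Word xs) 1)"
proof (induction xs)
  case Nil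
  then show ?case by (simp add: Umon_def one_ramond_U_def flip: zero_word_def)
next
  case (Cons x xs)
  have "Umon (x # xs) = Ugen x * Umon xs" by (simp add: Umon_def)
  also have "\<dots> = abs_ramond_U (tgen x * Poly_Mapping.single (Word xs) 1)"
    by (simp add: Cons Ugen.abs_eq times_ramond_U.abs_eq)
  finally show ?case by (simp add: tgen_def mult_single plus_word_def)
qed

lemma U_span_Umon: "u \<in> U.span (range Umon)"
proof -
  have "abs_ramond_U p \<in> U.span (range Umon)" for p
  proof -
    have "p \<in> pm.span (range (\<lambda>x. Poly_Mapping.single x 1))" by (simp add: pm_span_singles)
    then show ?thesis
    proof (induction rule: pm.span_induct_alt)
      case base
      then show ?case using U.span_zero by (simp add: zero_ramond_U_def)
    next
      case (step c x y)
      then obtain w where "x = Poly_Mapping.single (Word w) 1" by (metis rangeE word.exhaust)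
      then have "abs_ramond_U (pscale c x + y) = Uscale c (Umon w) + abs_ramond_U y"
        by (simp only: Umon_abs Uscale.abs_eq plus_ramond_U.abs_eq)
      then show ?case using step by (simp add: U.span_add U.span_scale U.span_base)
    qed
  qed
  then show ?thesis by (metis Quotient_abs_rep Quotient_ramond_U)
qed

lemma Uscale_mult: "Uscale k u * v = Uscale k (u * v)" "u * Uscale k v = Uscale k (u * v)"
  by (transfer; simp add: pscale_mult_left pscale_mult_right)+


lifting_forget ramond_U.lifting


section \<open>The generalised Verma module\<close>

text \<open>The pair \<open>(a, b)\<close> stands for \<open>a v + b G\<^sub>0 v\<close>, with \<open>v\<close> even.\<close>

type_synonym top_space = "complex \<times> complex"

definition Sscale :: "complex \<Rightarrow> top_space \<Rightarrow> top_space"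
  where "Sscale k s = (k * fst s, k * snd s)"

definition v_even :: top_space where "v_even = (1, 0)"
definition v_odd :: top_space where "v_odd = (0, 1)"

definition ramond_plus :: "ramond_gen set"
  where "ramond_plus = {Cgen} \<union> {Lgen n | n. n \<ge> 0} \<union> {Ggen m | m. m \<ge> 0}"

text \<open>The action of \<open>ramond_plus\<close>; the values at the negative modes are never used.\<close>

fun Sact :: "complex \<Rightarrow> complex \<Rightarrow> ramond_gen \<Rightarrow> top_space \<Rightarrow> top_space" where
  "Sact c h Cgen (a, b) = (c * a, c * b)"
| "Sact c h (Lgen n) (a, b) = (if n = 0 then (h * a, h * b) else (0, 0))"
| "Sact c h (Ggen m) (a, b) = (if m = 0 then ((h - c / 24) * b, a) else (0, 0))"

text \<open>The tensor product over the enveloping algebra of the nonnegative part is the quotient of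
  the formal linear combinations of pairs by the bilinearity relations and the relations which
  move an element of that subalgebra across the tensor sign. Since this subalgebra is generated by
  \<open>ramond_plus\<close>, it suffices to move these generators.\<close>

type_synonym formal_tensor = "(ramond_U \<times> top_space) \<Rightarrow>\<^sub>0 complex"

abbreviation fpair :: "ramond_U \<Rightarrow> top_space \<Rightarrow> formal_tensor"
  where "fpair u s \<equiv> Poly_Mapping.single (u, s) 1"

definition tensor_relations :: "complex \<Rightarrow> complex \<Rightarrow> formal_tensor set" where
  "tensor_relations c h =
     {fpair (u + u') s - fpair u s - fpair u' s | u u' s. True} \<union>
     {fpair u (s + s') - fpair u s - fpair u s' | u s s'. True} \<union>
     {fpair (Uscale k u) s - pscale k (fpair u s) | k u s. True} \<union>
     {fpair u (Sscale k s) - pscale k (fpair u s) | k u s. True} \<union>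
     {fpair (u * Ugen x) s - fpair u (Sact c h x s) | u x s. x \<in> ramond_plus}"

definition tensor_cong :: "complex \<Rightarrow> complex \<Rightarrow> formal_tensor \<Rightarrow> formal_tensor \<Rightarrow> bool"
  where "tensor_cong c h p q \<longleftrightarrow> p - q \<in> pm.span (tensor_relations c h)"

lemma equivp_tensor_cong: "equivp (tensor_cong c h)"
  using equivp_diff_subspace[OF pm.subspace_span pm.module_axioms]
  unfolding tensor_cong_def .

definition central_charge :: complex where "central_charge = - 21 / 4"
definition lowest_weight :: complex where "lowest_weight = - 3 / 32"

quotient_type verma = formal_tensor / "tensor_cong central_charge lowest_weight"
  by (rule equivp_tensor_cong)

lemma tensor_cong_refl [simp]: "tensor_cong c h p p"
  by (rule equivp_reflp[OF equivp_tensor_cong])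

instantiation verma :: ab_group_add
begin
lift_definition zero_verma :: verma is 0 .
lift_definition plus_verma :: "verma \<Rightarrow> verma \<Rightarrow> verma" is "(+)"
  unfolding tensor_cong_def using pm.span_add by (simp add: add_diff_add)
lift_definition minus_verma :: "verma \<Rightarrow> verma \<Rightarrow> verma" is "(-)"
  unfolding tensor_cong_def by (drule (1) pm.span_diff) (simp add: algebra_simps)
lift_definition uminus_verma :: "verma \<Rightarrow> verma" is "uminus"
  unfolding tensor_cong_def by (drule pm.span_neg) simp
instance
  by standard (transfer; simp add: algebra_simps)+
end

lift_definition Vscale :: "complex \<Rightarrow> verma \<Rightarrow> verma" is pscale
  unfolding tensor_cong_def by (drule pm.span_scale) (simp add: pm.scale_right_diff_distrib)

interpretation V: vector_space Vscale
  by unfold_locales (transfer; simp add: pm.scale_left_distrib pm.scale_right_distrib)+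

lift_definition tensor :: "ramond_U \<Rightarrow> top_space \<Rightarrow> verma" is fpair .

lemma tensor_cong_relation:
  assumes "p - q \<in> tensor_relations c h" shows "tensor_cong c h p q"
  unfolding tensor_cong_def using assms by (rule pm.span_base)

lemma tensor_add_left: "tensor (u + u') s = tensor u s + tensor u' s"
  by transfer (rule tensor_cong_relation, unfold tensor_relations_def diff_diff_eq[symmetric], blast)

lemma tensor_add_right: "tensor u (s + s') = tensor u s + tensor u s'"
  by transfer (rule tensor_cong_relation, unfold tensor_relations_def diff_diff_eq[symmetric], blast)

lemma tensor_scale_left: "tensor (Uscale k u) s = Vscale k (tensor u s)"
  by transfer (rule tensor_cong_relation, unfold tensor_relations_def, blast)

lemma tensor_scale_right: "tensor u (Sscale k s) = Vscale k (tensor u s)"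
  by transfer (rule tensor_cong_relation, unfold tensor_relations_def, blast)

lemma tensor_balanced:
  "x \<in> ramond_plus \<Longrightarrow> tensor (u * Ugen x) s = tensor u (Sact central_charge lowest_weight x s)"
  by transfer (rule tensor_cong_relation, unfold tensor_relations_def, blast)

text \<open>Linear maps on formal tensors respecting the relations.\<close>

lemma pushforward_tensor_cong:
  assumes "\<And>r. r \<in> tensor_relations c h \<Longrightarrow> pushforward f r \<in> tensor_relations c h"
    and "tensor_cong c h p q"
  shows "tensor_cong c h (pushforward f p) (pushforward f q)"
proof -
  interpret Vector_Spaces.linear pscale pscale "pushforward f :: formal_tensor \<Rightarrow> formal_tensor"
    by (rule linear_pushforward)
  have "pushforward f r \<in> pm.span (tensor_relations c h)"
    if "r \<in> pm.span (tensor_relations c h)" for r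
    using that
  proof (induction rule: pm.span_induct_alt)
    case base then show ?case by (simp add: zero pm.span_zero)
  next
    case (step k x y)
    then show ?case
      by (simp add: add scale pm.span_add pm.span_scale pm.span_base assms(1))
  qed
  with assms(2) show ?thesis
    unfolding tensor_cong_def by (metis diff)
qed

lift_definition Vact :: "ramond_U \<Rightarrow> verma \<Rightarrow> verma"
  is "\<lambda>u. pushforward (\<lambda>(u', s). (u * u', s))"
proof (rule pushforward_tensor_cong)
  fix u r assume "r \<in> tensor_relations central_charge lowest_weight"
  then consider
      (1) v v' s where "r = fpair (v + v') s - fpair v s - fpair v' s"
    | (2) v s s' where "r = fpair v (s + s') - fpair v s - fpair v s'"
    | (3) k v s where "r = fpair (Uscale k v) s - pscale k (fpair v s)"
    | (4) k v s where "r = fpair v (Sscale k s) - pscale k (fpair v s)"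
    | (5) v x s where "r = fpair (v * Ugen x) s - fpair v (Sact central_charge lowest_weight x s)" "x \<in> ramond_plus"
    unfolding tensor_relations_def by blast
  then show "pushforward (\<lambda>(u', s). (u * u', s)) r \<in> tensor_relations central_charge lowest_weight"
  proof cases
    case 1
    then have "pushforward (\<lambda>(u', s). (u * u', s)) r
        = fpair (u * v + u * v') s - fpair (u * v) s - fpair (u * v') s"
      by (simp add: module_hom.diff[OF module_hom_pushforward] distrib_left)
    then show ?thesis unfolding tensor_relations_def by blast
  next
    case 2
    then have "pushforward (\<lambda>(u', s). (u * u', s)) r
        = fpair (u * v) (s + s') - fpair (u * v) s - fpair (u * v) s'"
      by (simp add: module_hom.diff[OF module_hom_pushforward])
    then show ?thesis unfolding tensor_relations_def by blast
  next
    case 3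
    then have "pushforward (\<lambda>(u', s). (u * u', s)) r
        = fpair (Uscale k (u * v)) s - pscale k (fpair (u * v) s)"
      by (simp add: module_hom.diff[OF module_hom_pushforward] Uscale_mult)
    then show ?thesis unfolding tensor_relations_def by blast
  next
    case 4
    then have "pushforward (\<lambda>(u', s). (u * u', s)) r
        = fpair (u * v) (Sscale k s) - pscale k (fpair (u * v) s)"
      by (simp add: module_hom.diff[OF module_hom_pushforward])
    then show ?thesis unfolding tensor_relations_def by blast
  next
    case 5
    then have "pushforward (\<lambda>(u', s). (u * u', s)) r
        = fpair ((u * v) * Ugen x) s - fpair (u * v) (Sact central_charge lowest_weight x s)"
      by (simp add: module_hom.diff[OF module_hom_pushforward] mult.assoc)
    then show ?thesis unfolding tensor_relations_def using 5(2) by blast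
  qed
qed

text \<open>The operator \<open>u \<otimes> s \<mapsto> u \<otimes> G\<^sub>0 s\<close>. Well-definedness rests on \<open>G\<^sub>0\<close> commuting
  with the action of \<open>ramond_plus\<close> on the top space.\<close>

lemma Sact_G0_commute:
  "x \<in> ramond_plus \<Longrightarrow> Sact c h (Ggen 0) (Sact c h x s) = Sact c h x (Sact c h (Ggen 0) s)"
  by (cases s; cases x) auto

lemma Sact_add: "Sact c h x (s + s') = Sact c h x s + Sact c h x s'"
  by (cases s; cases s'; cases x) (auto simp: algebra_simps)

lemma Sact_scale: "Sact c h x (Sscale k s) = Sscale k (Sact c h x s)"
  by (cases s; cases x) (auto simp: Sscale_def)

lift_definition Vtheta :: "verma \<Rightarrow> verma"
  is "pushforward (\<lambda>(u, s). (u, Sact central_charge lowest_weight (Ggen 0) s))"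
proof (rule pushforward_tensor_cong)
  let ?G = "Sact central_charge lowest_weight (Ggen 0)"
  fix r assume "r \<in> tensor_relations central_charge lowest_weight"
  then consider
      (1) v v' s where "r = fpair (v + v') s - fpair v s - fpair v' s"
    | (2) v s s' where "r = fpair v (s + s') - fpair v s - fpair v s'"
    | (3) k v s where "r = fpair (Uscale k v) s - pscale k (fpair v s)"
    | (4) k v s where "r = fpair v (Sscale k s) - pscale k (fpair v s)"
    | (5) v x s where "r = fpair (v * Ugen x) s - fpair v (Sact central_charge lowest_weight x s)" "x \<in> ramond_plus"
    unfolding tensor_relations_def by blast
  then show "pushforward (\<lambda>(u, s). (u, ?G s)) r \<in> tensor_relations central_charge lowest_weight"
  proof cases
    case 1
    then have "pushforward (\<lambda>(u, s). (u, ?G s)) r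
        = fpair (v + v') (?G s) - fpair v (?G s) - fpair v' (?G s)"
      by (simp add: module_hom.diff[OF module_hom_pushforward])
    then show ?thesis unfolding tensor_relations_def by blast
  next
    case 2
    then have "pushforward (\<lambda>(u, s). (u, ?G s)) r
        = fpair v (?G s + ?G s') - fpair v (?G s) - fpair v (?G s')"
      by (simp add: module_hom.diff[OF module_hom_pushforward] Sact_add)
    then show ?thesis unfolding tensor_relations_def by blast
  next
    case 3
    then have "pushforward (\<lambda>(u, s). (u, ?G s)) r
        = fpair (Uscale k v) (?G s) - pscale k (fpair v (?G s))"
      by (simp add: module_hom.diff[OF module_hom_pushforward])
    then show ?thesis unfolding tensor_relations_def by blast
  next
    case 4
    then have "pushforward (\<lambda>(u, s). (u, ?G s)) r
        = fpair v (Sscale k (?G s)) - pscale k (fpair v (?G s))"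
      by (simp add: module_hom.diff[OF module_hom_pushforward] Sact_scale)
    then show ?thesis unfolding tensor_relations_def by blast
  next
    case 5
    then have "pushforward (\<lambda>(u, s). (u, ?G s)) r
        = fpair (v * Ugen x) (?G s) - fpair v (Sact central_charge lowest_weight x (?G s))"
      by (simp add: module_hom.diff[OF module_hom_pushforward] Sact_G0_commute)
    then show ?thesis unfolding tensor_relations_def using 5(2) by blast
  qed
qed

lemma Vact_tensor [simp]: "Vact u (tensor u' s) = tensor (u * u') s"
  by transfer simp

lemma Vtheta_tensor [simp]: "Vtheta (tensor u s) = tensor u (Sact central_charge lowest_weight (Ggen 0) s)"
  by transfer simp

lemma linear_Vact: "Vector_Spaces.linear Vscale Vscale (Vact u)"
  by (unfold_locales; transfer fixing: u; simp add: pushforward_add pushforward_pscale)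

lemma linear_Vtheta: "Vector_Spaces.linear Vscale Vscale Vtheta"
  by (unfold_locales; transfer; simp add: pushforward_add pushforward_pscale)


lemma Vtheta_Vact: "Vtheta (Vact u x) = Vact u (Vtheta x)"
proof -
  have "module_hom pscale pscale (pushforward f)" for f :: "ramond_U \<times> top_space \<Rightarrow> ramond_U \<times> top_space"
    by (rule module_hom_pushforward)
  have "pushforward f (pushforward g p) = pushforward (f \<circ> g) p"
    for f g :: "ramond_U \<times> top_space \<Rightarrow> ramond_U \<times> top_space" and p
  proof -
    have "p \<in> pm.span (range (\<lambda>x. Poly_Mapping.single x 1))" by (simp add: pm_span_singles)
    then show ?thesis
    proof (induction rule: pm.span_induct_alt)
      case base then show ?case by (simp add: module_hom.zero[OF module_hom_pushforward])
    next
      case (step c x y)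
      then show ?case by (auto simp: pushforward_add pushforward_pscale)
    qed
  qed
  note comp = this
  show ?thesis
    by (transfer fixing: u) (simp add: comp o_def case_prod_unfold)
qed

lemma verma_induct [case_names tensor add]:
  assumes "\<And>u s. P (tensor u s)" and "\<And>x y. P x \<Longrightarrow> P y \<Longrightarrow> P (x + y)"
  shows "P x"
proof -
  have "P (abs_verma p)" for p
  proof -
    have "p \<in> pm.span (range (\<lambda>x. Poly_Mapping.single x 1))" by (simp add: pm_span_singles)
    then show ?thesis
    proof (induction rule: pm.span_induct_alt)
      case base
      have "tensor (Uscale 0 0) 0 = 0" by (simp only: tensor_scale_left V.scale_zero_left)
      then show ?case using assms(1)[of "Uscale 0 0" 0] by (simp add: zero_verma_def)
    next
      case (step c x y)
      then obtain u s where x: "x = fpair u s" by auto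
      have "abs_verma (pscale c x) = tensor (Uscale c u) s"
        unfolding tensor_scale_left x by (simp add: tensor.abs_eq Vscale.abs_eq)
      then show ?case using assms step by (simp add: plus_verma.abs_eq[symmetric])
    qed
  qed
  then show ?thesis by (metis Quotient_abs_rep Quotient_verma)
qed

lemma Vtheta_Vtheta: "Vtheta (Vtheta x) = Vscale (lowest_weight - central_charge / 24) x"
proof (induction x rule: verma_induct)
  case (tensor u s)
  have "Sact central_charge lowest_weight (Ggen 0) (Sact central_charge lowest_weight (Ggen 0) s) = Sscale (lowest_weight - central_charge / 24) s"
    by (cases s) (simp add: Sscale_def)
  then show ?case by (simp add: tensor_scale_right)
next
  case (add x y)
  then show ?case
    using linear_Vtheta by (simp add: Vector_Spaces.linear_iff V.scale_right_distrib)
qed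


section \<open>The irreducible quotient\<close>

text \<open>\<open>Vpart False\<close> is the even and \<open>Vpart True\<close> the odd part of the Verma module.\<close>

definition Vpart :: "bool \<Rightarrow> verma set" where
  "Vpart p = V.span
     ({tensor (Umon xs) v_even | xs. odd (length (filter odd_gen xs)) = p} \<union>
      {tensor (Umon xs) v_odd | xs. even (length (filter odd_gen xs)) = p})"

definition graded_submodule :: "verma set \<Rightarrow> bool" where
  "graded_submodule N \<longleftrightarrow>
     V.subspace N \<and> (\<forall>u. \<forall>x\<in>N. Vact u x \<in> N) \<and>
     (\<forall>x\<in>N. \<exists>y\<in>N \<inter> Vpart False. \<exists>z\<in>N \<inter> Vpart True. x = y + z)"

text \<open>The maximal proper graded submodule, obtained as the sum of all proper graded submodules.
  By \<open>max_submodule_unique\<close> below, it is the greatest one as soon as there is a greatest one.\<close>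

definition max_submodule :: "verma set"
  where "max_submodule = V.span (\<Union>{N. graded_submodule N \<and> N \<noteq> UNIV})"

lemma graded_submodule_max: "graded_submodule max_submodule"
proof -
  let ?A = "\<Union>{N. graded_submodule N \<and> N \<noteq> UNIV}"
  let ?Q = "\<lambda>x. (\<forall>u. Vact u x \<in> V.span ?A) \<and>
      (\<exists>y\<in>V.span ?A \<inter> Vpart False. \<exists>z\<in>V.span ?A \<inter> Vpart True. x = y + z)"
  have sub: "V.subspace (Vpart p)" for p unfolding Vpart_def by (rule V.subspace_span)
  have lin: "Vact u (x + y) = Vact u x + Vact u y" "Vact u (Vscale k x) = Vscale k (Vact u x)"
      "Vact u 0 = 0" for u x y k
    using linear_Vact[of u]
    by (simp_all add: Vector_Spaces.linear_iff_module_hom module_hom.add module_hom.scale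
        module_hom.zero)
  have "?Q x" if "x \<in> V.span ?A" for x
    using that
  proof (induction rule: V.span_induct_alt)
    case base
    then show ?case
      by (auto simp: lin V.span_zero V.subspace_0[OF sub] intro!: bexI[of _ 0])
  next
    case (step c x y)
    from step(1) obtain N where N: "graded_submodule N" "N \<noteq> UNIV" "x \<in> N" by blast
    then have NA: "N \<subseteq> V.span ?A" by (auto intro: V.span_base)
    from N obtain x0 x1 where x: "x0 \<in> N \<inter> Vpart False" "x1 \<in> N \<inter> Vpart True" "x = x0 + x1"
      unfolding graded_submodule_def by blast
    from step obtain y0 y1 where y: "y0 \<in> V.span ?A \<inter> Vpart False"
        "y1 \<in> V.span ?A \<inter> Vpart True" "y = y0 + y1" by blast
    have "Vact u x \<in> V.span ?A" for u using N NA unfolding graded_submodule_def by blast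
    then have 1: "Vact u (Vscale c x + y) \<in> V.span ?A" for u
      using step by (simp add: lin V.span_add V.span_scale)
    have "Vscale c x0 + y0 \<in> V.span ?A \<inter> Vpart False"
      using x y NA by (auto intro!: V.span_add V.span_scale V.subspace_add[OF sub] V.subspace_scale[OF sub])
    moreover have "Vscale c x1 + y1 \<in> V.span ?A \<inter> Vpart True"
      using x y NA by (auto intro!: V.span_add V.span_scale V.subspace_add[OF sub] V.subspace_scale[OF sub])
    moreover have "Vscale c x + y = (Vscale c x0 + y0) + (Vscale c x1 + y1)"
      using x y by (simp add: V.scale_right_distrib)
    ultimately show ?case using 1 by blast
  qed
  then show ?thesis
    unfolding graded_submodule_def max_submodule_def by (simp add: V.subspace_span)
qed

lemma max_submodule_contains:
  "graded_submodule N \<Longrightarrow> N \<noteq> UNIV \<Longrightarrow> N \<subseteq> max_submodule"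
  unfolding max_submodule_def by (auto intro: V.span_base)

lemma max_submodule_unique:
  assumes "graded_submodule N" "N \<noteq> UNIV"
    and "\<And>N'. graded_submodule N' \<Longrightarrow> N' \<noteq> UNIV \<Longrightarrow> N' \<subseteq> N"
  shows "N = max_submodule"
proof
  show "N \<subseteq> max_submodule" using assms by (intro max_submodule_contains)
  have "V.subspace N" using assms unfolding graded_submodule_def by blast
  then show "max_submodule \<subseteq> N"
    unfolding max_submodule_def using assms(3) by (intro V.span_minimal) auto
qed

lemma Vtheta_Vpart: "x \<in> Vpart p \<Longrightarrow> Vtheta x \<in> Vpart (\<not> p)"
proof -
  interpret T: Vector_Spaces.linear Vscale Vscale Vtheta by (rule linear_Vtheta)
  have 1: "Vtheta (tensor u v_even) = tensor u v_odd" for u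
    by (simp add: v_even_def v_odd_def)
  have "Sact central_charge lowest_weight (Ggen 0) v_odd = Sscale (lowest_weight - central_charge / 24) v_even"
    by (simp add: v_even_def v_odd_def Sscale_def)
  then have 2: "Vtheta (tensor u v_odd) = Vscale (lowest_weight - central_charge / 24) (tensor u v_even)" for u
    by (simp add: tensor_scale_right)
  assume "x \<in> Vpart p"
  then show ?thesis
    unfolding Vpart_def
  proof (induction rule: V.span_induct_alt)
    case base then show ?case by (simp add: T.zero V.span_zero)
  next
    case (step c x y)
    have "Vtheta x \<in> V.span
       ({tensor (Umon xs) v_even | xs. odd (length (filter odd_gen xs)) = (\<not> p)} \<union>
        {tensor (Umon xs) v_odd | xs. even (length (filter odd_gen xs)) = (\<not> p)})"
      using step(1)
    proof
      assume "x \<in> {tensor (Umon xs) v_even | xs. odd (length (filter odd_gen xs)) = p}"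
      then show ?thesis using 1 by (intro V.span_base) (auto simp del: Vtheta_tensor)
    next
      assume "x \<in> {tensor (Umon xs) v_odd | xs. even (length (filter odd_gen xs)) = p}"
      then have "\<exists>y. Vtheta x = Vscale (lowest_weight - central_charge / 24) y \<and>
          y \<in> {tensor (Umon xs) v_even | xs. odd (length (filter odd_gen xs)) = (\<not> p)}"
        using 2 by (auto simp del: Vtheta_tensor)
      then show ?thesis by (metis (no_types, lifting) UnI1 V.span_base V.span_scale)
    qed
    then show ?case using step by (simp add: T.add T.scale V.span_add V.span_scale)
  qed
qed

lemma Vtheta_max_submodule:
  assumes "x \<in> max_submodule" shows "Vtheta x \<in> max_submodule"
proof -
  interpret T: Vector_Spaces.linear Vscale Vscale Vtheta by (rule linear_Vtheta)
  have inj: "x = y" if "Vtheta x = Vtheta y" for x y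
  proof -
    have "Vscale (lowest_weight - central_charge / 24) x = Vscale (lowest_weight - central_charge / 24) y"
      using that by (metis Vtheta_Vtheta)
    moreover have "lowest_weight - central_charge / 24 \<noteq> 0" by (simp add: lowest_weight_def central_charge_def)
    ultimately show ?thesis using V.scale_left_imp_eq by blast
  qed
  have proper: "graded_submodule (Vtheta ` N) \<and> Vtheta ` N \<noteq> UNIV"
    if N: "graded_submodule N" "N \<noteq> UNIV" for N
  proof
    have sub: "V.subspace (Vtheta ` N)"
      using N unfolding graded_submodule_def by (intro T.subspace_image) blast
    have act: "Vact u x \<in> Vtheta ` N" if "x \<in> Vtheta ` N" for u x
      using that N unfolding graded_submodule_def by (auto simp: Vtheta_Vact[symmetric])
    have grd: "\<exists>y\<in>Vtheta ` N \<inter> Vpart False. \<exists>z\<in>Vtheta ` N \<inter> Vpart True. x = y + z"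
      if x: "x \<in> Vtheta ` N" for x
    proof -
      from x obtain w where w: "w \<in> N" "x = Vtheta w" by blast
      then obtain y z where yz: "y \<in> N \<inter> Vpart False" "z \<in> N \<inter> Vpart True" "w = y + z"
        using N unfolding graded_submodule_def by blast
      have "Vtheta z \<in> Vtheta ` N \<inter> Vpart False" "Vtheta y \<in> Vtheta ` N \<inter> Vpart True"
        using Vtheta_Vpart[of z True] Vtheta_Vpart[of y False] yz by auto
      moreover have "x = Vtheta z + Vtheta y" using w yz by (simp add: T.add add.commute)
      ultimately show ?thesis by blast
    qed
    show "graded_submodule (Vtheta ` N)"
      unfolding graded_submodule_def using sub act grd by blast
    show "Vtheta ` N \<noteq> UNIV"
    proof
      assume *: "Vtheta ` N = UNIV"
      have "x \<in> N" for x
      proof -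
        have "Vtheta x \<in> Vtheta ` N" using * by simp
        then obtain n where "n \<in> N" "Vtheta x = Vtheta n" by blast
        then show ?thesis using inj by blast
      qed
      then show False using N(2) by blast
    qed
  qed
  show ?thesis using assms unfolding max_submodule_def
  proof (induction rule: V.span_induct_alt)
    case base then show ?case by (simp add: T.zero V.span_zero)
  next
    case (step c x y)
    then obtain N where "graded_submodule N" "N \<noteq> UNIV" "x \<in> N" by blast
    then have "Vtheta x \<in> V.span (\<Union>{N. graded_submodule N \<and> N \<noteq> UNIV})"
      using proper[of N] by (intro V.span_base) blast
    then show ?case using step by (simp add: T.add T.scale V.span_add V.span_scale)
  qed
qed

definition irr_cong :: "verma \<Rightarrow> verma \<Rightarrow> bool"
  where "irr_cong x y \<longleftrightarrow> x - y \<in> max_submodule"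

lemma subspace_max: "V.subspace max_submodule"
  unfolding max_submodule_def by (rule V.subspace_span)

lemma equivp_irr_cong: "equivp irr_cong"
  using equivp_diff_subspace[OF subspace_max V.module_axioms]
  unfolding irr_cong_def .

quotient_type ramond_L = verma / irr_cong
  by (rule equivp_irr_cong)

lifting_forget verma.lifting

lemma irr_cong_refl [simp]: "irr_cong p p"
  by (rule equivp_reflp[OF equivp_irr_cong])

instantiation ramond_L :: ab_group_add
begin
lift_definition zero_ramond_L :: ramond_L is 0 .
lift_definition plus_ramond_L :: "ramond_L \<Rightarrow> ramond_L \<Rightarrow> ramond_L" is "(+)"
  unfolding irr_cong_def using V.subspace_add[OF subspace_max] by (simp add: add_diff_add)
lift_definition minus_ramond_L :: "ramond_L \<Rightarrow> ramond_L \<Rightarrow> ramond_L" is "(-)"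
  unfolding irr_cong_def by (drule (1) V.subspace_diff[OF subspace_max]) (simp add: algebra_simps)
lift_definition uminus_ramond_L :: "ramond_L \<Rightarrow> ramond_L" is "uminus"
  unfolding irr_cong_def by (drule V.subspace_neg[OF subspace_max]) simp
instance
  by standard (transfer; simp add: algebra_simps)+
end

lift_definition Lscale :: "complex \<Rightarrow> ramond_L \<Rightarrow> ramond_L" is Vscale
  unfolding irr_cong_def by (drule V.subspace_scale[OF subspace_max])
    (simp add: V.scale_right_diff_distrib)

interpretation LV: vector_space Lscale
  by unfold_locales (transfer; simp add: V.scale_left_distrib V.scale_right_distrib)+

lift_definition Lproj :: "verma \<Rightarrow> ramond_L" is "\<lambda>x. x" .

lift_definition Lact :: "ramond_U \<Rightarrow> ramond_L \<Rightarrow> ramond_L" is Vact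
proof -
  fix u x y assume "irr_cong x y"
  then have "Vact u (x - y) \<in> max_submodule"
    using graded_submodule_max unfolding irr_cong_def graded_submodule_def by blast
  then show "irr_cong (Vact u x) (Vact u y)"
    unfolding irr_cong_def using linear_Vact[of u]
    by (simp add: Vector_Spaces.linear_iff_module_hom module_hom.diff)
qed

lift_definition Theta :: "ramond_L \<Rightarrow> ramond_L" is Vtheta
proof -
  fix x y assume "irr_cong x y"
  then have "Vtheta (x - y) \<in> max_submodule"
    unfolding irr_cong_def by (rule Vtheta_max_submodule)
  then show "irr_cong (Vtheta x) (Vtheta y)"
    unfolding irr_cong_def using linear_Vtheta
    by (simp add: Vector_Spaces.linear_iff_module_hom module_hom.diff)
qed


lemma linear_Theta: "Vector_Spaces.linear Lscale Lscale Theta"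
  using linear_Vtheta
  by (unfold_locales; transfer; simp add: Vector_Spaces.linear_iff)

lemma Theta_Lact: "Theta (Lact u x) = Lact u (Theta x)"
  by (transfer fixing: u) (simp add: Vtheta_Vact)

lemma Theta_tensor:
  "Theta (Lproj (tensor u s)) = Lproj (tensor u (Sact central_charge lowest_weight (Ggen 0) s))"
  by (transfer fixing: u s) simp

text \<open>\<open>Theta\<close> is the only linear map given by \<open>\<^bold>m w \<mapsto> \<^bold>m G\<^sub>0 w\<close> for
  monomials \<open>\<^bold>m\<close> in the negative modes and \<open>w\<close> in the top space.\<close>

definition ramond_minus :: "ramond_gen set"
  where "ramond_minus = {Lgen n | n. n < 0} \<union> {Ggen m | m. m < 0}"

lemma ramond_gen_cases: "x \<in> ramond_minus \<or> x \<in> ramond_plus"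
  by (cases x) (auto simp: ramond_minus_def ramond_plus_def)

lemma Vact_add_left: "Vact (u + u') x = Vact u x + Vact u' x"
proof (induction x rule: verma_induct)
  case (tensor v s) then show ?case by (simp add: distrib_right tensor_add_left)
next
  case (add x y)
  then show ?case
    using linear_Vact[of u] linear_Vact[of u'] linear_Vact[of "u + u'"]
    by (simp add: Vector_Spaces.linear_iff)
qed

lemma Vact_scale_left: "Vact (Uscale k u) x = Vscale k (Vact u x)"
proof (induction x rule: verma_induct)
  case (tensor v s) then show ?case by (simp add: Uscale_mult tensor_scale_left)
next
  case (add x y)
  then show ?case
    using linear_Vact[of u] linear_Vact[of "Uscale k u"]
    by (simp add: Vector_Spaces.linear_iff V.scale_right_distrib)
qed

lemma Vact_mult: "Vact (u * u') x = Vact u (Vact u' x)"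
proof (induction x rule: verma_induct)
  case (tensor v s) then show ?case by (simp add: mult.assoc)
next
  case (add x y)
  then show ?case
    using linear_Vact[of u] linear_Vact[of u'] linear_Vact[of "u * u'"]
    by (simp add: Vector_Spaces.linear_iff)
qed

lemma verma_span: "x \<in> V.span {tensor (Umon xs) s | xs s. set xs \<subseteq> ramond_minus}"
proof -
  let ?B = "{tensor (Umon xs) s | xs s. set xs \<subseteq> ramond_minus}"
  define W where "W = V.span ?B"
  have W: "V.subspace W" unfolding W_def by (rule V.subspace_span)
  have Cons: "Umon (x # xs) = Ugen x * Umon xs" for x xs by (simp add: Umon_def)
  have lin: "Vact u 0 = 0" "Vact u (x + y) = Vact u x + Vact u y"
      "Vact u (Vscale k x) = Vscale k (Vact u x)" for u x y k
    using linear_Vact[of u]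
    by (simp_all add: Vector_Spaces.linear_iff_module_hom module_hom.add module_hom.scale
        module_hom.zero)
  have ind: "Vact u w \<in> W" if "w \<in> W" "\<And>b. b \<in> ?B \<Longrightarrow> Vact u b \<in> W" for u w
    using that(1) unfolding W_def
  proof (induction rule: V.span_induct_alt)
    case base then show ?case by (simp add: lin V.span_zero)
  next
    case (step c x y)
    then show ?case using that(2)[of x] unfolding W_def by (simp add: lin V.span_add V.span_scale)
  qed
  have Ulin: "Vact (Ulin z) w \<in> W" if "\<And>x. Vact (Ugen x) w \<in> W" for z w
  proof -
    have "z \<in> pm.span (range (\<lambda>x. Poly_Mapping.single x 1))" by (simp add: pm_span_singles)
    then show ?thesis
    proof (induction rule: pm.span_induct_alt)
      case base
      have "Vact (Ulin 0) w = 0" using Vact_add_left[of 0 0 w] by (simp add: Ulin_zero)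
      then show ?case by (simp add: V.subspace_0[OF W])
    next
      case (step c x y)
      then show ?case using that
        by (auto simp: Ulin_add Ulin_single Vact_add_left Vact_scale_left
            intro!: V.subspace_add[OF W] V.subspace_scale[OF W])
    qed
  qed
  have minus: "Vact (Ugen x) w \<in> W" if "x \<in> ramond_minus" "w \<in> W" for x w
  proof (rule ind[OF that(2)])
    fix b assume "b \<in> ?B"
    then obtain xs s where "b = tensor (Umon xs) s" "set xs \<subseteq> ramond_minus" by blast
    then have "Vact (Ugen x) b = tensor (Umon (x # xs)) s \<and> set (x # xs) \<subseteq> ramond_minus"
      using that(1) by (simp add: Cons)
    then show "Vact (Ugen x) b \<in> W" unfolding W_def by (intro V.span_base) blast
  qed
  have base: "tensor (Umon xs) s \<in> W" if "set xs \<subseteq> ramond_minus" for xs s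
    unfolding W_def using that by (intro V.span_base) blast
  have gen: "Vact (Ugen x) (tensor (Umon xs) s) \<in> W" if "set xs \<subseteq> ramond_minus" for x xs s
    using that
  proof (induction xs arbitrary: x s)
    case Nil
    show ?case
    proof (cases "x \<in> ramond_minus")
      case True then show ?thesis using base[of "[]" s] by (intro minus) auto
    next
      case False
      then have "x \<in> ramond_plus" using ramond_gen_cases by blast
      then have "tensor (1 * Ugen x) s = tensor 1 (Sact central_charge lowest_weight x s)"
        by (rule tensor_balanced)
      then show ?thesis using base[of "[]"] by (simp add: Umon_def)
    qed
  next
    case (Cons y ys)
    let ?w = "tensor (Umon ys) s"
    have IH: "Vact (Ugen z) ?w \<in> W" for z using Cons by simp
    have y: "y \<in> ramond_minus" using Cons.prems by simp
    define e :: complex where "e = (if odd_gen x \<and> odd_gen y then - 1 else 1)"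
    have "(if odd_gen x \<and> odd_gen y then - 1 else 1) * (Ugen y * Ugen x)
        = Uscale e (Ugen y * Ugen x)"
      by (simp add: e_def U.scale_minus_left)
    then have "Ugen x * Ugen y = Uscale e (Ugen y * Ugen x) + Ulin (ramond_bracket x y)"
      using Ugen_relation[of x y] by simp
    moreover have "Vact (Ugen x) (tensor (Umon (y # ys)) s) = Vact (Ugen x * Ugen y) ?w"
      by (simp add: \<open>\<And>xs x. Umon (x # xs) = Ugen x * Umon xs\<close> mult.assoc)
    ultimately have "Vact (Ugen x) (tensor (Umon (y # ys)) s)
        = Vscale e (Vact (Ugen y) (Vact (Ugen x) ?w)) + Vact (Ulin (ramond_bracket x y)) ?w"
      by (simp only: Vact_add_left Vact_scale_left Vact_mult)
    moreover have "Vact (Ugen y) (Vact (Ugen x) ?w) \<in> W" by (intro minus y IH)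
    moreover have "Vact (Ulin (ramond_bracket x y)) ?w \<in> W" by (intro Ulin IH)
    ultimately show ?case
      by (simp add: V.subspace_add[OF W] V.subspace_scale[OF W])
  qed
  have all: "Vact (Ugen x) w \<in> W" if "w \<in> W" for x w
    by (rule ind[OF that]) (use gen in blast)
  have mon: "tensor (Umon xs) s \<in> W" for xs s
  proof (induction xs)
    case Nil then show ?case by (intro base) simp
  next
    case (Cons x xs)
    then show ?case using all[of "tensor (Umon xs) s" x]
      by (simp add: \<open>\<And>xs x. Umon (x # xs) = Ugen x * Umon xs\<close>)
  qed
  have ten: "tensor u s \<in> W" for u s
    using U_span_Umon[of u]
  proof (induction rule: U.span_induct_alt)
    case base
    have "tensor 0 s = 0" using tensor_add_left[of 0 0 s] by simp
    then show ?case by (simp add: V.subspace_0[OF W])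
  next
    case (step c x y)
    then obtain xs where "x = Umon xs" by blast
    then show ?case using step(2) mon[of xs s]
      by (simp add: tensor_add_left tensor_scale_left V.subspace_add[OF W] V.subspace_scale[OF W])
  qed
  have "x \<in> W"
    by (induction x rule: verma_induct) (auto intro: ten V.subspace_add[OF W])
  then show ?thesis unfolding W_def .
qed

lemma Theta_unique:
  assumes "Vector_Spaces.linear Lscale Lscale T"
    and "\<And>xs s. set xs \<subseteq> ramond_minus \<Longrightarrow>
      T (Lproj (tensor (Umon xs) s))
        = Lproj (tensor (Umon xs) (Sact central_charge lowest_weight (Ggen 0) s))"
  shows "T = Theta"
proof
  fix y
  interpret T: Vector_Spaces.linear Lscale Lscale T by fact
  interpret Th: Vector_Spaces.linear Lscale Lscale Theta by (rule linear_Theta)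
  have P: "Lproj 0 = 0" "Lproj (a + b) = Lproj a + Lproj b"
      "Lproj (Vscale k a) = Lscale k (Lproj a)" for a b k
    by (transfer; simp)+
  have *: "T (Lproj x) = Theta (Lproj x)" for x
    using verma_span[of x]
  proof (induction rule: V.span_induct_alt)
    case base then show ?case by (simp add: P T.zero Th.zero)
  next
    case (step c x y)
    then show ?case
      by (auto simp: P T.add Th.add T.scale Th.scale assms(2) Theta_tensor)
  qed
  obtain x where "y = Lproj x"
    by (metis Lproj.abs_eq Quotient_abs_rep Quotient_ramond_L)
  with * show "T y = Theta y" by simp
qed


section \<open>The trace\<close>

text \<open>Only meaningful for finite-dimensional subspaces \<open>W\<close> with \<open>f ` W \<subseteq> W\<close>.\<close>

definition (in vector_space) trace_on :: "'b set \<Rightarrow> ('b \<Rightarrow> 'b) \<Rightarrow> 'a" where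
  "trace_on W f =
     (let B = (SOME B. independent B \<and> span B = W) in \<Sum>b\<in>B. representation B (f b) b)"

definition L0_eigenspace :: "complex \<Rightarrow> ramond_L set"
  where "L0_eigenspace l = {x. Lact (Ugen (Lgen 0)) x = Lscale l x}"

definition qpow :: "complex \<Rightarrow> complex \<Rightarrow> complex"
  where "qpow \<tau> a = exp (2 * of_real pi * \<i> * a * \<tau>)"

definition ramond_trace :: "complex \<Rightarrow> complex" where
  "ramond_trace \<tau> =
     (\<Sum>\<^sub>\<infinity>l\<in>{l. L0_eigenspace l \<noteq> {0}}.
        qpow \<tau> (l - central_charge / 24) *
        LV.trace_on (L0_eigenspace l) (\<lambda>x. Lact (Ugen (Ggen 0)) (Theta x)))"

definition dedekind_eta :: "complex \<Rightarrow> complex"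
  where "dedekind_eta \<tau> = qpow \<tau> (1 / 24) * prodinf (\<lambda>n. 1 - qpow \<tau> 1 ^ (n + 1))"

end

theory Submission
  imports Defs "HOL-Complex_Analysis.Complex_Analysis"
begin

text \<open>
  The modes \<open>N\<^sub>n = \<Sum>\<^sub>k :L\<^sub>k G\<^sub>n\<^sub>-\<^sub>k: + q\<^sub>n G\<^sub>n\<close>, for a suitable quadratic polynomial \<open>q\<^sub>n\<close>, are
  those of the singular vector of weight \<open>7/2\<close> which exists in the vacuum module at
  \<open>c = -21/4\<close>. They span, together with their superpartners \<open>{G\<^sub>m, N\<^sub>n}\<close>, a graded submodule
  of the Verma module, and \<open>h = -3/32\<close> makes its component in the top space vanish. Hence
  \<open>N\<^sub>0\<close> acts as zero on \<open>L(c,h)\<close>. Taking the trace of \<open>\<Theta> N\<^sub>0\<close> on the subspace of level \<open>n\<close>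
  and using the cyclicity of the trace gives \<open>n t\<^sub>n = - 3 \<Sum>\<^sub>j\<^sub>,\<^sub>k\<^sub>\<ge>\<^sub>1 k t\<^sub>n\<^sub>-\<^sub>j\<^sub>k\<close> for the traces
  \<open>t\<^sub>n\<close> of \<open>G\<^sub>0 \<Theta>\<close>, which is the recursion for the coefficients of \<open>\<Prod>\<^sub>n (1 - q\<^sup>n)\<^sup>3\<close>.
  The character of \<open>L(c,h)\<close> is not needed; nontriviality of the top space of the Verma module is.
\<close>

section \<open>The super Jacobi identity\<close>

text \<open>The enveloping algebra and the Verma module are bare quotients without a PBW basis, so
  whatever must be nonzero is detected by scalar functionals: \<open>lincomb p g\<close> evaluates
  the linear extension of g at p, and functionals on words that respect all relations yield the
  projection to the top space. The infinite sum N_n exists on each vector separately, as the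
  stationary value of truncations; its brackets become polynomial identities in a large cutoff K.
  Closure of the null submodule is tested on G_{-1}, G_0, G_1, which together with C generate the
  superalgebra. The constants of the answer: [G_k, L_{-k}] and [L_k, G_{-k}] both equal (3/2) k G_0,
  and together they give the factor 3 of the recursion, hence the cube. On the top space G_0 Theta
  is the scalar h - c/24 = 1/8; its trace there is 2/8, the constant 1/4, while 1/8 = 3/24 is the
  leading exponent of eta^3. Convergence of the trace series comes from holomorphy of the Euler
  product rather than from bounds on dimensions.\<close>

definition lincomb :: "('k \<Rightarrow>\<^sub>0 complex) \<Rightarrow> ('k \<Rightarrow> complex) \<Rightarrow> complex"
  where "lincomb p g = (\<Sum>x\<in>Poly_Mapping.keys p. Poly_Mapping.lookup p x * g x)"

lemma lincomb_superset:
  assumes "finite A" "Poly_Mapping.keys p \<subseteq> A"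
  shows "lincomb p g = (\<Sum>x\<in>A. Poly_Mapping.lookup p x * g x)"
  unfolding lincomb_def using assms
  by (intro sum.mono_neutral_left) (auto simp: in_keys_iff)

lemma lincomb_add: "lincomb (p + q) g = lincomb p g + lincomb q g"
proof -
  let ?A = "Poly_Mapping.keys p \<union> Poly_Mapping.keys q"
  have "Poly_Mapping.keys (p + q) \<subseteq> ?A" by (rule Poly_Mapping.keys_add)
  then show ?thesis
    by (simp add: lincomb_superset[of ?A] lookup_add ring_distribs sum.distrib)
qed

lemma lincomb_pscale: "lincomb (pscale k p) g = k * lincomb p g"
proof -
  have "Poly_Mapping.keys (pscale k p) \<subseteq> Poly_Mapping.keys p" by (auto simp: in_keys_iff)
  then show ?thesis
    by (simp add: lincomb_superset[of "Poly_Mapping.keys p"] sum_distrib_left mult.assoc)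
qed

lemma lincomb_zero [simp]: "lincomb 0 g = 0"
  by (simp add: lincomb_def)

lemma lincomb_single [simp]: "lincomb (Poly_Mapping.single x a) g = a * g x"
  by (simp add: lincomb_superset[of "{x}"])

lemma lincomb_uminus: "lincomb (- p) g = - lincomb p g"
  using lincomb_add[of p "-p" g] by (simp add: add_eq_0_iff)

lemma lincomb_diff: "lincomb (p - q) g = lincomb p g - lincomb q g"
  using lincomb_add[of p "-q" g] by (simp add: lincomb_uminus)

lemma lincomb_cong: "(\<And>x. x \<in> Poly_Mapping.keys p \<Longrightarrow> g x = h x) \<Longrightarrow> lincomb p g = lincomb p h"
  by (simp add: lincomb_def)

lemma lincomb_add_fun: "lincomb p (\<lambda>x. g x + h x) = lincomb p g + lincomb p h"
  by (simp add: lincomb_def ring_distribs sum.distrib)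

lemma lincomb_cmult_fun: "lincomb p (\<lambda>x. k * g x) = k * lincomb p g"
  by (simp add: lincomb_def sum_distrib_left mult_ac)

lemma lincomb_swap: "lincomb p (\<lambda>x. lincomb q (g x)) = lincomb q (\<lambda>y. lincomb p (\<lambda>x. g x y))"
  unfolding lincomb_def sum_distrib_left by (subst sum.swap) (simp add: mult_ac)

definition super_sign :: "ramond_gen \<Rightarrow> ramond_gen \<Rightarrow> complex"
  where "super_sign x y = (if odd_gen x \<and> odd_gen y then - 1 else 1)"

lemma super_sign_square [simp]: "super_sign x y * super_sign x y = 1" by (auto simp: super_sign_def)

lemma super_sign_sym: "super_sign x y = super_sign y x" by (auto simp: super_sign_def)
lemma ramond_bracket_skew: "lincomb (ramond_bracket y x) g = - super_sign x y * lincomb (ramond_bracket x y) g"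
  by (cases x; cases y)
     (auto simp: super_sign_def lincomb_add lincomb_uminus lincomb_diff field_simps power3_eq_cube power2_eq_square add_eq_0_iff)

text \<open>A central term can occur only if the modes add up to zero and the number of odd
  arguments is even; the four cases written out are these. The split on k + m + n = 0 separates a
  comparison without central terms from a polynomial identity in k and m. Applying g to both sides
  makes the identity scalar.\<close>

lemma ramond_jacobi:
  "lincomb (ramond_bracket y z) (\<lambda>u. lincomb (ramond_bracket x u) g) =
     lincomb (ramond_bracket x y) (\<lambda>u. lincomb (ramond_bracket u z) g) +
     super_sign x y * lincomb (ramond_bracket x z) (\<lambda>u. lincomb (ramond_bracket y u) g)"
proof (cases x; cases y; cases z)
    fix k m n assume *: "x = Lgen k" "y = Lgen m" "z = Lgen n"
    show ?thesis
    proof (cases "k + m + n = 0")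
      case False
      \<comment> \<open>The same fact in each of the forms in which the deltas of
        \<open>ramond_bracket\<close> may present it to the simplifier.\<close>
      then have "k \<noteq> - (m + n)" "m + n \<noteq> - k" "k + m \<noteq> - n" "k + n \<noteq> - m" "m \<noteq> - (k + n)" "m + k \<noteq> - n" "n + k \<noteq> - m" "n + m \<noteq> - k"
         "k \<noteq> - (n + m)" "m \<noteq> - (n + k)" by auto
      then show ?thesis using *
        by (simp add: super_sign_def lincomb_add lincomb_uminus lincomb_diff del: minus_add_distrib add_uminus_conv_diff) (simp add: field_simps)
    next
      case True
      then have "n = - k - m" by simp
      then show ?thesis using *
        by (simp add: super_sign_def lincomb_add lincomb_uminus lincomb_diff) (simp add: field_simps power3_eq_cube power2_eq_square)
    qed
  next
    fix k m n assume *: "x = Lgen k" "y = Ggen m" "z = Ggen n"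
    show ?thesis
    proof (cases "k + m + n = 0")
      case False
      then have "k \<noteq> - (m + n)" "m + n \<noteq> - k" "k + m \<noteq> - n" "k + n \<noteq> - m" "m \<noteq> - (k + n)" "m + k \<noteq> - n" "n + k \<noteq> - m" "n + m \<noteq> - k"
         "k \<noteq> - (n + m)" "m \<noteq> - (n + k)" by auto
      then show ?thesis using *
        by (simp add: super_sign_def lincomb_add lincomb_uminus lincomb_diff del: minus_add_distrib add_uminus_conv_diff) (simp add: field_simps)
    next
      case True
      then have "n = - k - m" by simp
      then show ?thesis using *
        by (simp add: super_sign_def lincomb_add lincomb_uminus lincomb_diff) (simp add: field_simps power3_eq_cube power2_eq_square)
    qed
  next
    fix k m n assume *: "x = Ggen k" "y = Lgen m" "z = Ggen n"
    show ?thesis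
    proof (cases "k + m + n = 0")
      case False
      then have "k \<noteq> - (m + n)" "m + n \<noteq> - k" "k + m \<noteq> - n" "k + n \<noteq> - m" "m \<noteq> - (k + n)" "m + k \<noteq> - n" "n + k \<noteq> - m" "n + m \<noteq> - k"
         "k \<noteq> - (n + m)" "m \<noteq> - (n + k)" by auto
      then show ?thesis using *
        by (simp add: super_sign_def lincomb_add lincomb_uminus lincomb_diff del: minus_add_distrib add_uminus_conv_diff) (simp add: field_simps)
    next
      case True
      then have "n = - k - m" by simp
      then show ?thesis using *
        by (simp add: super_sign_def lincomb_add lincomb_uminus lincomb_diff) (simp add: field_simps power3_eq_cube power2_eq_square)
    qed
  next
    fix k m n assume *: "x = Ggen k" "y = Ggen m" "z = Lgen n"
    show ?thesis
    proof (cases "k + m + n = 0")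
      case False
      then have "k \<noteq> - (m + n)" "m + n \<noteq> - k" "k + m \<noteq> - n" "k + n \<noteq> - m" "m \<noteq> - (k + n)" "m + k \<noteq> - n" "n + k \<noteq> - m" "n + m \<noteq> - k"
         "k \<noteq> - (n + m)" "m \<noteq> - (n + k)" by auto
      then show ?thesis using *
        by (simp add: super_sign_def lincomb_add lincomb_uminus lincomb_diff del: minus_add_distrib add_uminus_conv_diff) (simp add: field_simps)
    next
      case True
      then have "n = - k - m" by simp
      then show ?thesis using *
        by (simp add: super_sign_def lincomb_add lincomb_uminus lincomb_diff) (simp add: field_simps power3_eq_cube power2_eq_square)
    qed
  qed (auto simp: super_sign_def lincomb_add lincomb_uminus lincomb_diff field_simps)

text \<open>The bracket is homogeneous, so the sign against z is constant on its support; the even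
  element C arises only from two generators of equal parity.\<close>

lemma super_sign_bracket:
  "u \<in> Poly_Mapping.keys (ramond_bracket x y) \<Longrightarrow> super_sign z u = super_sign z x * super_sign z y"
  using keys_add keys_single
  by (cases x; cases y) (force simp: super_sign_def split: if_splits dest!: subsetD[OF keys_add])+

lemma keys_bracket_plus:
  "x \<in> ramond_plus \<Longrightarrow> y \<in> ramond_plus \<Longrightarrow> u \<in> Poly_Mapping.keys (ramond_bracket x y) \<Longrightarrow> u \<in> ramond_plus"
  by (cases x; cases y) (force simp: ramond_plus_def split: if_splits dest!: subsetD[OF keys_add])+

lemma keys_bracket_minus:
  "x \<in> ramond_minus \<Longrightarrow> y \<in> ramond_minus \<Longrightarrow> u \<in> Poly_Mapping.keys (ramond_bracket x y) \<Longrightarrow> u \<in> ramond_minus"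
  by (cases x; cases y) (force simp: ramond_minus_def split: if_splits dest!: subsetD[OF keys_add])+

lemma keys_bracket_parity:
  "u \<in> Poly_Mapping.keys (ramond_bracket x y) \<Longrightarrow> odd_gen u \<longleftrightarrow> odd_gen x \<noteq> odd_gen y"
  by (cases x; cases y) (force split: if_splits dest!: subsetD[OF keys_add])+

section \<open>The projection of the Verma module onto its top space\<close>

abbreviation Sa :: "ramond_gen \<Rightarrow> top_space \<Rightarrow> top_space"
  where "Sa \<equiv> Sact central_charge lowest_weight"

definition top_linear :: "(top_space \<Rightarrow> complex) \<Rightarrow> bool"
  where "top_linear l \<longleftrightarrow> (\<forall>s t. l (s + t) = l s + l t) \<and> (\<forall>k s. l (Sscale k s) = k * l s)"

lemma top_linear_fst: "top_linear fst" and top_linear_snd: "top_linear snd"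
  by (auto simp: top_linear_def Sscale_def)

lemma top_linearD: "top_linear l \<Longrightarrow> l (s + t) = l s + l t" "top_linear l \<Longrightarrow> l (Sscale k s) = k * l s"
  unfolding top_linear_def by blast+

lemma lincomb_super_sign:
  "lincomb (ramond_bracket x y) (\<lambda>u. super_sign z u * F u) = super_sign z x * super_sign z y * lincomb (ramond_bracket x y) F"
proof -
  have "lincomb (ramond_bracket x y) (\<lambda>u. super_sign z u * F u)
      = lincomb (ramond_bracket x y) (\<lambda>u. (super_sign z x * super_sign z y) * F u)"
    by (rule lincomb_cong) (simp add: super_sign_bracket)
  then show ?thesis by (simp only: lincomb_cmult_fun)
qed

lemma lincomb_super_sign':
  "lincomb (ramond_bracket x y) (\<lambda>u. super_sign u z * F u) = super_sign x z * super_sign y z * lincomb (ramond_bracket x y) F"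
  using lincomb_super_sign[of x y z F] by (simp only: super_sign_sym[of z])

lemma top_linear_pair: "top_linear l \<Longrightarrow> l (a, b) = a * l v_even + b * l v_odd"
proof -
  assume "top_linear l"
  moreover have "(a, b) = Sscale a v_even + Sscale b v_odd"
    by (simp add: Sscale_def v_even_def v_odd_def)
  ultimately show ?thesis unfolding top_linear_def by metis
qed

text \<open>The top space is a module over the nonnegative part. For x = y = G_0 this is G_0^2 = L_0
  - C/24, which the entry h - c/24 in \<open>Sact\<close> encodes. The functional l makes the
  bracket term a scalar.\<close>

lemma Sact_bracket:
  assumes "top_linear l" "x \<in> ramond_plus" "y \<in> ramond_plus"
  shows "l (Sa x (Sa y s)) = super_sign x y * l (Sa y (Sa x s)) + lincomb (ramond_bracket x y) (\<lambda>u. l (Sa u s))"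
  using assms(2,3)
  by (cases s; cases x; cases y)
     (auto simp: ramond_plus_def super_sign_def lincomb_add lincomb_uminus lincomb_diff top_linear_pair[OF assms(1)] field_simps)

text \<open>\<open>der x\<close> is the transpose of the action of \<open>x\<close> by superderivations on the tensor algebra
  tensored with the top space.\<close>

fun der :: "ramond_gen \<Rightarrow> (ramond_gen list \<Rightarrow> top_space \<Rightarrow> complex) \<Rightarrow> ramond_gen list \<Rightarrow> top_space \<Rightarrow> complex"
  where
    "der x f [] s = f [] (Sa x s)"
  | "der x f (y # w) s =
       lincomb (ramond_bracket x y) (\<lambda>z. f (z # w) s) + super_sign x y * der x (\<lambda>v. f (y # v)) w s"

lemma der_cong:
  "(\<And>v t. length v = length w \<Longrightarrow> f v t = g v t) \<Longrightarrow> der x f w s = der x g w s"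
proof (induction w arbitrary: f g)
  case (Cons y w)
  have "lincomb p (\<lambda>z. f (z # w) s) = lincomb p (\<lambda>z. g (z # w) s)" for p
    using Cons.prems by (intro lincomb_cong) simp
  moreover have "der x (\<lambda>v. f (y # v)) w s = der x (\<lambda>v. g (y # v)) w s"
    using Cons.prems by (intro Cons.IH) simp
  ultimately show ?case by simp
qed simp

lemma der_add: "der x (\<lambda>v t. f v t + g v t) w s = der x f w s + der x g w s"
  by (induction w arbitrary: f g) (auto simp: lincomb_add_fun algebra_simps)

lemma der_cmult: "der x (\<lambda>v t. k * f v t) w s = k * der x f w s"
  by (induction w arbitrary: f) (auto simp: lincomb_cmult_fun algebra_simps)

lemma der_zero: "der x (\<lambda>v t. 0) w s = 0"
  using der_cmult[of x 0 "\<lambda>_ _. 0" w s] by simp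

lemma der_lincomb: "der x (\<lambda>v t. lincomb p (\<lambda>u. F u v t)) w s = lincomb p (\<lambda>u. der x (F u) w s)"
proof (induction w arbitrary: F)
  case (Cons y w)
  then show ?case by (simp add: lincomb_add_fun lincomb_cmult_fun lincomb_swap[of "ramond_bracket x y"])
qed simp

lemma top_linear_der: "(\<And>w. top_linear (f w)) \<Longrightarrow> top_linear (der x f w)"
proof (induction w arbitrary: f)
  case Nil
  show ?case using Nil[of "[]"] unfolding top_linear_def der.simps Sact_add Sact_scale by blast
next
  case (Cons y w)
  note lin = top_linearD[OF Cons.prems]
  note IH = top_linearD[OF Cons.IH, OF Cons.prems]
  show ?case unfolding top_linear_def
    by (intro conjI allI) (simp_all only: der.simps lin IH lincomb_add_fun lincomb_cmult_fun ring_distribs mult.left_commute add_ac)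
qed

text \<open>Transposition reverses composition: \<open>der y (der x f)\<close> evaluates f on x
  applied to y applied to the tensor. On the empty word the relation is \<open>Sact_bracket\<close>;
  on a longer one the Leibniz rule reduces it to the Jacobi identity for x, y and the first
  letter.\<close>

lemma der_bracket:
  assumes "x \<in> ramond_plus" "y \<in> ramond_plus" "\<And>w. top_linear (f w)"
  shows "der y (der x f) w s = super_sign x y * der x (der y f) w s
    + lincomb (ramond_bracket x y) (\<lambda>u. der u f w s)"
  using assms(3)
proof (induction w arbitrary: f)
  case Nil
  then show ?case using Sact_bracket[OF Nil assms(1,2)] by simp
next
  case (Cons z w)
  have 1: "der b (der a f) (z # w) s =
      lincomb (ramond_bracket b z) (\<lambda>u. lincomb (ramond_bracket a u) (\<lambda>t. f (t # w) s))
      + super_sign a b * super_sign a z * lincomb (ramond_bracket b z) (\<lambda>u. der a (\<lambda>v. f (u # v)) w s)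
      + super_sign b z * lincomb (ramond_bracket a z) (\<lambda>u. der b (\<lambda>v. f (u # v)) w s)
      + super_sign b z * super_sign a z * der b (der a (\<lambda>v. f (z # v))) w s" for a b
  proof -
    have "der b (\<lambda>v. der a f (z # v)) w s = der b (\<lambda>v t. lincomb (ramond_bracket a z) (\<lambda>u. f (u # v) t)
        + super_sign a z * der a (\<lambda>v. f (z # v)) v t) w s"
      by (rule der_cong) simp
    then have d: "der b (\<lambda>v. der a f (z # v)) w s = lincomb (ramond_bracket a z) (\<lambda>u. der b (\<lambda>v. f (u # v)) w s)
        + super_sign a z * der b (der a (\<lambda>v. f (z # v))) w s"
      by (simp only: der_add der_cmult der_lincomb)
    show ?thesis
      by (simp only: der.simps lincomb_add_fun lincomb_super_sign d ring_distribs mult.assoc add.assoc)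
  qed
  have IH: "der y (der x (\<lambda>v. f (z # v))) w s = super_sign x y * der x (der y (\<lambda>v. f (z # v))) w s
    + lincomb (ramond_bracket x y) (\<lambda>u. der u (\<lambda>v. f (z # v)) w s)"
    by (rule Cons.IH) (rule Cons.prems)
  have 2: "lincomb (ramond_bracket x y) (\<lambda>u. der u f (z # w) s) =
     lincomb (ramond_bracket x y) (\<lambda>u. lincomb (ramond_bracket u z) (\<lambda>t. f (t # w) s)) +
     super_sign x z * super_sign y z * lincomb (ramond_bracket x y) (\<lambda>u. der u (\<lambda>v. f (z # v)) w s)"
    by (simp add: lincomb_add_fun lincomb_super_sign')
  \<comment> \<open>B and B' stand for the terms in which one of x, y acts on the first letter and
    the other on the tail; they agree on both sides because the sign squares to 1.\<close>
  have "super_sign x y = 1 \<or> super_sign x y = - 1" by (simp add: super_sign_def)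
  then have "(K1 + super_sign x y * K2) + super_sign x y * ex * B + ey * B' + ey * ex * (super_sign x y * D + E)
      = super_sign x y * (K2 + super_sign x y * ey * B' + ex * B + ex * ey * D) + (K1 + ex * ey * E)"
    for K1 K2 B B' D E ex ey :: complex
    by (elim disjE) (simp_all add: algebra_simps)
  then show ?case
    by (simp only: 1[of y x] 1[of x y] 2 IH super_sign_sym[of y x] ramond_jacobi[of y z x "\<lambda>t. f (t # w) s"])
qed

section \<open>Functionals on words that respect the defining relations\<close>

text \<open>Vanishing on the products of a relator with words of total length n. The length is
  recorded for the induction: \<open>der\<close> evaluates its functional on words of unchanged
  length, and \<open>wproj\<close> passes to words shorter by one.\<close>

definition relator_free :: "nat \<Rightarrow> (ramond_gen list \<Rightarrow> top_space \<Rightarrow> complex) \<Rightarrow> bool" where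
  "relator_free n f \<longleftrightarrow> (\<forall>a b x y s. length a + length b = n \<longrightarrow>
     f (a @ x # y # b) s = super_sign x y * f (a @ y # x # b) s
       + lincomb (ramond_bracket x y) (\<lambda>u. f (a @ u # b) s))"

lemma relator_free_Cons: "relator_free (Suc n) f \<Longrightarrow> relator_free n (\<lambda>v. f (z # v))"
proof -
  assume R: "relator_free (Suc n) f"
  show ?thesis
    unfolding relator_free_def
  proof (intro allI impI)
    fix a b :: "ramond_gen list" and x y s assume "length a + length b = n"
    then show "f (z # a @ x # y # b) s = super_sign x y * f (z # a @ y # x # b) s
        + lincomb (ramond_bracket x y) (\<lambda>u. f (z # a @ u # b) s)"
      using R[unfolded relator_free_def, rule_format, of "z # a" b x y s] by simp
  qed
qed

text \<open>A superderivation maps relators to combinations of relators: letting z act on xy, yx and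
  [x, y] gives the relators of [z, x], y and of x, [z, y], and what is left over is the Jacobi
  identity. Letters in front are stripped by induction.\<close>

lemma relator_free_der:
  assumes "relator_free n f" shows "relator_free n (der z f)"
proof -
  have "der z f (a @ x # y # b) s = super_sign x y * der z f (a @ y # x # b) s
       + lincomb (ramond_bracket x y) (\<lambda>u. der z f (a @ u # b) s)"
    if "length a + length b = n" "relator_free n f" for a b x y s
    using that
  proof (induction a arbitrary: f n)
    case Nil
    have R: "f (p # q # b) s = super_sign p q * f (q # p # b) s
       + lincomb (ramond_bracket p q) (\<lambda>u. f (u # b) s)" for p q s
      using Nil.prems(2)[unfolded relator_free_def, rule_format, of "[]" b p q s] Nil.prems(1) by simp
    have d: "der z (\<lambda>v. f (x # y # v)) b s = super_sign x y * der z (\<lambda>v. f (y # x # v)) b s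
        + lincomb (ramond_bracket x y) (\<lambda>u. der z (\<lambda>v. f (u # v)) b s)"
    proof -
      have "der z (\<lambda>v. f (x # y # v)) b s = der z (\<lambda>v t. super_sign x y * f (y # x # v) t
         + lincomb (ramond_bracket x y) (\<lambda>u. f (u # v) t)) b s"
      proof (rule der_cong)
        fix v :: "ramond_gen list" and t assume "length v = length b"
        then show "f (x # y # v) t = super_sign x y * f (y # x # v) t + lincomb (ramond_bracket x y) (\<lambda>u. f (u # v) t)"
          using Nil.prems(2)[unfolded relator_free_def, rule_format, of "[]" v x y t] Nil.prems(1) by simp
      qed
      then show ?thesis by (simp add: der_add der_cmult der_lincomb)
    qed
    have r1: "lincomb (ramond_bracket z x) (\<lambda>u. f (u # y # b) s) =
       super_sign z y * super_sign x y * lincomb (ramond_bracket z x) (\<lambda>u. f (y # u # b) s)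
       + lincomb (ramond_bracket z x) (\<lambda>u. lincomb (ramond_bracket u y) (\<lambda>t. f (t # b) s))"
      by (subst R) (simp add: lincomb_add_fun lincomb_super_sign')
    have r2: "lincomb (ramond_bracket z y) (\<lambda>u. f (x # u # b) s) =
       super_sign x z * super_sign x y * lincomb (ramond_bracket z y) (\<lambda>u. f (u # x # b) s)
       + lincomb (ramond_bracket z y) (\<lambda>u. lincomb (ramond_bracket x u) (\<lambda>t. f (t # b) s))"
      by (subst R) (simp add: lincomb_add_fun lincomb_super_sign)
    have super_sign: "super_sign z x = 1 \<or> super_sign z x = - 1" "super_sign x y = 1 \<or> super_sign x y = - 1" "super_sign z y = 1 \<or> super_sign z y = - 1"
      by (simp_all add: super_sign_def)
    show ?case
      unfolding append_Nil der.simps lincomb_add_fun lincomb_super_sign d r1 r2 super_sign_sym[of x z] super_sign_sym[of y x]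
        ramond_jacobi[of x y z "\<lambda>t. f (t # b) s"]
      using super_sign by (elim disjE) (simp_all only:, simp_all add: algebra_simps)
  next
    case (Cons y' a)
    then obtain m where n: "n = Suc m" by auto
    with Cons.prems have IH: "der z (\<lambda>v. f (y' # v)) (a @ x # y # b) s =
        super_sign x y * der z (\<lambda>v. f (y' # v)) (a @ y # x # b) s
       + lincomb (ramond_bracket x y) (\<lambda>u. der z (\<lambda>v. f (y' # v)) (a @ u # b) s)"
      by (intro Cons.IH[of m]) (auto intro: relator_free_Cons)
    have R: "f (t # a @ x # y # b) s = super_sign x y * f (t # a @ y # x # b) s
       + lincomb (ramond_bracket x y) (\<lambda>u. f (t # a @ u # b) s)" for t
      using Cons.prems(2)[unfolded relator_free_def, rule_format, of "t # a" b x y s] Cons.prems(1) by simp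
    show ?case
      by (simp add: IH R lincomb_add_fun lincomb_cmult_fun lincomb_swap[of "ramond_bracket z y'"] algebra_simps)
  qed
  then show ?thesis using assms unfolding relator_free_def by blast
qed

definition balanced :: "nat \<Rightarrow> (ramond_gen list \<Rightarrow> top_space \<Rightarrow> complex) \<Rightarrow> bool" where
  "balanced n f \<longleftrightarrow> (\<forall>w x s. length w = n \<longrightarrow> x \<in> ramond_plus \<longrightarrow> f (w @ [x]) s = f w (Sa x s))"

lemma balanced_Cons: "balanced (Suc n) f \<Longrightarrow> balanced n (\<lambda>v. f (z # v))"
proof -
  assume R: "balanced (Suc n) f"
  show ?thesis
    unfolding balanced_def
  proof (intro allI impI)
    fix w :: "ramond_gen list" and x s assume "length w = n" "x \<in> ramond_plus"
    then show "f (z # w @ [x]) s = f (z # w) (Sa x s)"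
      using R[unfolded balanced_def, rule_format, of "z # w" x s] by simp
  qed
qed

text \<open>On the empty word, z applied to x \<otimes> s leaves [z, x] \<otimes> s and x \<otimes>
  z s up to sign. As [z, x] is again nonnegative, both can be balanced, and the claim becomes the
  module relation of the top space.\<close>

lemma balanced_der:
  assumes "balanced n f" "z \<in> ramond_plus" "\<And>w. top_linear (f w)" shows "balanced n (der z f)"
proof -
  have "der z f (w @ [x]) s = der z f w (Sa x s)"
    if "length w = n" "x \<in> ramond_plus" "balanced n f" "\<And>w. top_linear (f w)" for w x s
    using that
  proof (induction w arbitrary: f n)
    case Nil
    have B: "u \<in> ramond_plus \<Longrightarrow> f [u] t = f [] (Sa u t)" for u t
      using Nil.prems(3)[unfolded balanced_def, rule_format, of "[]" u t] Nil.prems(1) by simp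
    have "lincomb (ramond_bracket z x) (\<lambda>u. f [u] s) = lincomb (ramond_bracket z x) (\<lambda>u. f [] (Sa u s))"
      by (rule lincomb_cong) (use B keys_bracket_plus[OF assms(2) Nil(2)] in blast)
    then show ?case
      using B[OF Nil(2)] Sact_bracket[OF Nil(4) assms(2) Nil(2), of "[]" s] by simp
  next
    case (Cons y w)
    then obtain m where n: "n = Suc m" by auto
    have "der z (\<lambda>v. f (y # v)) (w @ [x]) s = der z (\<lambda>v. f (y # v)) w (Sa x s)"
      using Cons.prems n by (intro Cons.IH[of m]) (auto intro: balanced_Cons)
    moreover have "f (t # w @ [x]) s = f (t # w) (Sa x s)" for t
      using Cons.prems(3)[unfolded balanced_def, rule_format, of "t # w" x s] Cons.prems(1,2) by simp
    ultimately show ?case by simp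
  qed
  then show ?thesis using assms unfolding balanced_def by blast
qed

text \<open>A leading nonnegative mode is commuted to the right until it reaches the top space, which
  shortens the word. That the result respects the relations is the part of the
  Poincare-Birkhoff-Witt theorem needed for the top space of the Verma module to be nonzero.\<close>

fun tproj :: "(top_space \<Rightarrow> complex) \<Rightarrow> nat \<Rightarrow> ramond_gen list \<Rightarrow> top_space \<Rightarrow> complex" where
  "tproj l 0 w s = l s"
| "tproj l (Suc n) [] s = 0"
| "tproj l (Suc n) (x # w) s = (if x \<in> ramond_minus then 0 else der x (tproj l n) w s)"

definition wproj :: "(top_space \<Rightarrow> complex) \<Rightarrow> ramond_gen list \<Rightarrow> top_space \<Rightarrow> complex"
  where "wproj l w = tproj l (length w) w"

lemma wproj_Nil: "wproj l [] s = l s" by (simp add: wproj_def)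

lemma wproj_minus: "x \<in> ramond_minus \<Longrightarrow> wproj l (x # w) s = 0" by (simp add: wproj_def)

lemma ramond_plus_iff: "x \<in> ramond_plus \<longleftrightarrow> x \<notin> ramond_minus"
  by (cases x) (auto simp: ramond_minus_def ramond_plus_def)

lemma wproj_plus:
  "x \<in> ramond_plus \<Longrightarrow> wproj l (x # w) s = der x (wproj l) w s"
  by (simp add: wproj_def ramond_plus_iff) (rule der_cong, simp add: wproj_def)

lemma top_linear_wproj:
  assumes "top_linear l" shows "top_linear (wproj l w)"
proof -
  have "top_linear (tproj l n w)" for n w
  proof (induction n arbitrary: w)
    case 0
    show ?case using assms by (simp add: top_linear_def)
  next
    case (Suc n)
    then show ?case
      using top_linear_der[of "tproj l n", OF Suc] by (cases w) (auto simp: top_linear_def)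
  qed
  then show ?thesis by (simp add: wproj_def)
qed

text \<open>A negative mode in front makes all terms vanish, and a nonnegative one passes to a
  shorter word by \<open>relator_free_der\<close>; the point is a relator at the front. Two negative
  modes have a negative bracket, in the mixed cases only the bracket terms survive, and two
  nonnegative modes are covered by \<open>der_bracket\<close>.\<close>

lemma relator_free_wproj:
  assumes l: "top_linear l" shows "relator_free n (wproj l)"
proof (induction n)
  let ?f = "wproj l"
  have lin: "top_linear (?f w)" for w by (rule top_linear_wproj[OF l])
  have base: "?f (x # y # b) s = super_sign x y * ?f (y # x # b) s
       + lincomb (ramond_bracket x y) (\<lambda>u. ?f (u # b) s)" for b x y s
  proof -
    have zero: "der x (\<lambda>v. ?f (y # v)) b s = 0" if "y \<in> ramond_minus" for x y
      using that der_cong[of b "\<lambda>v. ?f (y # v)" "\<lambda>_ _. 0" x s] by (simp add: wproj_minus der_zero)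
    consider "x \<in> ramond_minus" "y \<in> ramond_minus" | "x \<in> ramond_minus" "y \<in> ramond_plus"
      | "x \<in> ramond_plus" "y \<in> ramond_minus" | "x \<in> ramond_plus" "y \<in> ramond_plus"
      using ramond_plus_iff by blast
    then show ?thesis
    proof cases
      case 1
      then have "lincomb (ramond_bracket x y) (\<lambda>u. ?f (u # b) s) = lincomb (ramond_bracket x y) (\<lambda>u. 0)"
        by (intro lincomb_cong wproj_minus) (rule keys_bracket_minus)
      then show ?thesis using 1 by (simp add: wproj_minus lincomb_def)
    next
      case 2
      then show ?thesis
        by (simp add: wproj_minus wproj_plus zero ramond_bracket_skew[of y x])
    next
      case 3
      then show ?thesis by (simp add: wproj_minus wproj_plus zero)
    next
      case 4
      have plus: "der z (\<lambda>v. ?f (t # v)) b s = der z (der t ?f) b s" if "t \<in> ramond_plus" for z t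
        using that by (intro der_cong) (rule wproj_plus)
      have "lincomb (ramond_bracket x y) (\<lambda>u. ?f (u # b) s)
          = lincomb (ramond_bracket x y) (\<lambda>u. der u ?f b s)"
        using keys_bracket_plus[OF 4] by (intro lincomb_cong) (simp add: wproj_plus)
      then have *: "der y (der x ?f) b s = super_sign x y * der x (der y ?f) b s
          + lincomb (ramond_bracket x y) (\<lambda>u. ?f (u # b) s)"
        using der_bracket[OF 4 lin] by simp
      have skew: "lincomb (ramond_bracket y x) (\<lambda>u. ?f (u # b) s)
          = - super_sign x y * lincomb (ramond_bracket x y) (\<lambda>u. ?f (u # b) s)"
        by (rule ramond_bracket_skew)
      have "super_sign x y = 1 \<or> super_sign x y = - 1" by (simp add: super_sign_def)
      then have alg: "B + super_sign x y * A = super_sign x y * (- super_sign x y * B + super_sign x y * (super_sign x y * A + B)) + B"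
        for A B by (elim disjE) simp_all
      show ?thesis
        using 4 by (simp only: wproj_plus der.simps plus * skew super_sign_sym[of y x] alg[symmetric])
    qed
  qed
  {
    case 0
    show ?case unfolding relator_free_def
    proof (intro allI impI)
      fix a b :: "ramond_gen list" and x y s assume "length a + length b = 0"
      then have a: "a = []" by simp
      show "?f (a @ x # y # b) s = super_sign x y * ?f (a @ y # x # b) s
         + lincomb (ramond_bracket x y) (\<lambda>u. ?f (a @ u # b) s)"
        unfolding a append_Nil by (rule base)
    qed
  next
    case (Suc n)
    show ?case unfolding relator_free_def
    proof (intro allI impI)
      fix a b :: "ramond_gen list" and x y s assume len: "length a + length b = Suc n"
      show "?f (a @ x # y # b) s = super_sign x y * ?f (a @ y # x # b) s
         + lincomb (ramond_bracket x y) (\<lambda>u. ?f (a @ u # b) s)"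
      proof (cases a)
        case Nil
        show ?thesis unfolding Nil append_Nil by (rule base)
      next
        case (Cons z a')
        show ?thesis
        proof (cases "z \<in> ramond_minus")
          case True
          then show ?thesis using Cons by (simp add: wproj_minus lincomb_def)
        next
          case False
          then have z: "z \<in> ramond_plus" by (simp add: ramond_plus_iff)
          have "length a' + length b = n" using len Cons by simp
          then show ?thesis
            unfolding Cons append_Cons wproj_plus[OF z]
            using relator_free_der[OF Suc, of z] unfolding relator_free_def by blast
        qed
      qed
    qed
  }
qed

lemma balanced_wproj:
  assumes l: "top_linear l" shows "balanced n (wproj l)"
proof (induction n)
  case 0
  show ?case unfolding balanced_def by (simp add: wproj_plus wproj_Nil)
next
  case (Suc n)
  show ?case unfolding balanced_def
  proof (intro allI impI)
    fix w :: "ramond_gen list" and x s assume len: "length w = Suc n" and x: "x \<in> ramond_plus"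
    then obtain z v where w: "w = z # v" "length v = n" by (cases w) auto
    show "wproj l (w @ [x]) s = wproj l w (Sa x s)"
    proof (cases "z \<in> ramond_minus")
      case True
      then show ?thesis using w by (simp add: wproj_minus)
    next
      case False
      then have z: "z \<in> ramond_plus" by (simp add: ramond_plus_iff)
      show ?thesis
        unfolding w(1) append_Cons wproj_plus[OF z]
        using balanced_der[OF Suc z top_linear_wproj[OF l]] w(2) x unfolding balanced_def by blast
    qed
  qed
qed

section \<open>Parity of the functionals\<close>

abbreviation odd_word :: "ramond_gen list \<Rightarrow> bool"
  where "odd_word w \<equiv> odd (length (filter odd_gen w))"

text \<open>f is supported on tensors of parity q, with \<open>True\<close> for odd. A word tensored
  with \<open>v_odd\<close> has the parity opposite to that of the word.\<close>

definition has_parity :: "nat \<Rightarrow> bool \<Rightarrow> (ramond_gen list \<Rightarrow> top_space \<Rightarrow> complex) \<Rightarrow> bool" where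
  "has_parity n q f \<longleftrightarrow> (\<forall>w. length w = n \<longrightarrow>
     (odd_word w \<noteq> q \<longrightarrow> f w v_even = 0) \<and> (odd_word w = q \<longrightarrow> f w v_odd = 0))"

lemma has_parity_der:
  assumes "has_parity n q f" "\<And>w. top_linear (f w)" shows "has_parity n (q \<noteq> odd_gen x) (der x f)"
proof -
  have "(odd_word w \<noteq> (q \<noteq> odd_gen x) \<longrightarrow> der x f w v_even = 0) \<and>
        (odd_word w = (q \<noteq> odd_gen x) \<longrightarrow> der x f w v_odd = 0)"
    if "length w = n" "has_parity n q f" "\<And>w. top_linear (f w)" for w
    using that
  proof (induction w arbitrary: f n q)
    case Nil
    have P: "q \<Longrightarrow> f [] v_even = 0" "\<not> q \<Longrightarrow> f [] v_odd = 0"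
      using Nil.prems(1,2) by (auto simp: has_parity_def)
    note pair = top_linear_pair[OF Nil.prems(3)]
    have "Sa x v_even = (if odd_gen x then (0, snd (Sa x v_even)) else (fst (Sa x v_even), 0))"
      "Sa x v_odd = (if odd_gen x then (fst (Sa x v_odd), 0) else (0, snd (Sa x v_odd)))"
      by (cases x; simp add: v_even_def v_odd_def)+
    then obtain a b where "Sa x v_even = (if odd_gen x then (0, a) else (a, 0))"
      "Sa x v_odd = (if odd_gen x then (b, 0) else (0, b))" by metis
    then show ?case using P by (auto simp: pair)
  next
    case (Cons y w)
    then obtain m where n: "n = Suc m" "length w = m" by auto
    have P: "has_parity m (q \<noteq> odd_gen y) (\<lambda>v. f (y # v))" for y
      using Cons.prems(2) unfolding has_parity_def n
    proof (intro allI impI)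
      fix v :: "ramond_gen list" assume "length v = m"
      then show "(odd_word v \<noteq> (q \<noteq> odd_gen y) \<longrightarrow> f (y # v) v_even = 0) \<and>
          (odd_word v = (q \<noteq> odd_gen y) \<longrightarrow> f (y # v) v_odd = 0)"
        using Cons.prems(2)[unfolded has_parity_def n, rule_format, of "y # v"] by (cases "odd_gen y") auto
    qed
    have IH: "(odd_word w \<noteq> ((q \<noteq> odd_gen y) \<noteq> odd_gen x) \<longrightarrow> der x (\<lambda>v. f (y # v)) w v_even = 0) \<and>
        (odd_word w = ((q \<noteq> odd_gen y) \<noteq> odd_gen x) \<longrightarrow> der x (\<lambda>v. f (y # v)) w v_odd = 0)"
      by (rule Cons.IH[OF n(2) P]) (rule Cons.prems)
    have B: "lincomb (ramond_bracket x y) (\<lambda>u. f (u # w) s) = lincomb (ramond_bracket x y) (\<lambda>u. 0)"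
      if "odd_word w \<noteq> ((q \<noteq> odd_gen y) \<noteq> odd_gen x) \<and> s = v_even \<or>
          odd_word w = ((q \<noteq> odd_gen y) \<noteq> odd_gen x) \<and> s = v_odd" for s
    proof (rule lincomb_cong)
      fix u assume "u \<in> Poly_Mapping.keys (ramond_bracket x y)"
      then have "odd_gen u \<longleftrightarrow> odd_gen x \<noteq> odd_gen y" by (rule keys_bracket_parity)
      then show "f (u # w) s = 0"
        using P[of u, unfolded has_parity_def, rule_format, OF n(2)] that by auto
    qed
    have Z: "lincomb p (\<lambda>u. 0) = 0" for p :: "ramond_gen \<Rightarrow>\<^sub>0 complex" by (simp add: lincomb_def)
    have O: "odd_word (y # w) = (odd_word w \<noteq> odd_gen y)" by simp
    have "odd_word w \<noteq> ((q \<noteq> odd_gen y) \<noteq> odd_gen x) \<longrightarrow> lincomb (ramond_bracket x y) (\<lambda>u. f (u # w) v_even) = 0"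
      "odd_word w = ((q \<noteq> odd_gen y) \<noteq> odd_gen x) \<longrightarrow> lincomb (ramond_bracket x y) (\<lambda>u. f (u # w) v_odd) = 0"
      using B[of v_even] B[of v_odd] Z by metis+
    then show ?case unfolding der.simps O using IH
      by (cases q; cases "odd_gen x"; cases "odd_gen y"; cases "odd_word w"; simp)
  qed
  then show ?thesis using assms unfolding has_parity_def by blast
qed

lemma has_parity_wproj:
  assumes l: "top_linear l" and q: "q \<Longrightarrow> l v_even = 0" "\<not> q \<Longrightarrow> l v_odd = 0"
  shows "has_parity n q (wproj l)"
proof (induction n)
  case 0
  show ?case unfolding has_parity_def using q by (simp add: wproj_Nil)
next
  case (Suc n)
  show ?case unfolding has_parity_def
  proof (intro allI impI)
    fix w :: "ramond_gen list" assume "length w = Suc n"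
    then obtain z v where w: "w = z # v" "length v = n" by (cases w) auto
    have "odd_word w = (odd_word v \<noteq> odd_gen z)" using w by simp
    then show "(odd_word w \<noteq> q \<longrightarrow> wproj l w v_even = 0) \<and> (odd_word w = q \<longrightarrow> wproj l w v_odd = 0)"
      using has_parity_der[OF Suc top_linear_wproj[OF l], of z] w
      by (cases "z \<in> ramond_minus") (auto simp: wproj_minus wproj_plus ramond_plus_iff has_parity_def)
  qed
qed

section \<open>Descent from words to the enveloping algebra and the Verma module\<close>

lemma lincomb_diff_fun: "lincomb p (\<lambda>x. g x - h x) = lincomb p g - lincomb p h"
  by (simp add: lincomb_def ring_distribs sum_subtractf)

lemma lincomb_mult:
  fixes p q :: tensor_alg
  shows "lincomb (p * q) g = lincomb p (\<lambda>v. lincomb q (\<lambda>w. g (v + w)))"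
proof -
  have "p \<in> pm.span (range (\<lambda>x. Poly_Mapping.single x 1))" by (simp add: pm_span_singles)
  then show ?thesis
  proof (induction rule: pm.span_induct_alt)
    case base then show ?case by simp
  next
    case (step c x p')
    then obtain v where x: "x = Poly_Mapping.single v 1" by blast
    have "q \<in> pm.span (range (\<lambda>x. Poly_Mapping.single x 1))" by (simp add: pm_span_singles)
    then have "lincomb (Poly_Mapping.single v 1 * q) g = lincomb q (\<lambda>w. g (v + w))"
    proof (induction rule: pm.span_induct_alt)
      case base then show ?case by simp
    next
      case (step c x q')
      then show ?case
        by (auto simp: distrib_left lincomb_add mult_single)
    qed
    then show ?case using step
      by (simp add: x distrib_right lincomb_add lincomb_pscale pscale_mult_left del: pscale_single)
  qed
qed

lemma lincomb_pushforward: "lincomb (pushforward f p) g = lincomb p (\<lambda>x. g (f x))"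
proof -
  have "p \<in> pm.span (range (\<lambda>x. Poly_Mapping.single x 1))" by (simp add: pm_span_singles)
  then show ?thesis
  proof (induction rule: pm.span_induct_alt)
    case base
    then show ?case by (simp add: pushforward_def)
  next
    case (step c x p')
    then show ?case by (auto simp: pushforward_add lincomb_add)
  qed
qed

definition Tproj :: "(top_space \<Rightarrow> complex) \<Rightarrow> tensor_alg \<Rightarrow> top_space \<Rightarrow> complex"
  where "Tproj l p s = lincomb p (\<lambda>w. wproj l (letters w) s)"

text \<open>Convolution with a and b distributes the relator over all pairs of words, where
  \<open>relator_free_wproj\<close> applies.\<close>

lemma Tproj_ideal:
  assumes l: "top_linear l" and "p \<in> ramond_ideal" shows "Tproj l p s = 0"
  using assms(2) unfolding ramond_ideal_def
proof (induction rule: pm.span_induct_alt)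
  case base then show ?case by (simp add: Tproj_def)
next
  case (step c z q)
  then obtain a x y b where z: "z = a * ramond_relator x y * b" by blast
  have rel: "lincomb (ramond_relator x y) h =
      h (Word [x, y]) - super_sign x y * h (Word [y, x]) - lincomb (ramond_bracket x y) (\<lambda>u. h (Word [u]))" for h
    by (simp add: ramond_relator_def tgen_def tlin_def mult_single plus_word_def lincomb_diff
        lincomb_add lincomb_uminus lincomb_pushforward super_sign_def)
  have free: "wproj l (v @ x # y # w) s - super_sign x y * wproj l (v @ y # x # w) s
      - lincomb (ramond_bracket x y) (\<lambda>u. wproj l (v @ u # w) s) = 0" for v w
    using relator_free_wproj[OF l, of "length v + length w"]
    unfolding relator_free_def by (metis add_diff_cancel_left' diff_self)
  have lin: "lincomb b (\<lambda>w. F w - k * H w - lincomb q (\<lambda>u. K u w))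
     = lincomb b F - k * lincomb b H - lincomb q (\<lambda>u. lincomb b (K u))" for F H K k and q :: "ramond_gen \<Rightarrow>\<^sub>0 complex"
    by (simp add: lincomb_diff_fun lincomb_cmult_fun lincomb_swap[of b q])
  have "Tproj l z s = lincomb a (\<lambda>v. lincomb b (\<lambda>w. wproj l (letters v @ x # y # letters w) s
      - super_sign x y * wproj l (letters v @ y # x # letters w) s
      - lincomb (ramond_bracket x y) (\<lambda>u. wproj l (letters v @ u # letters w) s)))"
    unfolding Tproj_def z by (simp add: lincomb_mult rel lin plus_word_def)
  also have "\<dots> = 0" unfolding free by (simp add: lincomb_def)
  finally show ?case using step
    by (simp add: Tproj_def lincomb_add lincomb_pscale)
qed

definition Uproj :: "(top_space \<Rightarrow> complex) \<Rightarrow> ramond_U \<Rightarrow> top_space \<Rightarrow> complex"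
  where "Uproj l u s = Tproj l (rep_ramond_U u) s"

lemma Uproj_abs: "top_linear l \<Longrightarrow> Uproj l (abs_ramond_U p) s = Tproj l p s"
proof -
  assume l: "top_linear l"
  have "ramond_cong (rep_ramond_U (abs_ramond_U p)) p"
    by (metis Quotient_rep_abs Quotient_ramond_U ramond_cong_refl)
  then have "Tproj l (rep_ramond_U (abs_ramond_U p) - p) s = 0"
    unfolding ramond_cong_def using Tproj_ideal[OF l] by blast
  then show ?thesis by (simp add: Uproj_def Tproj_def lincomb_diff)
qed

lemma ramond_U_abs_cases: obtains p where "u = abs_ramond_U p"
  by (metis Quotient_abs_rep Quotient_ramond_U)

lemma Uproj_add: "top_linear l \<Longrightarrow> Uproj l (u + v) s = Uproj l u s + Uproj l v s"
  by (rule ramond_U_abs_cases[of u], rule ramond_U_abs_cases[of v])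
     (simp add: plus_ramond_U.abs_eq Uproj_abs Tproj_def lincomb_add)

lemma Uproj_scale: "top_linear l \<Longrightarrow> Uproj l (Uscale k u) s = k * Uproj l u s"
  by (rule ramond_U_abs_cases[of u]) (simp add: Uscale.abs_eq Uproj_abs Tproj_def lincomb_pscale)

lemma top_linear_Uproj: "top_linear l \<Longrightarrow> top_linear (Uproj l u)"
proof -
  assume l: "top_linear l"
  note lin = top_linearD[OF top_linear_wproj[OF l]]
  show ?thesis
    unfolding top_linear_def Uproj_def Tproj_def
    by (simp only: lin lincomb_add_fun lincomb_cmult_fun simp_thms)
qed

lemma Uproj_Umon: "top_linear l \<Longrightarrow> Uproj l (Umon xs) s = wproj l xs s"
  by (simp add: Umon_abs Uproj_abs Tproj_def)

lemma Uproj_minus: "top_linear l \<Longrightarrow> x \<in> ramond_minus \<Longrightarrow> Uproj l (Ugen x * u) s = 0"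
  by (rule ramond_U_abs_cases[of u])
     (simp add: Ugen.abs_eq times_ramond_U.abs_eq Uproj_abs Tproj_def lincomb_mult tgen_def plus_word_def
       wproj_minus, simp add: lincomb_def)

lemma Uproj_plus: "top_linear l \<Longrightarrow> x \<in> ramond_plus \<Longrightarrow> Uproj l (u * Ugen x) s = Uproj l u (Sa x s)"
proof (rule ramond_U_abs_cases[of u])
  fix p assume l: "top_linear l" "x \<in> ramond_plus" "u = abs_ramond_U p"
  have "wproj l (v @ [x]) s = wproj l v (Sa x s)" for v
    using balanced_wproj[OF l(1)] l(2) unfolding balanced_def by blast
  then show ?thesis using l
    by (simp add: Ugen.abs_eq times_ramond_U.abs_eq Uproj_abs Tproj_def lincomb_mult tgen_def plus_word_def)
qed

definition Fproj :: "(top_space \<Rightarrow> complex) \<Rightarrow> formal_tensor \<Rightarrow> complex"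
  where "Fproj l p = lincomb p (\<lambda>(u, s). Uproj l u s)"

lemma Fproj_relations:
  assumes l: "top_linear l" and "r \<in> tensor_relations central_charge lowest_weight"
  shows "Fproj l r = 0"
proof -
  note simps = Fproj_def lincomb_diff lincomb_pscale lincomb_single case_prod_conv
    Uproj_add[OF l] Uproj_scale[OF l] Uproj_plus[OF l] top_linearD[OF top_linear_Uproj[OF l]]
  from assms(2) show ?thesis
    unfolding tensor_relations_def
  proof (elim UnE CollectE exE conjE, goal_cases)
    case (2 u s s')
    then show ?case by (simp only: simps) (simp add: algebra_simps)
  qed (simp_all add: simps del: pscale_single)
qed

definition vproj :: "(top_space \<Rightarrow> complex) \<Rightarrow> verma \<Rightarrow> complex"
  where "vproj l x = Fproj l (rep_verma x)"

lemma vproj_abs: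
  assumes l: "top_linear l" shows "vproj l (abs_verma p) = Fproj l p"
proof -
  have "tensor_cong central_charge lowest_weight (rep_verma (abs_verma p)) p"
    by (metis Quotient_rep_abs Quotient_verma tensor_cong_refl)
  then have "rep_verma (abs_verma p) - p \<in> pm.span (tensor_relations central_charge lowest_weight)"
    by (simp add: tensor_cong_def)
  then have "Fproj l (rep_verma (abs_verma p) - p) = 0"
  proof (induction rule: pm.span_induct_alt)
    case base then show ?case by (simp add: Fproj_def)
  next
    case (step c x y)
    then show ?case using Fproj_relations[OF l, of x]
      by (simp add: Fproj_def lincomb_add lincomb_pscale)
  qed
  then show ?thesis by (simp add: vproj_def Fproj_def lincomb_diff)
qed

lemma verma_abs_cases: obtains p where "x = abs_verma p"
  by (metis Quotient_abs_rep Quotient_verma)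

lemma vproj_add: "top_linear l \<Longrightarrow> vproj l (x + y) = vproj l x + vproj l y"
  by (rule verma_abs_cases[of x], rule verma_abs_cases[of y])
     (simp add: plus_verma.abs_eq vproj_abs Fproj_def lincomb_add)

lemma vproj_scale: "top_linear l \<Longrightarrow> vproj l (Vscale k x) = k * vproj l x"
  by (rule verma_abs_cases[of x]) (simp add: Vscale.abs_eq vproj_abs Fproj_def lincomb_pscale)

lemma vproj_tensor: "top_linear l \<Longrightarrow> vproj l (tensor u s) = Uproj l u s"
  by (simp add: tensor.abs_eq vproj_abs Fproj_def)

definition top_proj :: "verma \<Rightarrow> top_space"
  where "top_proj x = (vproj fst x, vproj snd x)"

lemma top_proj_add: "top_proj (x + y) = top_proj x + top_proj y"
  by (simp add: top_proj_def vproj_add top_linear_fst top_linear_snd)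

lemma top_proj_scale: "top_proj (Vscale k x) = Sscale k (top_proj x)"
  by (simp add: top_proj_def vproj_scale top_linear_fst top_linear_snd Sscale_def)

text \<open>The consequence of PBW on which the proof rests: s can be recovered from 1 \<otimes> s,
  so the top space embeds and the Verma module is nonzero.\<close>

lemma top_proj_top: "top_proj (tensor 1 s) = s"
  using Uproj_Umon[OF top_linear_fst, of "[]" s] Uproj_Umon[OF top_linear_snd, of "[]" s]
  by (simp add: top_proj_def vproj_tensor top_linear_fst top_linear_snd Umon_def wproj_Nil)

lemma top_proj_minus: "x \<in> ramond_minus \<Longrightarrow> top_proj (Vact (Ugen x) y) = 0"
proof (induction y rule: verma_induct)
  case (tensor u s)
  then show ?case
    by (simp add: top_proj_def vproj_tensor top_linear_fst top_linear_snd Uproj_minus zero_prod_def)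
next
  case (add y z)
  then show ?case
    using linear_Vact[of "Ugen x"] by (simp add: Vector_Spaces.linear_iff top_proj_add)
qed

lemma top_proj_Vpart:
  assumes "x \<in> Vpart p" shows "(if p then fst else snd) (top_proj x) = 0"
  using assms unfolding Vpart_def
proof (induction rule: V.span_induct_alt)
  case base
  have "top_proj (Vscale 0 0) = Sscale 0 (top_proj 0)" by (rule top_proj_scale)
  then show ?case by (simp add: Sscale_def)
next
  case (step c x y)
  have P: "has_parity n False (wproj fst)" "has_parity n True (wproj snd)" for n
    by (rule has_parity_wproj; simp add: top_linear_fst top_linear_snd v_even_def v_odd_def)+
  have "(if p then fst else snd) (top_proj x) = 0"
    using step(1) P
    by (auto simp: top_proj_def vproj_tensor top_linear_fst top_linear_snd Uproj_Umon has_parity_def)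
  then show ?case using step by (simp add: top_proj_add top_proj_scale Sscale_def split: if_splits)
qed

text \<open>B may be linearly dependent, so coefficients cannot be compared. Split a combination for
  x by whether the eigenvalue is l. The remainder z again has eigenvalue l but lies in the span of
  eigenvectors for a finite set E of other eigenvalues; applying H - m removes these one by one
  until z = 0.\<close>

lemma (in vector_space) eigenvector_in_span:
  assumes H: "Vector_Spaces.linear scale scale H"
    and B: "\<And>b. b \<in> B \<Longrightarrow> \<exists>m. H b = scale m b"
    and x: "x \<in> span B" "H x = scale l x"
  shows "x \<in> span {b \<in> B. H b = scale l b}"
proof -
  interpret H: Vector_Spaces.linear scale scale H by fact
  have zero: "z = 0" if "finite E" "l \<notin> E" "z \<in> span {b \<in> B. \<exists>m\<in>E. H b = scale m b}" "H z = scale l z" for E z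
    using that
  proof (induction E arbitrary: z rule: finite_induct)
    case empty
    then show ?case by simp
  next
    case (insert m E)
    have step: "H y - scale m y \<in> span {b \<in> B. \<exists>m\<in>E. H b = scale m b}"
      if "y \<in> span {b \<in> B. \<exists>m\<in>insert m E. H b = scale m b}" for y
      using that
    proof (induction rule: span_induct_alt)
      case base
      then show ?case by (simp add: H.zero span_zero)
    next
      case (step c b y)
      have "H b - scale m b \<in> span {b \<in> B. \<exists>m\<in>E. H b = scale m b}"
      proof (cases "H b = scale m b")
        case True
        then show ?thesis by (simp add: span_zero)
      next
        case False
        then obtain m' where m': "m' \<in> E" "b \<in> B" "H b = scale m' b" using step(1) by blast
        then have "b \<in> span {b \<in> B. \<exists>m\<in>E. H b = scale m b}" by (intro span_base) blast
        then show ?thesis unfolding m'(3) by (intro span_diff span_scale)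
      qed
      then have "scale c (H b - scale m b) + (H y - scale m y) \<in> span {b \<in> B. \<exists>m\<in>E. H b = scale m b}"
        using step(2) by (intro span_add span_scale)
      moreover have "H (scale c b + y) - scale m (scale c b + y) = scale c (H b - scale m b) + (H y - scale m y)"
        by (simp add: H.add H.scale algebra_simps)
      ultimately show ?case by simp
    qed
    have "scale (l - m) z \<in> span {b \<in> B. \<exists>m\<in>E. H b = scale m b}"
      using step[OF insert.prems(2)] insert.prems(3) by (simp add: scale_left_diff_distrib)
    then have "scale (inverse (l - m)) (scale (l - m) z) \<in> span {b \<in> B. \<exists>m\<in>E. H b = scale m b}"
      by (rule span_scale)
    moreover have "l - m \<noteq> 0" using insert.prems(1) by auto
    ultimately have "z \<in> span {b \<in> B. \<exists>m\<in>E. H b = scale m b}" by simp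
    then show ?case using insert.IH insert.prems by simp
  qed
  from x(1) obtain T r where T: "finite T" "T \<subseteq> B" and xT: "x = (\<Sum>b\<in>T. scale (r b) b)"
    unfolding span_explicit by blast
  obtain e where e: "\<And>b. b \<in> B \<Longrightarrow> H b = scale (e b) b" using B by metis
  define T1 where "T1 = {b \<in> T. H b = scale l b}"
  define y where "y = (\<Sum>b\<in>T1. scale (r b) b)"
  define z where "z = (\<Sum>b\<in>T - T1. scale (r b) b)"
  have fin: "finite T1" "T1 \<subseteq> T" using T by (auto simp: T1_def)
  have xyz: "x = z + y"
    unfolding xT y_def z_def using sum.subset_diff[OF fin(2) T(1)] by blast
  have Hy: "H y = scale l y"
    unfolding y_def H.sum scale_sum_right by (rule sum.cong) (auto simp: T1_def H.scale scale_left_commute)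
  have Hz: "H z = scale l z"
    using x(2) Hy unfolding xyz H.add scale_right_distrib by simp
  have "z = 0"
  proof (rule zero[OF _ _ _ Hz])
    show "finite (e ` (T - T1))" using T by simp
    show "l \<notin> e ` (T - T1)" using e T by (auto simp: T1_def)
    show "z \<in> span {b \<in> B. \<exists>m\<in>e ` (T - T1). H b = scale m b}"
      unfolding z_def using e T by (intro span_sum span_scale span_base) blast
  qed
  moreover have "y \<in> span {b \<in> B. H b = scale l b}"
    unfolding y_def using T by (intro span_sum span_scale span_base) (auto simp: T1_def)
  ultimately show ?thesis using xyz by simp
qed

section \<open>The modes on the Verma module\<close>

abbreviation Lv :: "int \<Rightarrow> verma \<Rightarrow> verma" where "Lv n \<equiv> Vact (Ugen (Lgen n))"
abbreviation Gv :: "int \<Rightarrow> verma \<Rightarrow> verma" where "Gv n \<equiv> Vact (Ugen (Ggen n))"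

lemma Vact_add: "Vact u (x + y) = Vact u x + Vact u y"
  and Vact_scale: "Vact u (Vscale k x) = Vscale k (Vact u x)"
  and Vact_zero [simp]: "Vact u 0 = 0"
  and Vact_diff: "Vact u (x - y) = Vact u x - Vact u y"
  and Vact_uminus: "Vact u (- x) = - Vact u x"
  and Vact_sum: "Vact u (\<Sum>i\<in>I. f i) = (\<Sum>i\<in>I. Vact u (f i))"
  using linear_Vact[of u]
  by (simp_all add: Vector_Spaces.linear_iff_module_hom module_hom.add module_hom.scale
      module_hom.zero module_hom.diff module_hom.neg module_hom.sum)

lemma Ugen_Cgen_commute: "Ugen Cgen * u = u * Ugen Cgen"
  using U_span_Umon[of u]
proof (induction rule: U.span_induct_alt)
  case base
  show ?case by simp
next
  case (step c x y)
  then obtain xs where x: "x = Umon xs" by blast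
  have gen: "Ugen Cgen * Ugen g = Ugen g * Ugen Cgen" for g
    using Ugen_relation[of Cgen g] by (simp add: Ulin_zero)
  have "Ugen Cgen * Umon xs = Umon xs * Ugen Cgen"
  proof (induction xs)
    case Nil
    then show ?case by (simp add: Umon_def)
  next
    case (Cons g xs)
    have "Ugen Cgen * Umon (g # xs) = (Ugen Cgen * Ugen g) * Umon xs"
      by (simp add: Umon_def mult.assoc)
    also have "\<dots> = Ugen g * (Umon xs * Ugen Cgen)" by (simp add: gen mult.assoc Cons)
    finally show ?case by (simp add: Umon_def mult.assoc)
  qed
  then show ?case using step x by (simp add: distrib_left distrib_right Uscale_mult)
qed

lemma Vact_Cgen: "Vact (Ugen Cgen) x = Vscale central_charge x"
proof (induction x rule: verma_induct)
  case (tensor u s)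
  have "Vact (Ugen Cgen) (tensor u s) = tensor (u * Ugen Cgen) s"
    by (simp add: Ugen_Cgen_commute)
  also have "\<dots> = tensor u (Sa Cgen s)"
    by (rule tensor_balanced) (simp add: ramond_plus_def)
  also have "Sa Cgen s = Sscale central_charge s" by (cases s) (simp add: Sscale_def)
  finally show ?case by (simp add: tensor_scale_right)
next
  case (add x y)
  then show ?case by (simp add: Vact_add V.scale_right_distrib)
qed

lemma Vact_gen_gen:
  "Vact (Ugen x) (Vact (Ugen y) z) = Vscale (super_sign x y) (Vact (Ugen y) (Vact (Ugen x) z))
     + Vact (Ulin (ramond_bracket x y)) z"
proof -
  have "Ugen x * Ugen y = Uscale (super_sign x y) (Ugen y * Ugen x) + Ulin (ramond_bracket x y)"
    using Ugen_relation[of x y] by (simp add: super_sign_def U.scale_minus_left)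
  then show ?thesis by (simp add: Vact_mult[symmetric] Vact_scale_left[symmetric] Vact_add_left[symmetric])
qed

text \<open>The factor -21/48 is c/12; in \<open>Vact_GG\<close> the factor -7/4 is c/3.\<close>

lemma Vact_LL: "Lv m (Lv n x) = Lv n (Lv m x) + Vscale (of_int (m - n)) (Lv (m + n) x)
    + Vscale (if m = - n then - 21 / 48 * of_int (m ^ 3 - m) else 0) x"
  by (simp add: Vact_gen_gen[of "Lgen m" "Lgen n"] super_sign_def Ulin_add Ulin_single Vact_add_left
      Vact_scale_left Vact_Cgen) (simp add: central_charge_def)

lemma Vact_GL: "Gv m (Lv n x) = Lv n (Gv m x) + Vscale (of_int m - of_int n / 2) (Gv (m + n) x)"
  by (simp add: Vact_gen_gen[of "Ggen m" "Lgen n"] super_sign_def Ulin_single Vact_scale_left)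

lemma Vact_LG: "Lv n (Gv m x) = Gv m (Lv n x) + Vscale (of_int n / 2 - of_int m) (Gv (m + n) x)"
  by (simp add: Vact_GL V.scale_left_diff_distrib)

lemma Vact_GG: "Gv m (Gv n x) = - Gv n (Gv m x) + Vscale 2 (Lv (m + n) x)
    + Vscale (if m = - n then - 7 / 4 * (of_int m ^ 2 - 1 / 4) else 0) x"
  by (simp add: Vact_gen_gen[of "Ggen m" "Ggen n"] super_sign_def Ulin_add Ulin_single Vact_add_left
      Vact_scale_left Vact_Cgen) (simp add: central_charge_def)

lemma central_charge_top: "lowest_weight - central_charge / 24 = 1 / 8"
  by (simp add: central_charge_def lowest_weight_def)

section \<open>The grading of the Verma module by conformal weight\<close>

fun mode :: "ramond_gen \<Rightarrow> int" where
  "mode (Lgen n) = n"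
| "mode (Ggen n) = n"
| "mode Cgen = 0"

text \<open>Defined as an eigenspace of L_0, which makes sense without a basis;
  \<open>Vlevel_span\<close> then relates it to monomials.\<close>

definition Vlevel :: "int \<Rightarrow> verma set"
  where "Vlevel n = {x. Lv 0 x = Vscale (lowest_weight + of_int n) x}"

lemma subspace_Vlevel: "V.subspace (Vlevel n)"
  by (auto simp: Vlevel_def V.subspace_def Vact_add Vact_scale V.scale_right_distrib mult.commute)

lemma Vact_Vlevel: "x \<in> Vlevel n \<Longrightarrow> Vact (Ugen g) x \<in> Vlevel (n - mode g)"
proof (cases g)
  case (Lgen k)
  assume x: "x \<in> Vlevel n"
  show ?thesis using x Lgen
    by (simp add: Vlevel_def Vact_LL[of 0 k] Vact_scale)
       (simp add: algebra_simps)
next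
  case (Ggen k)
  assume x: "x \<in> Vlevel n"
  show ?thesis using x Ggen
    by (simp add: Vlevel_def Vact_LG[of 0 k] Vact_scale)
       (simp add: algebra_simps)
next
  case Cgen
  assume x: "x \<in> Vlevel n"
  show ?thesis using V.subspace_scale[OF subspace_Vlevel x] Cgen by (simp add: Vact_Cgen)
qed

definition word_level :: "ramond_gen list \<Rightarrow> int"
  where "word_level xs = - (\<Sum>g\<leftarrow>xs. mode g)"

lemma tensor_Umon_Cons: "tensor (Umon (x # xs)) s = Vact (Ugen x) (tensor (Umon xs) s)"
  by (simp add: Umon_def)

lemma tensor_top_level: "tensor 1 s \<in> Vlevel 0"
proof -
  have "tensor (1 * Ugen (Lgen 0)) s = tensor 1 (Sa (Lgen 0) s)"
    by (rule tensor_balanced) (simp add: ramond_plus_def)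
  moreover have "Sa (Lgen 0) s = Sscale lowest_weight s" by (cases s) (simp add: Sscale_def)
  ultimately show ?thesis by (simp add: Vlevel_def tensor_scale_right)
qed

lemma tensor_Umon_level: "tensor (Umon xs) s \<in> Vlevel (word_level xs)"
proof (induction xs)
  case Nil
  then show ?case using tensor_top_level by (simp add: Umon_def word_level_def)
next
  case (Cons x xs)
  have "word_level (x # xs) = word_level xs - mode x" by (simp add: word_level_def)
  then show ?case using Vact_Vlevel[OF Cons, of x] by (simp only: tensor_Umon_Cons)
qed

lemma mode_minus: "x \<in> ramond_minus \<Longrightarrow> mode x < 0"
  by (auto simp: ramond_minus_def)

lemma word_level_minus:
  "set xs \<subseteq> ramond_minus \<Longrightarrow> int (length xs) \<le> word_level xs"
proof (induction xs)
  case (Cons x xs)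
  then show ?case using mode_minus[of x] by (simp add: word_level_def)
qed (simp add: word_level_def)

lemma Vlevel_span:
  "x \<in> Vlevel n \<Longrightarrow> x \<in> V.span {tensor (Umon xs) s | xs s. set xs \<subseteq> ramond_minus \<and> word_level xs = n}"
proof -
  assume x: "x \<in> Vlevel n"
  let ?B = "{tensor (Umon xs) s | xs s. set xs \<subseteq> ramond_minus}"
  let ?C = "{tensor (Umon xs) s | xs s. set xs \<subseteq> ramond_minus \<and> word_level xs = n}"
  have "x \<in> V.span {b \<in> ?B. Lv 0 b = Vscale (lowest_weight + of_int n) b}"
  proof (rule V.eigenvector_in_span[OF linear_Vact _ verma_span])
    show "Lv 0 x = Vscale (lowest_weight + of_int n) x" using x by (simp add: Vlevel_def)
    fix b assume "b \<in> ?B"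
    then show "\<exists>m. Lv 0 b = Vscale m b" using tensor_Umon_level unfolding Vlevel_def by blast
  qed
  \<comment> \<open>A monomial might be zero in the Verma module, and then the eigenvalue equation
    says nothing about its weight; hence the extra 0.\<close>
  moreover have "{b \<in> ?B. Lv 0 b = Vscale (lowest_weight + of_int n) b} \<subseteq> insert 0 ?C"
  proof (safe)
    fix xs s
    assume *: "Lv 0 (tensor (Umon xs) s) = Vscale (lowest_weight + of_int n) (tensor (Umon xs) s)"
      "set xs \<subseteq> ramond_minus" "tensor (Umon xs) s \<noteq> 0"
    then have "Vscale (lowest_weight + of_int (word_level xs)) (tensor (Umon xs) s)
        = Vscale (lowest_weight + of_int n) (tensor (Umon xs) s)"
      using tensor_Umon_level[of xs s] unfolding Vlevel_def by simp
    then have "word_level xs = n" using *(3) V.scale_right_imp_eq by fastforce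
    then show "\<exists>ys t. tensor (Umon xs) s = tensor (Umon ys) t \<and> set ys \<subseteq> ramond_minus \<and> word_level ys = n"
      using * by blast
  qed
  ultimately show ?thesis using V.span_mono V.span_insert_0 by blast
qed

lemma Vlevel_negative: "n < 0 \<Longrightarrow> Vlevel n = {0}"
proof -
  assume n: "n < 0"
  have empty: "{tensor (Umon xs) s | xs s. set xs \<subseteq> ramond_minus \<and> word_level xs = n} = {}"
    using n word_level_minus by force
  have "Vlevel n \<subseteq> V.span {}" using Vlevel_span[of _ n] unfolding empty by (rule subsetI)
  then show ?thesis using V.subspace_0[OF subspace_Vlevel] by auto
qed

lemma Vlevel_zero: "x \<in> Vlevel 0 \<Longrightarrow> \<exists>s. x = tensor 1 s"
proof -
  assume "x \<in> Vlevel 0"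
  moreover have "{tensor (Umon xs) s | xs s. set xs \<subseteq> ramond_minus \<and> word_level xs = 0} \<subseteq> range (tensor 1)"
    using word_level_minus by (force simp: Umon_def)
  ultimately have "x \<in> V.span (range (tensor 1))" using Vlevel_span V.span_mono by blast
  then show ?thesis
  proof (induction rule: V.span_induct_alt)
    case base
    have "tensor 1 (Sscale 0 0) = Vscale 0 (tensor 1 0)" by (rule tensor_scale_right)
    then show ?case by (metis V.scale_zero_left)
  next
    case (step c x y)
    then show ?case by (metis rangeE tensor_add_right tensor_scale_right)
  qed
qed

lemma span_Vlevel: "x \<in> V.span (\<Union>n\<in>{0..}. Vlevel n)"
proof -
  have "{tensor (Umon xs) s | xs s. set xs \<subseteq> ramond_minus} \<subseteq> (\<Union>n\<in>{0..}. Vlevel n)"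
    using tensor_Umon_level word_level_minus by force
  then show ?thesis using verma_span V.span_mono by blast
qed

text \<open>Levels are bounded below and x is a finite sum of homogeneous vectors. This makes the
  null field finite on each vector.\<close>

lemma Vact_locally_finite: "\<exists>K. \<forall>g. mode g > K \<longrightarrow> Vact (Ugen g) x = 0"
  using span_Vlevel[of x]
proof (induction rule: V.span_induct_alt)
  case base
  then show ?case by simp
next
  case (step c x y)
  then obtain n K where "x \<in> Vlevel n" "\<forall>g. mode g > K \<longrightarrow> Vact (Ugen g) y = 0" by blast
  moreover have "Vact (Ugen g) x = 0" if "mode g > n" for g
    using Vact_Vlevel[of x n g] Vlevel_negative[of "n - mode g"] that \<open>x \<in> Vlevel n\<close> by simp
  ultimately have "\<forall>g. mode g > max n K \<longrightarrow> Vact (Ugen g) (Vscale c x + y) = 0"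
    by (simp add: Vact_add Vact_scale)
  then show ?case by blast
qed

lemma top_proj_zero [simp]: "top_proj 0 = 0"
  using top_proj_scale[of 0 0] by (simp add: Sscale_def zero_prod_def)

lemma top_proj_diff: "top_proj (x - y) = top_proj x - top_proj y"
  using top_proj_add[of "x - y" y] by (simp add: algebra_simps)

lemma top_proj_level: "x \<in> Vlevel n \<Longrightarrow> n \<noteq> 0 \<Longrightarrow> top_proj x = 0"
proof -
  assume x: "x \<in> Vlevel n" and n: "n \<noteq> 0"
  have "x \<in> V.span {tensor (Umon xs) s | xs s. set xs \<subseteq> ramond_minus \<and> word_level xs = n}"
    using x by (rule Vlevel_span)
  then show ?thesis
  proof (induction rule: V.span_induct_alt)
    case base
    then show ?case by simp
  next
    case (step c x y)
    then obtain xs s where xs: "x = tensor (Umon xs) s" "set xs \<subseteq> ramond_minus" "word_level xs = n" by blast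
    then obtain g ys where "xs = g # ys" using n by (cases xs) (auto simp: word_level_def)
    then have "top_proj x = 0"
      using xs top_proj_minus[of g] by (simp add: tensor_Umon_Cons del: Vact_tensor)
    then show ?case using step by (simp add: top_proj_add top_proj_scale Sscale_def zero_prod_def)
  qed
qed

definition (in vector_space) functional :: "('b \<Rightarrow> 'a) \<Rightarrow> bool"
  where "functional f \<longleftrightarrow> (\<forall>x y. f (x + y) = f x + f y) \<and> (\<forall>k x. f (scale k x) = k * f x)"

lemma (in vector_space) functional_simps:
  assumes "functional f"
  shows "f (x + y) = f x + f y" "f (scale k x) = k * f x" "f 0 = 0" "f (- x) = - f x"
    "f (x - y) = f x - f y" "f (\<Sum>i\<in>I. g i) = (\<Sum>i\<in>I. f (g i))"
proof -
  show a: "f (x + y) = f x + f y" "f (scale k x) = k * f x" for x y k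
    using assms by (auto simp: functional_def)
  show z: "f 0 = 0" using a(2)[of 0 0] by simp
  show m: "f (- x) = - f x" for x using a(1)[of x "- x"] z by (simp add: add_eq_0_iff)
  show "f (x - y) = f x - f y" using a(1)[of x "- y"] m by simp
  show "f (\<Sum>i\<in>I. g i) = (\<Sum>i\<in>I. f (g i))"
    by (induction I rule: infinite_finite_induct) (auto simp: a z)
qed

text \<open>Extend x - y to a basis and take its coordinate. Vector identities thereby become
  complex ones, open to field arithmetic.\<close>

lemma (in vector_space) functional_eqI:
  assumes "\<And>f. functional f \<Longrightarrow> f x = f y"
  shows "x = y"
proof (rule ccontr)
  assume "x \<noteq> y"
  then have v: "independent {x - y}" by simp
  define B where "B = extend_basis {x - y}"
  have B: "independent B" "span B = UNIV" "x - y \<in> B"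
    using independent_extend_basis[OF v] span_extend_basis[OF v] extend_basis_superset[OF v]
    by (auto simp: B_def)
  define f where "f = (\<lambda>z. representation B z (x - y))"
  have "functional f"
    using B unfolding functional_def f_def by (simp add: representation_add representation_scale)
  moreover have "f (x - y) = 1" unfolding f_def using B by (simp add: representation_basis)
  ultimately show False using assms functional_simps(5) by (metis eq_iff_diff_eq_0 zero_neq_one)
qed

section \<open>The null field\<close>

definition killed :: "int \<Rightarrow> verma \<Rightarrow> bool"
  where "killed R x \<longleftrightarrow> (\<forall>g. mode g > R \<longrightarrow> Vact (Ugen g) x = 0)"

lemma killed_mono: "killed R x \<Longrightarrow> R \<le> S \<Longrightarrow> killed S x"
  by (auto simp: killed_def)

lemma ex_killed: "\<exists>R. killed R x"
  using Vact_locally_finite unfolding killed_def .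

lemma killedL: "killed R x \<Longrightarrow> k > R \<Longrightarrow> Lv k x = 0"
  and killedG: "killed R x \<Longrightarrow> k > R \<Longrightarrow> Gv k x = 0"
  unfolding killed_def by (metis mode.simps)+

text \<open>The part depending on K is the sum of n - 3k/2 over k = 0, ..., K. It arises from
  rewriting G_{n-k} L_k as L_k G_{n-k}, as [L_k, G_{n-k}] = (3k/2 - n) G_n.\<close>

definition null_coeff :: "int \<Rightarrow> int \<Rightarrow> complex" where
  "null_coeff n K = of_int n * (of_int K + 1) - 3 / 4 * of_int K * (of_int K + 1)
     + (- 3 / 8 * of_int n ^ 2 - of_int n / 2 + 3 / 32)"

definition null_trunc :: "int \<Rightarrow> int \<Rightarrow> verma \<Rightarrow> verma" where
  "null_trunc K n x = (\<Sum>k\<in>{- K..K}. Lv k (Gv (n - k) x)) + Vscale (null_coeff n K) (Gv n x)"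

text \<open>The normally ordered mode is \<open>\<Sum>k<0. L k (G (n - k)) + \<Sum>k\<ge>0. G (n - k) (L k)\<close> plus
  \<open>- 3 / 8 * n\<^sup>2 - n / 2 + 3 / 32\<close> times \<open>G n\<close>. Commuting the modes in the second sum back gives
  the symmetric truncations \<open>null_trunc\<close>, which become stationary on every vector.\<close>

definition null_mode :: "int \<Rightarrow> verma \<Rightarrow> verma" where
  "null_mode n x = (THE y. \<exists>K0. \<forall>K\<ge>K0. null_trunc K n x = y)"

lemma sum_int_Suc: "(K::int) \<ge> 0 \<Longrightarrow> (\<Sum>k\<in>{- (K + 1)..K + 1}. f k) = f (- (K + 1)) + (\<Sum>k\<in>{- K..K}. f k) + f (K + 1)"
  for f :: "int \<Rightarrow> 'a::comm_monoid_add"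
proof -
  assume K: "K \<ge> 0"
  have "{- (K + 1)..K + 1} = insert (- (K + 1)) (insert (K + 1) {- K..K})" using K by auto
  moreover have "- (K + 1) \<noteq> K + 1" using K by simp
  ultimately show ?thesis by (simp add: add_ac)
qed

text \<open>The new summand at k = -(K + 1) vanishes because G_{n+K+1} kills x. The one at k = K + 1
  is a pure commutator because L_{K+1} kills x, and \<open>null_coeff\<close> changes by the
  opposite amount.\<close>

lemma null_trunc_step:
  assumes R: "killed R x" and K: "K \<ge> 0" "K \<ge> R" "K \<ge> R - n"
  shows "null_trunc (K + 1) n x = null_trunc K n x"
proof -
  have "Lv (- (K + 1)) (Gv (n - (- (K + 1))) x) = 0"
    using K by (simp add: killedG[OF R])
  moreover have "Lv (K + 1) (Gv (n - (K + 1)) x) = Vscale (3 * (of_int K + 1) / 2 - of_int n) (Gv n x)"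
    using K by (simp add: Vact_LG[of "K + 1"] killedL[OF R])
  moreover have "null_coeff n (K + 1) = null_coeff n K - (3 * (of_int K + 1) / 2 - of_int n)"
    by (simp add: null_coeff_def field_simps)
  ultimately show ?thesis
    unfolding null_trunc_def sum_int_Suc[OF K(1)]
    by (simp only: V.scale_left_diff_distrib[of "null_coeff n K"]) simp
qed

lemma null_mode_eq:
  assumes R: "killed R x" and K: "K \<ge> 0" "K \<ge> R" "K \<ge> R - n"
  shows "null_mode n x = null_trunc K n x"
proof -
  have *: "null_trunc K' n x = null_trunc K n x" if "K' \<ge> K" for K'
    using that
  proof (induction K' rule: int_ge_induct)
    case (step i)
    then show ?case using null_trunc_step[OF R, of i n] K by simp
  qed simp
  show ?thesis unfolding null_mode_def
  proof (rule the_equality)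
    show "\<exists>K0. \<forall>K'\<ge>K0. null_trunc K' n x = null_trunc K n x" using * by blast
    fix y assume "\<exists>K0. \<forall>K\<ge>K0. null_trunc K n x = y"
    then obtain K0 where "\<forall>K\<ge>K0. null_trunc K n x = y" by blast
    then show "y = null_trunc K n x" using *[of "max K K0"] by (metis max.cobounded1 max.cobounded2)
  qed
qed

lemma null_trunc_add: "null_trunc K n (x + y) = null_trunc K n x + null_trunc K n y"
  by (simp add: null_trunc_def Vact_add sum.distrib algebra_simps)

lemma null_trunc_scale: "null_trunc K n (Vscale c x) = Vscale c (null_trunc K n x)"
  by (simp add: null_trunc_def Vact_scale V.scale_sum_right algebra_simps)

text \<open>Provides one cutoff for finitely many vectors and modes, so that all null modes in an
  identity can be truncated alike.\<close>

lemma ex_null_mode: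
  assumes "finite X"
  shows "\<exists>R K0. (\<forall>x\<in>X. killed R x) \<and> 
     (\<forall>K\<ge>K0. \<forall>x\<in>X. \<forall>n\<in>{- D..D}. null_mode n x = null_trunc K n x)"
proof -
  obtain r where r: "\<And>x. killed (r x) x" using ex_killed by metis
  define R where "R = Max (insert 0 (r ` X))"
  have R: "r x \<le> R" if "x \<in> X" for x using that assms by (simp add: R_def)
  then have k: "killed R x" if "x \<in> X" for x using killed_mono[OF r] that by blast
  have "null_mode n x = null_trunc K n x" if "K \<ge> \<bar>R\<bar> + \<bar>D\<bar>" "x \<in> X" "n \<in> {- D..D}" for K x n
    by (rule null_mode_eq[OF k[OF that(2)]]) (use that in auto)
  then show ?thesis using k by blast
qed

lemma null_mode_add: "null_mode n (x + y) = null_mode n x + null_mode n y"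
proof -
  obtain K0 where N: "\<forall>K\<ge>K0. \<forall>z\<in>{x, y, x + y}. \<forall>n\<in>{- \<bar>n\<bar>..\<bar>n\<bar>}. null_mode n z = null_trunc K n z"
    using ex_null_mode[of "{x, y, x + y}" "\<bar>n\<bar>"] by auto
  have "null_mode n z = null_trunc K0 n z" if "z \<in> {x, y, x + y}" for z
    using N[rule_format, of K0 z n] that by force
  then show ?thesis by (simp add: null_trunc_add)
qed

lemma null_mode_scale: "null_mode n (Vscale c x) = Vscale c (null_mode n x)"
proof -
  obtain K0 where N: "\<forall>K\<ge>K0. \<forall>z\<in>{x, Vscale c x}. \<forall>n\<in>{- \<bar>n\<bar>..\<bar>n\<bar>}. null_mode n z = null_trunc K n z"
    using ex_null_mode[of "{x, Vscale c x}" "\<bar>n\<bar>"] by auto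
  have "null_mode n z = null_trunc K0 n z" if "z \<in> {x, Vscale c x}" for z
    using N[rule_format, of K0 z n] that by force
  then show ?thesis by (simp add: null_trunc_scale)
qed

section \<open>Brackets of the null field with G_m and with L_{-1}, L_0, L_1\<close>

lemma sum_symmetric_squares:
  "(M::int) \<ge> 0 \<Longrightarrow> (\<Sum>p\<in>{- M..M}. of_int p ^ 2 - 1 / 4 :: complex)
     = (2 * of_int M + 1) * (2 * of_int M - 1) * (2 * of_int M + 3) / 12"
proof (induction M rule: int_ge_induct)
  case base
  then show ?case by simp
next
  case (step M)
  show ?case unfolding sum_int_Suc[OF step(1)] step(2) by (simp add: field_simps power2_eq_square)
qed

text \<open>Pairs p with s - p. The given window need not be stable under this reflection, but d
  vanishes below P, so the sum agrees with that over the stable window \<open>?V\<close>. It will be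
  applied to d p = f (G_p G_{s-p} x), with A = 2 f (L_s x) and B = (c/3) f x.\<close>

lemma sum_antisymmetric:
  fixes d :: "int \<Rightarrow> complex"
  assumes d: "\<And>p. d p + d (s - p) = A + (if s = 0 then B * (of_int p ^ 2 - 1 / 4) else 0)"
    and z: "\<And>p. p < P \<Longrightarrow> d p = 0"
    and K: "m - K \<le> P" "s - m - K \<le> P" "P \<le> m + K" "0 \<le> m + K"
  shows "2 * (\<Sum>p\<in>{m - K..m + K}. d p) = (2 * of_int (m + K) + 1 - of_int s) * A
     + (if s = 0 then B * ((2 * of_int (m + K) + 1) * (2 * of_int (m + K) - 1) * (2 * of_int (m + K) + 3) / 12) else 0)"
proof -
  let ?V = "{s - m - K..m + K}"
  have "(\<Sum>p\<in>{m - K..m + K}. d p) = (\<Sum>p\<in>{P..m + K}. d p)"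
    using K by (intro sum.mono_neutral_right) (auto intro!: z)
  moreover have "(\<Sum>p\<in>?V. d p) = (\<Sum>p\<in>{P..m + K}. d p)"
    using K by (intro sum.mono_neutral_right) (auto intro!: z)
  moreover have "(\<Sum>p\<in>?V. d (s - p)) = (\<Sum>p\<in>?V. d p)"
    by (rule sum.reindex_bij_witness[of _ "\<lambda>p. s - p" "\<lambda>p. s - p"]) auto
  ultimately have "2 * (\<Sum>p\<in>{m - K..m + K}. d p) = (\<Sum>p\<in>?V. d p + d (s - p))"
    by (simp add: sum.distrib)
  also have "\<dots> = (\<Sum>p\<in>?V. A + (if s = 0 then B * (of_int p ^ 2 - 1 / 4) else 0))"
    by (simp only: d)
  also have "\<dots> = of_nat (card ?V) * A + (if s = 0 then B * (\<Sum>p\<in>?V. of_int p ^ 2 - 1 / 4) else 0)"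
    by (simp add: sum.distrib sum_distrib_left)
  also have "of_nat (card ?V) = (2 * of_int (m + K) + 1 - of_int s :: complex)"
  proof -
    have "of_nat (card ?V) = (of_int (int (card ?V)) :: complex)" by simp
    also have "int (card ?V) = 2 * (m + K) + 1 - s" using K by simp
    finally show ?thesis by simp
  qed
  also have "(if s = 0 then B * (\<Sum>p\<in>?V. of_int p ^ 2 - 1 / 4) else 0) =
      (if s = 0 then B * ((2 * of_int (m + K) + 1) * (2 * of_int (m + K) - 1) * (2 * of_int (m + K) + 3) / 12) else 0)"
  proof (cases "s = 0")
    case True
    then have "?V = {- (m + K)..m + K}" by auto
    then show ?thesis by (simp only: sum_symmetric_squares[OF K(4)])
  qed simp
  finally show ?thesis .
qed

text \<open>Termwise this is [G_m, L_k] G_{n-k} + L_k {G_m, G_{n-k}}. The last bracket has a central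
  term at k = s alone, which lies in the window as K \<ge> |s|. Under p = m + k the weight m - k/2
  becomes (3m - p)/2.\<close>

lemma null_trunc_anticommutator:
  assumes f: "V.functional f" and s: "s = m + n" and K: "K \<ge> \<bar>s\<bar>"
  shows "f (Gv m (null_trunc K n x) + null_trunc K n (Gv m x)) =
     (\<Sum>p\<in>{m - K..m + K}. (3 * of_int m - of_int p) / 2 * f (Gv p (Gv (s - p) x)))
     + 2 * (\<Sum>k\<in>{- K..K}. f (Lv k (Lv (s - k) x)))
     - 7 / 4 * (of_int m ^ 2 - 1 / 4) * f (Lv s x)
     + null_coeff n K * (2 * f (Lv s x) + (if s = 0 then - 7 / 4 * (of_int m ^ 2 - 1 / 4) * f x else 0))"
proof -
  note fs = V.functional_simps[OF f]
  have summand: "f (Gv m (Lv k (Gv (n - k) x))) + f (Lv k (Gv (n - k) (Gv m x))) =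
      (of_int m - of_int k / 2) * f (Gv (m + k) (Gv (n - k) x)) + 2 * f (Lv k (Lv (s - k) x))
      + (if k = s then - 7 / 4 * (of_int m ^ 2 - 1 / 4) * f (Lv s x) else 0)" for k
    by (simp add: Vact_GL[of m k] Vact_GG[of m "n - k"] Vact_add Vact_scale Vact_uminus Vact_diff fs s)
       (auto simp: algebra_simps)
  have "f (Gv m (null_trunc K n x) + null_trunc K n (Gv m x)) =
      (\<Sum>k\<in>{- K..K}. f (Gv m (Lv k (Gv (n - k) x))) + f (Lv k (Gv (n - k) (Gv m x))))
      + null_coeff n K * (f (Gv m (Gv n x)) + f (Gv n (Gv m x)))"
    by (simp add: null_trunc_def Vact_add Vact_scale Vact_sum fs sum.distrib algebra_simps)
  also have "f (Gv m (Gv n x)) + f (Gv n (Gv m x)) =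
      2 * f (Lv s x) + (if s = 0 then - 7 / 4 * (of_int m ^ 2 - 1 / 4) * f x else 0)"
    by (simp add: Vact_GG[of m n] fs s)
  also have "(\<Sum>k\<in>{- K..K}. f (Gv m (Lv k (Gv (n - k) x))) + f (Lv k (Gv (n - k) (Gv m x)))) =
      (\<Sum>k\<in>{- K..K}. (of_int m - of_int k / 2) * f (Gv (m + k) (Gv (n - k) x)))
      + 2 * (\<Sum>k\<in>{- K..K}. f (Lv k (Lv (s - k) x)))
      + (\<Sum>k\<in>{- K..K}. if k = s then - 7 / 4 * (of_int m ^ 2 - 1 / 4) * f (Lv s x) else 0)"
    unfolding summand by (simp only: sum.distrib sum_distrib_left)
  also have "(\<Sum>k\<in>{- K..K}. if k = s then - 7 / 4 * (of_int m ^ 2 - 1 / 4) * f (Lv s x) else 0)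
      = - 7 / 4 * (of_int m ^ 2 - 1 / 4) * f (Lv s x)"
    using K by (subst sum.delta) auto
  also have "(\<Sum>k\<in>{- K..K}. (of_int m - of_int k / 2) * f (Gv (m + k) (Gv (n - k) x)))
      = (\<Sum>p\<in>{m - K..m + K}. (3 * of_int m - of_int p) / 2 * f (Gv p (Gv (s - p) x)))"
    by (rule sum.reindex_bij_witness[of _ "\<lambda>p. p - m" "\<lambda>k. m + k"]) (auto simp: s field_simps)
  finally show ?thesis by simp
qed

text \<open>This identity forces \<open>c = -21/4\<close> and the coefficients of \<open>n\<^sup>2\<close>, \<open>n\<close> and \<open>1\<close> in
  \<open>null_coeff\<close>.\<close>

lemma null_mode_anticommutator_shift:
  "Gv (m + 1) (null_mode (n - 1) x) + null_mode (n - 1) (Gv (m + 1) x) = Gv m (null_mode n x) + null_mode n (Gv m x)"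
proof (rule V.functional_eqI)
  fix f assume f: "V.functional f"
  note fs = V.functional_simps[OF f]
  define s where "s = m + n"
  obtain R K0 where R: "\<forall>z\<in>{x, Gv m x, Gv (m + 1) x}. killed R z" and
    K0: "\<forall>K\<ge>K0. \<forall>z\<in>{x, Gv m x, Gv (m + 1) x}. \<forall>k\<in>{- (\<bar>n\<bar> + 1)..\<bar>n\<bar> + 1}. null_mode k z = null_trunc K k z"
    using ex_null_mode[of "{x, Gv m x, Gv (m + 1) x}" "\<bar>n\<bar> + 1"] by auto
  \<comment> \<open>Large enough for the truncations, for d to vanish at the lower ends of the
    windows around m and m + 1, and for d to be explicit at the new upper end.\<close>
  define K where "K = \<bar>K0\<bar> + \<bar>R\<bar> + 2 * \<bar>m\<bar> + 2 * \<bar>n\<bar> + 10"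
  have N: "null_mode k z = null_trunc K k z" if "z \<in> {x, Gv m x, Gv (m + 1) x}" "k \<in> {n, n - 1}" for z k
  proof -
    have "K0 \<le> K" by (simp add: K_def)
    moreover have "k \<in> {- (\<bar>n\<bar> + 1)..\<bar>n\<bar> + 1}" using that by (auto simp: abs_if)
    ultimately show ?thesis using K0 that(1) by blast
  qed
  define d where "d p = f (Gv p (Gv (s - p) x))" for p
  define l where "l = f (Lv s x)"
  define y where "y = f x"
  define S where "S = (\<Sum>p\<in>{m - K..m + K}. d p)"
  have dd: "d p + d (s - p) = 2 * l + (if s = 0 then (- 7 / 4 * y) * (of_int p ^ 2 - 1 / 4) else 0)" for p
    unfolding d_def l_def y_def by (simp add: Vact_GG[of p "s - p"] fs)
  have d0: "d p = 0" if "p < s - R" for p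
    unfolding d_def using that R by (simp add: killedG[of R] fs)
  have d1: "d p = 2 * l + (if s = 0 then (- 7 / 4 * y) * (of_int p ^ 2 - 1 / 4) else 0)" if "p > R" for p
    using dd[of p] d0[of "s - p"] that by simp
  have S: "2 * S = (2 * of_int (m + K) + 1 - of_int s) * (2 * l)
     + (if s = 0 then (- 7 / 4 * y) * ((2 * of_int (m + K) + 1) * (2 * of_int (m + K) - 1) * (2 * of_int (m + K) + 3) / 12) else 0)"
    unfolding S_def by (rule sum_antisymmetric[where d = d, OF dd, of "s - R"]) (auto simp: d0 K_def s_def)
  have e0: "d (m - K) = 0" by (rule d0) (simp add: K_def s_def)
  \<comment> \<open>The window around m + 1 gains the point m + 1 + K and loses m - K, where d is
    zero; on the common part the weight grows by 3/2.\<close>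
  have "{m - K..m + K} = insert (m - K) {m + 1 - K..m + K}" by (auto simp: K_def)
  then have A: "(\<Sum>p\<in>{m - K..m + K}. g p * d p) = (\<Sum>p\<in>{m + 1 - K..m + K}. g p * d p)" for g
    using e0 by simp
  have "{m + 1 - K..m + 1 + K} = insert (m + 1 + K) {m + 1 - K..m + K}" by (auto simp: K_def)
  then have "(\<Sum>p\<in>{m + 1 - K..m + 1 + K}. (3 * of_int (m + 1) - of_int p) / 2 * d p)
      = (3 * of_int (m + 1) - of_int (m + 1 + K)) / 2 * d (m + 1 + K)
        + (\<Sum>p\<in>{m - K..m + K}. (3 * of_int (m + 1) - of_int p) / 2 * d p)"
    unfolding A by simp
  also have "(\<Sum>p\<in>{m - K..m + K}. (3 * of_int (m + 1) - of_int p) / 2 * d p) =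
      (\<Sum>p\<in>{m - K..m + K}. (3 * of_int m - of_int p) / 2 * d p) + 3 / 2 * S"
    unfolding S_def sum_distrib_left sum.distrib[symmetric] by (rule sum.cong) (auto simp: field_simps)
  finally have shift: "(\<Sum>p\<in>{m + 1 - K..m + 1 + K}. (3 * of_int (m + 1) - of_int p) / 2 * d p)
      = (3 * of_int (m + 1) - of_int (m + 1 + K)) / 2 * d (m + 1 + K)
        + ((\<Sum>p\<in>{m - K..m + K}. (3 * of_int m - of_int p) / 2 * d p) + 3 / 2 * S)" .
  have dK: "d (m + 1 + K) = 2 * l + (if s = 0 then (- 7 / 4 * y) * (of_int (m + 1 + K) ^ 2 - 1 / 4) else 0)"
    by (rule d1) (simp add: K_def)
  have n: "n = s - m" by (simp add: s_def)
  have S': "S = ((2 * of_int (m + K) + 1 - of_int s) * (2 * l)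
     + (if s = 0 then (- 7 / 4 * y) * ((2 * of_int (m + K) + 1) * (2 * of_int (m + K) - 1) * (2 * of_int (m + K) + 3) / 12) else 0)) / 2"
    unfolding S[symmetric] by simp
  define c where "c k = 7 / 4 * (of_int k ^ 2 - 1 / 4) * l" for k :: int
  define N' where "N' j k = null_coeff j K * (2 * l + (if s = 0 then - 7 / 4 * (of_int k ^ 2 - 1 / 4) * y else 0))"
    for j k :: int
  define T where "T k = (\<Sum>p\<in>{k - K..k + K}. (3 * of_int k - of_int p) / 2 * d p)" for k :: int
  define W where "W = 2 * (\<Sum>k\<in>{- K..K}. f (Lv k (Lv (s - k) x)))"
  define D where "D = (3 * of_int (m + 1) - of_int (m + 1 + K)) / 2 * d (m + 1 + K)"
  \<comment> \<open>What is left once T m and W have cancelled: a polynomial identity in m, s and K,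
    linear in l and y.\<close>
  have lin: "D + 3 / 2 * S - c (m + 1) + N' (n - 1) (m + 1) = - c m + N' n m"
    unfolding D_def c_def N'_def dK S' null_coeff_def n
    by (cases "s = 0") (simp_all add: field_simps power2_eq_square)
  have shift': "T (m + 1) = D + (T m + 3 / 2 * S)"
    unfolding T_def D_def by (rule shift)
  have 1: "f (Gv (m + 1) (null_mode (n - 1) x) + null_mode (n - 1) (Gv (m + 1) x)) = T (m + 1) + W - c (m + 1) + N' (n - 1) (m + 1)"
    using null_trunc_anticommutator[OF f, of s "m + 1" "n - 1" K x]
    unfolding d_def l_def y_def T_def W_def c_def N'_def by (simp add: N s_def K_def)
  have 2: "f (Gv m (null_mode n x) + null_mode n (Gv m x)) = T m + W - c m + N' n m"
    using null_trunc_anticommutator[OF f, of s "m" "n" K x]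
    unfolding d_def l_def y_def T_def W_def c_def N'_def by (simp add: N s_def K_def)
  show "f (Gv (m + 1) (null_mode (n - 1) x) + null_mode (n - 1) (Gv (m + 1) x)) = f (Gv m (null_mode n x) + null_mode n (Gv m x))"
    unfolding 1 2 shift' using lin by (simp add: algebra_simps)
qed

text \<open>The condition on m singles out -1, 0, 1, where the central term of [L_m, L_k] is absent.
  The Leibniz rule gives two sums, the first of which is reindexed by p = m + k.\<close>

lemma null_trunc_commutator:
  assumes f: "V.functional f" and m: "m ^ 3 = m"
  shows "f (Lv m (null_trunc K n x) - null_trunc K n (Lv m x)) =
     (\<Sum>p\<in>{m - K..m + K}. (2 * of_int m - of_int p) * f (Lv p (Gv (m + n - p) x)))
     + (\<Sum>p\<in>{- K..K}. (of_int m / 2 - of_int n + of_int p) * f (Lv p (Gv (m + n - p) x)))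
     + null_coeff n K * (of_int m / 2 - of_int n) * f (Gv (m + n) x)"
proof -
  note fs = V.functional_simps[OF f]
  have summand: "f (Lv m (Lv k (Gv (n - k) x))) - f (Lv k (Gv (n - k) (Lv m x))) =
      (of_int m - of_int k) * f (Lv (m + k) (Gv (n - k) x))
      + (of_int m / 2 - of_int n + of_int k) * f (Lv k (Gv (m + n - k) x))" for k
  proof -
    have 1: "Lv m (Lv k z) = Lv k (Lv m z) + Vscale (of_int (m - k)) (Lv (m + k) z)" for z
      unfolding Vact_LL[of m k] m by simp
    have 2: "Lv m (Gv (n - k) x) = Gv (n - k) (Lv m x) + Vscale (of_int m / 2 - of_int (n - k)) (Gv (m + n - k) x)"
      by (simp add: Vact_LG[of m "n - k"] add_diff_eq add.commute)
    show ?thesis unfolding 1 2 Vact_add Vact_scale fs by (simp add: algebra_simps)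
  qed
  have "f (Lv m (null_trunc K n x) - null_trunc K n (Lv m x)) =
      (\<Sum>k\<in>{- K..K}. f (Lv m (Lv k (Gv (n - k) x))) - f (Lv k (Gv (n - k) (Lv m x))))
      + null_coeff n K * (f (Lv m (Gv n x)) - f (Gv n (Lv m x)))"
    by (simp add: null_trunc_def Vact_add Vact_scale Vact_sum fs sum_subtractf algebra_simps)
  also have "f (Lv m (Gv n x)) - f (Gv n (Lv m x)) = (of_int m / 2 - of_int n) * f (Gv (m + n) x)"
    by (simp add: Vact_LG[of m n] fs add.commute)
  also have "(\<Sum>k\<in>{- K..K}. f (Lv m (Lv k (Gv (n - k) x))) - f (Lv k (Gv (n - k) (Lv m x)))) =
      (\<Sum>k\<in>{- K..K}. (of_int m - of_int k) * f (Lv (m + k) (Gv (n - k) x)))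
      + (\<Sum>k\<in>{- K..K}. (of_int m / 2 - of_int n + of_int k) * f (Lv k (Gv (m + n - k) x)))"
    unfolding summand by (simp only: sum.distrib)
  also have "(\<Sum>k\<in>{- K..K}. (of_int m - of_int k) * f (Lv (m + k) (Gv (n - k) x)))
      = (\<Sum>p\<in>{m - K..m + K}. (2 * of_int m - of_int p) * f (Lv p (Gv (m + n - p) x)))"
    by (rule sum.reindex_bij_witness[of _ "\<lambda>p. p - m" "\<lambda>k. m + k"]) auto
  finally show ?thesis by simp
qed

text \<open>The commutator of a primary field of weight 7/2, with coefficient (7/2 - 1) m - n. For m
  = 1 and m = -1 the two windows differ by a point at each end: the lower one contributes nothing,
  the upper one is absorbed by \<open>null_coeff\<close>.\<close>

lemma null_mode_commutator:
  assumes m: "m \<in> {- 1, 0, 1}"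
  shows "Lv m (null_mode n x) = null_mode n (Lv m x) + Vscale (5 / 2 * of_int m - of_int n) (null_mode (m + n) x)"
proof (rule V.functional_eqI)
  fix f assume f: "V.functional f"
  note fs = V.functional_simps[OF f]
  obtain R K0 where R: "\<forall>z\<in>{x, Lv m x}. killed R z" and
    K0: "\<forall>K\<ge>K0. \<forall>z\<in>{x, Lv m x}. \<forall>k\<in>{- (\<bar>n\<bar> + 1)..\<bar>n\<bar> + 1}. null_mode k z = null_trunc K k z"
    using ex_null_mode[of "{x, Lv m x}" "\<bar>n\<bar> + 1"] by auto
  define K where "K = \<bar>K0\<bar> + \<bar>R\<bar> + 2 * \<bar>n\<bar> + 10"
  have N: "null_mode k z = null_trunc K k z" if "z \<in> {x, Lv m x}" "k \<in> {n, m + n}" for z k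
  proof -
    have "K0 \<le> K" by (simp add: K_def)
    moreover have "k \<in> {- (\<bar>n\<bar> + 1)..\<bar>n\<bar> + 1}" using that m by (auto simp: abs_if)
    ultimately show ?thesis using K0 that(1) by blast
  qed
  define e where "e p = f (Lv p (Gv (m + n - p) x))" for p
  define y where "y = f (Gv (m + n) x)"
  define S where "S = (\<Sum>p\<in>{- K..K}. e p)"
  have e0: "e p = 0" if "p < m + n - R" for p
    unfolding e_def using that R by (simp add: killedG[of R] fs)
  have e1: "e p = (3 / 2 * of_int p - of_int (m + n)) * y" if "p > R" for p
    unfolding e_def y_def using that R by (simp add: Vact_LG[of p "m + n - p"] killedL[of R] fs algebra_simps)
  have split: "(\<Sum>p\<in>{m - K..m + K}. (2 * of_int m - of_int p) * e p) + (\<Sum>p\<in>{- K..K}. (of_int m / 2 - of_int n + of_int p) * e p)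
      = (5 / 2 * of_int m - of_int n) * S
        + (if m = 1 then (1 - of_int K) * e (K + 1) else if m = - 1 then (2 + of_int K) * e K else 0)"
  proof -
    have S: "(5 / 2 * of_int m - of_int n) * S = (\<Sum>p\<in>{- K..K}. (2 * of_int m - of_int p) * e p)
        + (\<Sum>p\<in>{- K..K}. (of_int m / 2 - of_int n + of_int p) * e p)"
      unfolding S_def sum_distrib_left sum.distrib[symmetric]
      by (rule sum.cong) (auto simp: field_simps)
    \<comment> \<open>For m = 1 the window gains p = K + 1, of weight 2m - p = 1 - K; for m = -1 it
      loses p = K, of weight -2 - K.\<close>
    have "(\<Sum>p\<in>{m - K..m + K}. (2 * of_int m - of_int p) * e p) = (\<Sum>p\<in>{- K..K}. (2 * of_int m - of_int p) * e p)
        + (if m = 1 then (1 - of_int K) * e (K + 1) else if m = - 1 then (2 + of_int K) * e K else 0)"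
    proof -
      consider "m = 0" | "m = 1" | "m = - 1" using m by blast
      then show ?thesis
      proof cases
        case 2
        have "{1 - K..1 + K} = insert (K + 1) {1 - K..K}" "{- K..K} = insert (- K) {1 - K..K}"
          by (auto simp: K_def)
        moreover have "e (- K) = 0" using m by (intro e0) (auto simp: K_def)
        ultimately show ?thesis using 2 by simp
      next
        case 3
        have "{- 1 - K..- 1 + K} = insert (- 1 - K) {- K..K - 1}" "{- K..K} = insert K {- K..K - 1}"
          by (auto simp: K_def)
        moreover have "e (- 1 - K) = 0" using m by (intro e0) (auto simp: K_def)
        ultimately show ?thesis using 3 by (simp add: algebra_simps)
      qed simp
    qed
    then show ?thesis using S by simp
  qed
  have eK: "e (K + 1) = (3 / 2 * of_int (K + 1) - of_int (m + n)) * y"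
    "e K = (3 / 2 * of_int K - of_int (m + n)) * y"
    by (rule e1, simp add: K_def)+
  have lin: "(if m = 1 then (1 - of_int K) * e (K + 1) else if m = - 1 then (2 + of_int K) * e K else 0)
      + null_coeff n K * (of_int m / 2 - of_int n) * y = (5 / 2 * of_int m - of_int n) * (null_coeff (m + n) K * y)"
    unfolding eK null_coeff_def using m by (auto simp: field_simps power2_eq_square)
  have "f (Lv m (null_mode n x)) - f (null_mode n (Lv m x)) =
     (\<Sum>p\<in>{m - K..m + K}. (2 * of_int m - of_int p) * e p) + (\<Sum>p\<in>{- K..K}. (of_int m / 2 - of_int n + of_int p) * e p)
     + null_coeff n K * (of_int m / 2 - of_int n) * y"
    using null_trunc_commutator[OF f, of m K n x] m unfolding e_def y_def by (auto simp: N fs)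
  also have "\<dots> = (5 / 2 * of_int m - of_int n) * (S + null_coeff (m + n) K * y)"
    unfolding split using lin by (simp add: algebra_simps)
  also have "S + null_coeff (m + n) K * y = f (null_mode (m + n) x)"
    by (simp add: N null_trunc_def fs S_def e_def y_def)
  finally show "f (Lv m (null_mode n x)) = f (null_mode n (Lv m x) + Vscale (5 / 2 * of_int m - of_int n) (null_mode (m + n) x))"
    by (simp only: fs diff_eq_eq add.commute)
qed

section \<open>The superpartner of the null field\<close>

text \<open>By \<open>null_mode_anticommutator_shift\<close>, {G_m, N_k} is the same for all m + k =
  n; the representative with m = 0 is taken.\<close>

definition partner_mode :: "int \<Rightarrow> verma \<Rightarrow> verma"
  where "partner_mode n x = Gv 0 (null_mode n x) + null_mode n (Gv 0 x)"

lemma null_mode_zero [simp]: "null_mode n 0 = 0" using null_mode_scale[of n 0 0] by simp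
lemma null_mode_uminus: "null_mode n (- x) = - null_mode n x" using null_mode_scale[of n "- 1" x] by simp

lemma partner_mode_add: "partner_mode n (x + y) = partner_mode n x + partner_mode n y"
  by (simp add: partner_mode_def Vact_add null_mode_add)

lemma partner_mode_scale: "partner_mode n (Vscale c x) = Vscale c (partner_mode n x)"
  by (simp add: partner_mode_def Vact_scale null_mode_scale V.scale_right_distrib)

lemma Gv_null_mode:
  assumes "j \<in> {- 1, 0, 1}"
  shows "Gv j (null_mode n x) = partner_mode (n + j) x - null_mode n (Gv j x)"
  using assms null_mode_anticommutator_shift[of 0 "n + 1" x] null_mode_anticommutator_shift[of "- 1" n x]
  by (auto simp: partner_mode_def eq_diff_eq)

lemma Gv_0_0: "Gv 0 (Gv 0 x) = Lv 0 x + Vscale (7 / 32) x"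
proof -
  have "Gv 0 (Gv 0 x) + Gv 0 (Gv 0 x) = Vscale 2 (Lv 0 x) + Vscale (7 / 16) x"
    using Vact_GG[of 0 0 x] by (simp add: eq_neg_iff_add_eq_0 algebra_simps)
  then have "Vscale 2 (Gv 0 (Gv 0 x)) = Vscale 2 (Lv 0 x + Vscale (7 / 32) x)"
    using V.scale_left_distrib[of 1 1 "Gv 0 (Gv 0 x)"] by (simp add: V.scale_right_distrib)
  then show ?thesis using V.scale_left_imp_eq[of 2] by simp
qed

text \<open>For j = 0, [G_0, {G_0, N_n}] = [G_0^2, N_n] = [L_0, N_n]. For j = 1 and j = -1, move G_j
  past G_0 by {G_j, G_0} = 2 L_j and use the brackets of the null field with L_j and G_j; multiples
  of N_{n+j} remain.\<close>

lemma Gv_partner_mode: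
  assumes "j \<in> {- 1, 0, 1}"
  shows "\<exists>c. Gv j (partner_mode n x) = partner_mode n (Gv j x) + Vscale c (null_mode (n + j) x)"
proof (cases "j = 0")
  case True
  have "Gv 0 (partner_mode n x) - partner_mode n (Gv 0 x) = Gv 0 (Gv 0 (null_mode n x)) - null_mode n (Gv 0 (Gv 0 x))"
    by (simp add: partner_mode_def Vact_add)
  also have "\<dots> = Lv 0 (null_mode n x) - null_mode n (Lv 0 x)"
    by (simp add: Gv_0_0 null_mode_add null_mode_scale)
  also have "\<dots> = Vscale (- of_int n) (null_mode n x)"
    using null_mode_commutator[of 0 n x] by simp
  finally show ?thesis using True by (metis add.commute add.right_neutral diff_eq_eq)
next
  case False
  have comm: "Gv j (Gv 0 y) = Vscale 2 (Lv j y) - Gv 0 (Gv j y)" for y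
    using False by (simp add: Vact_GG[of j 0])
  have "Gv j (partner_mode n x) - partner_mode n (Gv j x)
      = Gv j (Gv 0 (null_mode n x)) + Gv j (null_mode n (Gv 0 x)) - Gv 0 (null_mode n (Gv j x)) - null_mode n (Gv 0 (Gv j x))"
    by (simp add: partner_mode_def Vact_add)
  also have "\<dots> = Vscale 2 (Lv j (null_mode n x)) - Gv 0 (Gv j (null_mode n x)) + (partner_mode (n + j) (Gv 0 x) - null_mode n (Gv j (Gv 0 x)))
      - Gv 0 (null_mode n (Gv j x)) - null_mode n (Gv 0 (Gv j x))"
    by (simp only: comm Gv_null_mode[OF assms, of n "Gv 0 x"])
  also have "Gv 0 (Gv j (null_mode n x)) = Gv 0 (partner_mode (n + j) x) - Gv 0 (null_mode n (Gv j x))"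
    by (simp only: Gv_null_mode[OF assms] Vact_diff)
  also have "null_mode n (Gv j (Gv 0 x)) = Vscale 2 (null_mode n (Lv j x)) - null_mode n (Gv 0 (Gv j x))"
    using null_mode_add[of n "Vscale 2 (Lv j x)" "- Gv 0 (Gv j x)"] by (simp add: comm null_mode_uminus null_mode_scale)
  also have "Gv 0 (partner_mode (n + j) x) = partner_mode (n + j) (Gv 0 x) + Vscale (- of_int (n + j)) (null_mode (n + j) x)"
  proof -
    have "Gv 0 (partner_mode (n + j) x) - partner_mode (n + j) (Gv 0 x)
        = Gv 0 (Gv 0 (null_mode (n + j) x)) - null_mode (n + j) (Gv 0 (Gv 0 x))"
      by (simp add: partner_mode_def Vact_add)
    also have "\<dots> = Lv 0 (null_mode (n + j) x) - null_mode (n + j) (Lv 0 x)"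
      by (simp add: Gv_0_0 null_mode_add null_mode_scale)
    also have "\<dots> = Vscale (- of_int (n + j)) (null_mode (n + j) x)"
      using null_mode_commutator[of 0 "n + j" x] by simp
    finally show ?thesis by (simp add: algebra_simps)
  qed
  also have "Vscale 2 (Lv j (null_mode n x)) = Vscale 2 (null_mode n (Lv j x)) + Vscale (2 * (5 / 2 * of_int j - of_int n)) (null_mode (j + n) x)"
    by (simp add: null_mode_commutator[OF assms] V.scale_right_distrib)
  finally have "Gv j (partner_mode n x) - partner_mode n (Gv j x) =
      Vscale (2 * (5 / 2 * of_int j - of_int n)) (null_mode (n + j) x) - Vscale (- of_int (n + j)) (null_mode (n + j) x)"
    by (simp add: add.commute)
  then have "Gv j (partner_mode n x) = partner_mode n (Gv j x) + Vscale (2 * (5 / 2 * of_int j - of_int n) - - of_int (n + j)) (null_mode (n + j) x)"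
    by (simp only: V.scale_left_diff_distrib diff_eq_eq add.commute)
  then show ?thesis by blast
qed

lemma ex_null_trunc: "\<exists>K. null_mode n x = null_trunc K n x"
proof -
  obtain R where "killed R x" using ex_killed by blast
  then have "null_mode n x = null_trunc (\<bar>R\<bar> + \<bar>n\<bar>) n x" by (rule null_mode_eq) auto
  then show ?thesis by blast
qed

section \<open>Parity and conformal weight of the modes\<close>

lemma Vact_Vpart:
  assumes "x \<in> Vpart p" shows "Vact (Ugen g) x \<in> Vpart (p \<noteq> odd_gen g)"
  using assms unfolding Vpart_def
proof (induction rule: V.span_induct_alt)
  case base
  then show ?case by (simp add: V.span_zero)
next
  case (step c x y)
  let ?B = "\<lambda>p. {tensor (Umon xs) v_even | xs. odd (length (filter odd_gen xs)) = p} \<union>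
      {tensor (Umon xs) v_odd | xs. even (length (filter odd_gen xs)) = p}"
  obtain xs where "x = tensor (Umon xs) v_even \<and> odd (length (filter odd_gen xs)) = p \<or>
      x = tensor (Umon xs) v_odd \<and> even (length (filter odd_gen xs)) = p" using step(1) by blast
  then have "Vact (Ugen g) x = tensor (Umon (g # xs)) v_even \<and> odd (length (filter odd_gen (g # xs))) = (p \<noteq> odd_gen g) \<or>
      Vact (Ugen g) x = tensor (Umon (g # xs)) v_odd \<and> even (length (filter odd_gen (g # xs))) = (p \<noteq> odd_gen g)"
    by (auto simp: Umon_def)
  then have "Vact (Ugen g) x \<in> ?B (p \<noteq> odd_gen g)" by blast
  then show ?case using step(2) by (simp only: Vact_add Vact_scale V.span_add V.span_scale V.span_base)
qed

lemma subspace_Vpart: "V.subspace (Vpart p)"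
  unfolding Vpart_def by (rule V.subspace_span)

lemma null_mode_Vpart: "x \<in> Vpart p \<Longrightarrow> null_mode n x \<in> Vpart (\<not> p)"
proof -
  assume x: "x \<in> Vpart p"
  obtain K where K: "null_mode n x = null_trunc K n x" using ex_null_trunc by blast
  have 1: "Lv k (Gv (n - k) x) \<in> Vpart (\<not> p)" for k
    using Vact_Vpart[OF Vact_Vpart[OF x, of "Ggen (n - k)"], of "Lgen k"] by simp
  have 2: "Gv n x \<in> Vpart (\<not> p)" using Vact_Vpart[OF x, of "Ggen n"] by simp
  show ?thesis
    unfolding K null_trunc_def
    by (intro V.subspace_add[OF subspace_Vpart] V.subspace_sum[OF subspace_Vpart]
        V.subspace_scale[OF subspace_Vpart] 1 2)
qed

lemma partner_mode_Vpart: "x \<in> Vpart p \<Longrightarrow> partner_mode n x \<in> Vpart p"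
proof -
  assume x: "x \<in> Vpart p"
  have "Gv 0 (null_mode n x) \<in> Vpart p" using Vact_Vpart[OF null_mode_Vpart[OF x, of n], of "Ggen 0"] by simp
  moreover have "null_mode n (Gv 0 x) \<in> Vpart p" using null_mode_Vpart[OF Vact_Vpart[OF x, of "Ggen 0"], of n] by simp
  ultimately show ?thesis unfolding partner_mode_def by (rule V.subspace_add[OF subspace_Vpart])
qed

lemma null_mode_Vlevel: "x \<in> Vlevel k \<Longrightarrow> null_mode n x \<in> Vlevel (k - n)"
proof -
  assume x: "x \<in> Vlevel k"
  obtain K where K: "null_mode n x = null_trunc K n x" using ex_null_trunc by blast
  have 1: "Lv i (Gv (n - i) x) \<in> Vlevel (k - n)" for i
    using Vact_Vlevel[OF Vact_Vlevel[OF x, of "Ggen (n - i)"], of "Lgen i"] by simp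
  have 2: "Gv n x \<in> Vlevel (k - n)" using Vact_Vlevel[OF x, of "Ggen n"] by simp
  show ?thesis
    unfolding K null_trunc_def
    by (intro V.subspace_add[OF subspace_Vlevel] V.subspace_sum[OF subspace_Vlevel]
        V.subspace_scale[OF subspace_Vlevel] 1 2)
qed

lemma partner_mode_Vlevel: "x \<in> Vlevel k \<Longrightarrow> partner_mode n x \<in> Vlevel (k - n)"
proof -
  assume x: "x \<in> Vlevel k"
  have "Gv 0 (null_mode n x) \<in> Vlevel (k - n)" using Vact_Vlevel[OF null_mode_Vlevel[OF x, of n], of "Ggen 0"] by simp
  moreover have "null_mode n (Gv 0 x) \<in> Vlevel (k - n)" using null_mode_Vlevel[OF Vact_Vlevel[OF x, of "Ggen 0"], of n] by simp
  ultimately show ?thesis unfolding partner_mode_def by (rule V.subspace_add[OF subspace_Vlevel])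
qed

section \<open>Submodules as subspaces closed under G_{-1}, G_0, G_1\<close>

text \<open>For m \<noteq> 0, L_m is half of {G_m, G_0}, and [L_e, G_m] is a nonzero multiple of
  G_{m+e} for the m in question. So G_0 and G_e reach every mode of the sign of e.\<close>

lemma generated_modes:
  assumes X: "V.subspace X" and e: "e \<in> {- 1, 1}"
    and G0: "\<And>x. x \<in> X \<Longrightarrow> Gv 0 x \<in> X" and Ge: "\<And>x. x \<in> X \<Longrightarrow> Gv e x \<in> X"
    and x: "x \<in> X"
  shows "Gv (e * (1 + int k)) x \<in> X \<and> Lv (e * (1 + int k)) x \<in> X"
  using x
proof (induction k arbitrary: x)
  have L: "Lv m x \<in> X" if "m \<noteq> 0" "x \<in> X" "\<And>x. x \<in> X \<Longrightarrow> Gv m x \<in> X" for m x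
  proof -
    have "Vscale (1 / 2) (Gv m (Gv 0 x) + Gv 0 (Gv m x)) = Lv m x"
      using that(1) by (simp add: Vact_GG[of m 0])
    moreover have "Vscale (1 / 2) (Gv m (Gv 0 x) + Gv 0 (Gv m x)) \<in> X"
      using that G0 by (intro V.subspace_scale[OF X] V.subspace_add[OF X]) auto
    ultimately show ?thesis by simp
  qed
  {
    case 0
    then show ?case using Ge L[of e x] e by auto
  next
    case (Suc k)
    let ?m = "e * (1 + int k)"
    have G: "Gv (e * (1 + int (Suc k))) x \<in> X" if x: "x \<in> X" for x
    proof -
      \<comment> \<open>The coefficient of G_{m+e} in [L_e, G_m]; it is half an odd integer, hence
        nonzero.\<close>
      define a :: complex where "a = of_int e / 2 - of_int ?m"
      have a: "a \<noteq> 0"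
      proof -
        have "2 * a = of_int (e * (- 1 - 2 * int k))" by (simp add: a_def algebra_simps)
        moreover have "e * (- 1 - 2 * int k) \<noteq> 0" using e by auto
        ultimately show ?thesis by (metis mult_zero_right of_int_eq_0_iff)
      qed
      have "Lv e (Gv ?m x) - Gv ?m (Lv e x) = Vscale a (Gv (e * (1 + int (Suc k))) x)"
        unfolding Vact_LG[of e ?m] by (simp add: a_def algebra_simps)
      moreover have "Lv e (Gv ?m x) - Gv ?m (Lv e x) \<in> X"
        using Suc.IH x L[of e] Ge e by (intro V.subspace_diff[OF X]) auto
      ultimately have "Vscale (1 / a) (Vscale a (Gv (e * (1 + int (Suc k))) x)) \<in> X"
        using V.subspace_scale[OF X] by metis
      then show ?thesis using a by simp
    qed
    have "e * (1 + int (Suc k)) \<noteq> 0" using e by auto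
    then show ?case using G L Suc.prems by blast
  }
qed

lemma closed_minus:
  assumes X: "V.subspace X"
    and "\<And>x. x \<in> X \<Longrightarrow> Gv 0 x \<in> X" "\<And>x. x \<in> X \<Longrightarrow> Gv (- 1) x \<in> X"
    and "g \<in> ramond_minus" "x \<in> X"
  shows "Vact (Ugen g) x \<in> X"
proof -
  obtain n where n: "n < 0" "g = Lgen n \<or> g = Ggen n" using assms(4) by (auto simp: ramond_minus_def)
  then have "n = - 1 * (1 + int (nat (- n - 1)))" by simp
  then show ?thesis
    using generated_modes[OF X, of "- 1" x "nat (- n - 1)"] assms n by auto
qed

lemma submoduleI:
  assumes X: "V.subspace X"
    and G: "\<And>j x. j \<in> {- 1, 0, 1} \<Longrightarrow> x \<in> X \<Longrightarrow> Gv j x \<in> X"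
    and x: "x \<in> X"
  shows "Vact u x \<in> X"
proof -
  have gen: "Vact (Ugen g) x \<in> X" if "x \<in> X" for g x
  proof (cases "mode g = 0")
    case True
    then consider "g = Lgen 0" | "g = Ggen 0" | "g = Cgen" by (cases g) auto
    then show ?thesis
    proof cases
      case 1
      have "Lv 0 x = Gv 0 (Gv 0 x) - Vscale (7 / 32) x" by (simp add: Gv_0_0)
      then show ?thesis using 1 that
        by (simp del: Vact_tensor) (intro V.subspace_diff[OF X] V.subspace_scale[OF X] G; simp)
    next
      case 3
      then show ?thesis using that by (simp add: Vact_Cgen V.subspace_scale[OF X])
    qed (use G that in auto)
  next
    case False
    define e where "e = sgn (mode g)"
    have e: "e \<in> {- 1, 1}" using False by (auto simp: e_def sgn_if)
    have m: "mode g = e * (1 + int (nat (\<bar>mode g\<bar> - 1)))"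
      using False by (auto simp: e_def sgn_if)
    have "g = Lgen (mode g) \<or> g = Ggen (mode g)" using False by (cases g) auto
    then show ?thesis
      using generated_modes[OF X e, of x "nat (\<bar>mode g\<bar> - 1)"] G e that m by auto
  qed
  show ?thesis using U_span_Umon[of u]
  proof (induction rule: U.span_induct_alt)
    case base
    have "Vact (Uscale 0 0) x = Vscale 0 (Vact 0 x)" by (rule Vact_scale_left)
    then show ?case by (simp add: V.subspace_0[OF X])
  next
    case (step c v w)
    then obtain xs where "v = Umon xs" by blast
    moreover have "Vact (Umon xs) x \<in> X"
    proof (induction xs)
      case Nil
      have "Vact 1 x = x"
      proof (induction x rule: verma_induct)
        case (add x y)
        then show ?case by (simp add: Vact_add)
      qed simp
      then show ?case using x by (simp add: Umon_def)
    next
      case (Cons g xs)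
      then show ?case using gen by (simp add: Umon_def Vact_mult)
    qed
    ultimately show ?case using step
      by (simp add: Vact_add_left Vact_scale_left V.subspace_add[OF X] V.subspace_scale[OF X])
  qed
qed

section \<open>The null submodule misses the top space\<close>

lemma top_proj_Gv_0: "top_proj (Gv 0 x) = Sa (Ggen 0) (top_proj x)"
  using span_Vlevel[of x]
proof (induction rule: V.span_induct_alt)
  case base
  then show ?case by (simp add: zero_prod_def)
next
  case (step c x y)
  then obtain n where n: "n \<ge> 0" "x \<in> Vlevel n" by auto
  have "top_proj (Gv 0 x) = Sa (Ggen 0) (top_proj x)"
  proof (cases "n = 0")
    case True
    then obtain s where x: "x = tensor 1 s" using Vlevel_zero n by blast
    have "tensor (1 * Ugen (Ggen 0)) s = tensor 1 (Sa (Ggen 0) s)"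
      by (rule tensor_balanced) (simp add: ramond_plus_def)
    then show ?thesis by (simp add: x top_proj_top)
  next
    case False
    then show ?thesis
      using n Vact_Vlevel[OF n(2), of "Ggen 0"] by (simp add: top_proj_level[of _ n] zero_prod_def)
  qed
  then show ?case using step(2)
    by (simp add: Vact_add Vact_scale top_proj_add top_proj_scale Sact_add Sact_scale)
qed

lemma Gv_0_top: "Gv 0 (tensor 1 s) = tensor 1 (Sa (Ggen 0) s)"
  using tensor_balanced[of "Ggen 0" 1 s] by (simp add: ramond_plus_def)

text \<open>The only point where the value \<open>h = -3/32\<close> matters for the null field.\<close>

lemma null_mode_0_top: "null_mode 0 (tensor 1 s) = 0"
proof -
  have "killed 0 (tensor 1 s)"
    using Vact_Vlevel[OF tensor_top_level] Vlevel_negative unfolding killed_def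
    by (metis diff_0 neg_less_0_iff_less singletonD)
  then have "null_mode 0 (tensor 1 s) = null_trunc 0 0 (tensor 1 s)" by (rule null_mode_eq) simp_all
  also have "\<dots> = Lv 0 (Gv 0 (tensor 1 s)) + Vscale (3 / 32) (Gv 0 (tensor 1 s))"
    by (simp add: null_trunc_def null_coeff_def del: Vact_tensor)
  also have "Lv 0 (Gv 0 (tensor 1 s)) = Vscale (- 3 / 32) (Gv 0 (tensor 1 s))"
    using tensor_top_level unfolding Gv_0_top Vlevel_def by (simp add: lowest_weight_def del: Vact_tensor)
  finally show ?thesis by (simp flip: V.scale_left_distrib)
qed

text \<open>X is closed under G_0 and G_{-1}: moving either to the left of a null or partner mode
  leaves such modes applied to x itself, while the projection kills the image of G_{-1} and commutes
  with G_0. As these two generate the negative modes, it suffices that X contains the top space,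
  where weights settle n \<noteq> 0 and \<open>null_mode_0_top\<close> settles n = 0.\<close>

lemma top_proj_null_mode_partner_mode: "top_proj (null_mode n x) = 0 \<and> top_proj (partner_mode n x) = 0"
proof -
  define X where "X = {x. \<forall>n. top_proj (null_mode n x) = 0 \<and> top_proj (partner_mode n x) = 0}"
  have S0: "Sscale c 0 = 0" for c by (simp add: Sscale_def zero_prod_def)
  have G00: "Sa (Ggen 0) 0 = 0" by (simp add: zero_prod_def)
  have X: "V.subspace X"
    using partner_mode_scale[of _ 0 0]
    by (auto simp: V.subspace_def X_def null_mode_add partner_mode_add null_mode_scale partner_mode_scale top_proj_add top_proj_scale S0)
  have comm: "null_mode n (Gv j x) = partner_mode (n + j) x - Gv j (null_mode n x)"
    "\<exists>c. partner_mode n (Gv j x) = Gv j (partner_mode n x) - Vscale c (null_mode (n + j) x)" if "j \<in> {- 1, 0}" for n j x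
    using Gv_null_mode[of j n x] Gv_partner_mode[of j n x] that by (auto simp: algebra_simps)
  have G: "Gv j x \<in> X" if "x \<in> X" "j \<in> {- 1, 0}" for x j
  proof -
    have "top_proj y = 0 \<Longrightarrow> top_proj (Gv j y) = 0" for y
      using that(2) top_proj_Gv_0[of y] top_proj_minus[of "Ggen (- 1)" y] G00
      by (auto simp: ramond_minus_def)
    note top = this and j = that(2)
    show ?thesis
      unfolding X_def mem_Collect_eq
    proof (intro allI conjI)
      fix n
      have N: "top_proj (Gv j (null_mode n x)) = 0" "top_proj (Gv j (partner_mode n x)) = 0" "top_proj (partner_mode (n + j) x) = 0"
        "top_proj (null_mode (n + j) x) = 0"
        using that(1) top unfolding X_def by blast+
      then show "top_proj (null_mode n (Gv j x)) = 0"
        using comm(1)[OF that(2), of n x] by (simp add: top_proj_diff)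
      obtain c where "partner_mode n (Gv j x) = Gv j (partner_mode n x) - Vscale c (null_mode (n + j) x)"
        using comm(2)[OF j] by blast
      then show "top_proj (partner_mode n (Gv j x)) = 0"
        using N by (simp add: top_proj_diff top_proj_scale S0)
    qed
  qed
  have top: "tensor 1 s \<in> X" for s
  proof -
    have "top_proj (null_mode n (tensor 1 s)) = 0 \<and> top_proj (partner_mode n (tensor 1 s)) = 0" for n
    proof (cases "n = 0")
      case True
      then show ?thesis by (simp add: partner_mode_def null_mode_0_top Gv_0_top del: Vact_tensor)
    next
      case False
      then show ?thesis
        using top_proj_level[OF null_mode_Vlevel[OF tensor_top_level[of s], of n]]
          top_proj_level[OF partner_mode_Vlevel[OF tensor_top_level[of s], of n]] by simp
    qed
    then show ?thesis by (simp add: X_def)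
  qed
  have "tensor (Umon xs) s \<in> X" if "set xs \<subseteq> ramond_minus" for xs s
    using that
  proof (induction xs)
    case Nil
    then show ?case using top by (simp add: Umon_def)
  next
    case (Cons g xs)
    show ?case unfolding tensor_Umon_Cons
    proof (rule closed_minus[OF X])
      show "g \<in> ramond_minus" "tensor (Umon xs) s \<in> X" using Cons by auto
    qed (simp_all add: G)
  qed
  then have "V.span {tensor (Umon xs) s | xs s. set xs \<subseteq> ramond_minus} \<subseteq> X"
    by (intro V.span_minimal X) blast
  then have "x \<in> X" using verma_span by blast
  then show ?thesis by (simp add: X_def)
qed

lemma span_homogeneous_graded:
  assumes "\<And>b. b \<in> B \<Longrightarrow> \<exists>y\<in>V.span B \<inter> Vpart False. \<exists>z\<in>V.span B \<inter> Vpart True. b = y + z"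
    and "x \<in> V.span B"
  shows "\<exists>y\<in>V.span B \<inter> Vpart False. \<exists>z\<in>V.span B \<inter> Vpart True. x = y + z"
  using assms(2)
proof (induction rule: V.span_induct_alt)
  case base
  then show ?case by (auto simp: V.span_zero V.subspace_0[OF subspace_Vpart] intro!: bexI[of _ 0])
next
  case (step c b x)
  obtain y z where yz: "y \<in> V.span B \<inter> Vpart False" "z \<in> V.span B \<inter> Vpart True" "b = y + z"
    using assms(1)[OF step(1)] by blast
  obtain y' z' where yz': "y' \<in> V.span B \<inter> Vpart False" "z' \<in> V.span B \<inter> Vpart True" "x = y' + z'"
    using step(2) by blast
  have "Vscale c y + y' \<in> V.span B \<inter> Vpart False" "Vscale c z + z' \<in> V.span B \<inter> Vpart True"
    using yz yz' by (auto intro!: V.span_add V.span_scale V.subspace_add[OF subspace_Vpart] V.subspace_scale[OF subspace_Vpart])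
  moreover have "Vscale c b + x = (Vscale c y + y') + (Vscale c z + z')"
    using yz yz' by (simp add: V.scale_right_distrib)
  ultimately show ?case by blast
qed

lemma Vpart_decomposition: "\<exists>y\<in>Vpart False. \<exists>z\<in>Vpart True. x = y + z"
proof -
  let ?B = "Vpart False \<union> Vpart True"
  have "tensor (Umon xs) s \<in> V.span ?B" for xs s
  proof -
    have "s = Sscale (fst s) v_even + Sscale (snd s) v_odd"
      by (simp add: Sscale_def v_even_def v_odd_def)
    then have "tensor (Umon xs) s = Vscale (fst s) (tensor (Umon xs) v_even) + Vscale (snd s) (tensor (Umon xs) v_odd)"
      by (metis tensor_add_right tensor_scale_right)
    moreover have "tensor (Umon xs) v_even \<in> ?B" "tensor (Umon xs) v_odd \<in> ?B"
      unfolding Vpart_def by (cases "odd_word xs"; auto intro!: V.span_base)+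
    ultimately show ?thesis by (simp add: V.span_add V.span_scale V.span_base)
  qed
  then have "V.span {tensor (Umon xs) s | xs s. set xs \<subseteq> ramond_minus} \<subseteq> V.span ?B"
    by (intro V.span_minimal V.subspace_span) blast
  then have "x \<in> V.span ?B" using verma_span by blast
  moreover have "\<exists>y\<in>V.span ?B \<inter> Vpart False. \<exists>z\<in>V.span ?B \<inter> Vpart True. b = y + z" if "b \<in> ?B" for b
    using that V.span_base[OF that] V.span_zero[of ?B] V.subspace_0[OF subspace_Vpart]
    by (metis Int_iff Un_iff add.left_neutral add.right_neutral)
  ultimately show ?thesis using span_homogeneous_graded[of ?B x] by blast
qed

text \<open>J, spanned by all values of null and partner modes, is closed under G_{-1}, G_0, G_1 by
  their brackets, and graded because null modes are odd and partner modes even. It is proper because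
  its top components vanish, unlike that of \<open>tensor 1 v_even\<close>.\<close>

lemma null_mode_max_submodule: "null_mode n x \<in> max_submodule"
proof -
  define B where "B = range (\<lambda>(n, x). null_mode n x) \<union> range (\<lambda>(n, x). partner_mode n x)"
  define J where "J = V.span B"
  have J: "V.subspace J" unfolding J_def by (rule V.subspace_span)
  have NJ: "null_mode n x \<in> J" and PJ: "partner_mode n x \<in> J" for n x
    unfolding J_def B_def by (rule V.span_base, blast)+
  have G: "Gv j x \<in> J" if j: "j \<in> {- 1, 0, 1}" and "x \<in> J" for j x
    using that(2) unfolding J_def
  proof (induction rule: V.span_induct_alt)
    case base
    then show ?case by (simp add: V.span_zero)
  next
    case (step c b x)
    have "Gv j b \<in> J"
      using step(1) unfolding B_def
    proof
      assume "b \<in> range (\<lambda>(n, x). null_mode n x)"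
      then obtain n z where "b = null_mode n z" by auto
      then show ?thesis using Gv_null_mode[OF j] NJ PJ V.subspace_diff[OF J] by simp
    next
      assume "b \<in> range (\<lambda>(n, x). partner_mode n x)"
      then obtain n z where "b = partner_mode n z" by auto
      then show ?thesis using Gv_partner_mode[OF j, of n z] NJ PJ V.subspace_add[OF J] V.subspace_scale[OF J] by metis
    qed
    then show ?case using step(2) unfolding J_def by (simp add: Vact_add Vact_scale V.span_add V.span_scale)
  qed
  have "graded_submodule J"
    unfolding graded_submodule_def
  proof (intro conjI allI ballI)
    show "V.subspace J" by (rule J)
    show "Vact u x \<in> J" if "x \<in> J" for u x using submoduleI[OF J G that] .
    show "\<exists>y\<in>J \<inter> Vpart False. \<exists>z\<in>J \<inter> Vpart True. x = y + z" if x: "x \<in> J" for x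
      unfolding J_def
    proof (rule span_homogeneous_graded)
      show "x \<in> V.span B" using x unfolding J_def .
      fix b assume "b \<in> B"
      then obtain n w where b: "b = null_mode n w \<or> b = partner_mode n w" unfolding B_def by auto
      obtain y z where yz: "y \<in> Vpart False" "z \<in> Vpart True" "w = y + z"
        using Vpart_decomposition by blast
      have "null_mode n z \<in> J \<inter> Vpart False" "null_mode n y \<in> J \<inter> Vpart True"
           "partner_mode n y \<in> J \<inter> Vpart False" "partner_mode n z \<in> J \<inter> Vpart True"
        using NJ PJ null_mode_Vpart[OF yz(1)] null_mode_Vpart[OF yz(2)] partner_mode_Vpart[OF yz(1)] partner_mode_Vpart[OF yz(2)] by auto
      moreover have "null_mode n w = null_mode n z + null_mode n y" "partner_mode n w = partner_mode n y + partner_mode n z"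
        by (simp_all add: yz(3) null_mode_add partner_mode_add add.commute)
      ultimately show "\<exists>y\<in>V.span B \<inter> Vpart False. \<exists>z\<in>V.span B \<inter> Vpart True. b = y + z"
        using b unfolding J_def by blast
    qed
  qed
  moreover have "J \<noteq> UNIV"
  proof
    assume "J = UNIV"
    then have "tensor 1 v_even \<in> V.span B" unfolding J_def by blast
    moreover have "top_proj x = 0" if "x \<in> V.span B" for x
      using that
    proof (induction rule: V.span_induct_alt)
      case base
      then show ?case by simp
    next
      case (step c b x)
      then have "top_proj b = 0" using top_proj_null_mode_partner_mode unfolding B_def by auto
      then show ?case using step by (simp add: top_proj_add top_proj_scale Sscale_def zero_prod_def)
    qed
    ultimately have "v_even = 0" using top_proj_top by metis
    then show False by (simp add: v_even_def zero_prod_def)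
  qed
  ultimately show ?thesis using max_submodule_contains NJ by blast
qed

section \<open>The maximal submodule misses the top space\<close>

text \<open>L_0 - (h + K + 1) kills level K + 1, preserves the lower ones and multiplies the top
  vector by -(K + 1). Repeating this strips y off level by level.\<close>

lemma top_component:
  assumes N: "V.subspace N" "\<And>x. x \<in> N \<Longrightarrow> Lv 0 x \<in> N"
    and "y \<in> V.span (\<Union>n\<in>{1..K}. Vlevel (int n))" "tensor 1 s + y \<in> N"
  shows "tensor 1 s \<in> N"
  using assms(3,4)
proof (induction K arbitrary: y)
  case 0
  then show ?case by simp
next
  case (Suc K)
  define D where "D z = Lv 0 z - Vscale (lowest_weight + of_int (int (Suc K))) z" for z
  have D_add: "D (a + b) = D a + D b" and D_scale: "D (Vscale c a) = Vscale c (D a)" for a b c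
    by (simp_all add: D_def Vact_add Vact_scale algebra_simps)
  have Dlevel: "D z = Vscale (of_int n - of_int (int (Suc K))) z" if "z \<in> Vlevel n" for z n
    using that by (simp add: D_def Vlevel_def V.scale_left_diff_distrib[symmetric] del: of_nat_Suc)
  have Dy: "D y \<in> V.span (\<Union>n\<in>{1..K}. Vlevel (int n))"
    using Suc.prems(1)
  proof (induction rule: V.span_induct_alt)
    case base
    have "D 0 = 0" using D_scale[of 0 0] by simp
    then show ?case by (simp add: V.span_zero)
  next
    case (step c z w)
    then obtain n where n: "n \<in> {1..Suc K}" "z \<in> Vlevel (int n)" by blast
    have "D z \<in> V.span (\<Union>n\<in>{1..K}. Vlevel (int n))"
    proof (cases "n = Suc K")
      case True
      then show ?thesis using Dlevel[OF n(2)] by (simp add: V.span_zero)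
    next
      case False
      then have "z \<in> (\<Union>n\<in>{1..K}. Vlevel (int n))" using n by auto
      then show ?thesis using Dlevel[OF n(2)] by (simp add: V.span_scale V.span_base)
    qed
    then show ?case using step(2) by (simp add: D_add D_scale V.span_add V.span_scale)
  qed
  define a :: complex where "a = - of_int (int (Suc K))"
  have a: "a \<noteq> 0" by (simp add: a_def del: of_nat_Suc)
  have "D (tensor 1 s + y) \<in> N"
    unfolding D_def using N Suc.prems(2) by (intro V.subspace_diff V.subspace_scale) auto
  then have "Vscale (1 / a) (D (tensor 1 s + y)) \<in> N" by (rule V.subspace_scale[OF N(1)])
  moreover have "Vscale (1 / a) (D (tensor 1 s + y)) = tensor 1 s + Vscale (1 / a) (D y)"
  proof -
    have "D (tensor 1 s) = Vscale a (tensor 1 s)"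
      using Dlevel[OF tensor_top_level[of s]] by (simp add: a_def del: of_nat_Suc)
    then show ?thesis using a by (simp add: D_add V.scale_right_distrib)
  qed
  ultimately show ?case
    using Suc.IH[of "Vscale (1 / a) (D y)"] V.span_scale[OF Dy] by simp
qed

lemma top_decomposition:
  "\<exists>K. \<exists>y \<in> V.span (\<Union>n\<in>{1..K}. Vlevel (int n)). x = tensor 1 (top_proj x) + y"
  using span_Vlevel[of x]
proof (induction rule: V.span_induct_alt)
  case base
  have "tensor 1 (Sscale 0 0) = Vscale 0 (tensor 1 0)" by (rule tensor_scale_right)
  then have "tensor 1 0 = 0" by (simp add: Sscale_def zero_prod_def)
  then show ?case by (intro exI[of _ 0] bexI[of _ 0]) (auto simp: V.span_zero)
next
  case (step c x z)
  obtain K y where y: "y \<in> V.span (\<Union>n\<in>{1..K}. Vlevel (int n))" "z = tensor 1 (top_proj z) + y"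
    using step(2) by blast
  obtain n where n: "n \<ge> 0" "x \<in> Vlevel n" using step(1) by auto
  have mono: "V.span (\<Union>n\<in>{1..K}. Vlevel (int n)) \<subseteq> V.span (\<Union>n\<in>{1..max K (nat n)}. Vlevel (int n))"
    by (intro V.span_mono UN_mono) auto
  obtain w where w: "w \<in> V.span (\<Union>n\<in>{1..max K (nat n)}. Vlevel (int n))" "x = tensor 1 (top_proj x) + w"
  proof (cases "n = 0")
    case True
    then obtain s where "x = tensor 1 s" using Vlevel_zero n by blast
    then show ?thesis using that[of 0] by (simp add: top_proj_top V.span_zero)
  next
    case False
    then have "top_proj x = 0" using top_proj_level n by blast
    moreover have "tensor 1 0 = 0"
      using tensor_scale_right[of 1 0 0] by (simp add: Sscale_def zero_prod_def)
    moreover have "x \<in> V.span (\<Union>n\<in>{1..max K (nat n)}. Vlevel (int n))"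
      using n False by (intro V.span_base UN_I[of "nat n"]) auto
    ultimately show ?thesis using that[of x] by simp
  qed
  have "Vscale c x + z = tensor 1 (top_proj (Vscale c x + z)) + (Vscale c w + y)"
    by (subst w(2), subst y(2)) (simp add: top_proj_add top_proj_scale tensor_add_right tensor_scale_right V.scale_right_distrib)
  moreover have "Vscale c w + y \<in> V.span (\<Union>n\<in>{1..max K (nat n)}. Vlevel (int n))"
    using w(1) y(1) mono by (intro V.span_add V.span_scale) auto
  ultimately show ?case by blast
qed

text \<open>The \<open>\<int>\<^sub>2\<close>-grading is essential: an eigenvector of \<open>G\<^sub>0\<close> in the top space generates a proper
  ungraded submodule.\<close>

lemma top_proj_proper_submodule:
  assumes N: "graded_submodule N" "N \<noteq> UNIV" and x: "x \<in> N"
  shows "top_proj x = 0"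
proof (rule ccontr)
  assume nz: "top_proj x \<noteq> 0"
  have sub: "V.subspace N" and act: "\<And>u x. x \<in> N \<Longrightarrow> Vact u x \<in> N"
    using N(1) unfolding graded_submodule_def by blast+
  have top: "tensor 1 (top_proj w) \<in> N" if "w \<in> N" for w
    using top_decomposition[of w] top_component[OF sub act] that by metis
  obtain y z where yz: "y \<in> N \<inter> Vpart False" "z \<in> N \<inter> Vpart True" "x = y + z"
    using N(1) x unfolding graded_submodule_def by blast
  obtain a b where ab: "top_proj y = (a, 0)" "top_proj z = (0, b)"
    using top_proj_Vpart[of y False] top_proj_Vpart[of z True] yz by (metis IntD2 prod.collapse)
  have "a \<noteq> 0 \<or> b \<noteq> 0" using nz yz(3) ab by (auto simp: top_proj_add zero_prod_def)
  then have "tensor 1 v_even \<in> N"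
  proof
    assume a: "a \<noteq> 0"
    have "Vscale (1 / a) (tensor 1 (a, 0)) \<in> N"
      using top[of y] yz ab by (intro V.subspace_scale[OF sub]) auto
    then show ?thesis using a by (simp add: tensor_scale_right[symmetric] Sscale_def v_even_def)
  next
    assume b: "b \<noteq> 0"
    \<comment> \<open>G_0 sends (0, b) to (b/8, 0), since h - c/24 = 1/8.\<close>
    have "Vscale (8 / b) (Gv 0 (tensor 1 (0, b))) \<in> N"
      using top[of z] yz ab by (intro V.subspace_scale[OF sub] act) auto
    then show ?thesis
      using b by (simp add: Gv_0_top central_charge_top tensor_scale_right[symmetric] Sscale_def v_even_def del: Vact_tensor)
  qed
  moreover from act[OF this, of "Ugen (Ggen 0)"] have "tensor 1 v_odd \<in> N"
    by (simp only: Gv_0_top) (simp add: v_even_def v_odd_def)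
  ultimately have "tensor 1 s \<in> N" for s
  proof -
    assume *: "tensor 1 v_even \<in> N" "tensor 1 v_odd \<in> N"
    have "s = Sscale (fst s) v_even + Sscale (snd s) v_odd"
      by (simp add: Sscale_def v_even_def v_odd_def)
    then have "tensor 1 s = Vscale (fst s) (tensor 1 v_even) + Vscale (snd s) (tensor 1 v_odd)"
      by (metis tensor_add_right tensor_scale_right)
    then show ?thesis using * V.subspace_add[OF sub] V.subspace_scale[OF sub] by simp
  qed
  then have "Vact u (tensor 1 s) \<in> N" for u s by (rule act)
  then have t: "tensor u s \<in> N" for u s by simp
  have "w \<in> N" for w
    by (induction w rule: verma_induct) (auto intro: t V.subspace_add[OF sub])
  then show False using N(2) by blast
qed

text \<open>Hence the top space of the irreducible quotient is still two-dimensional, which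
  \<open>G0_trace_zero\<close> uses.\<close>

lemma top_proj_max_submodule:
  assumes "x \<in> max_submodule" shows "top_proj x = 0"
  using assms unfolding max_submodule_def
proof (induction rule: V.span_induct_alt)
  case base
  then show ?case by simp
next
  case (step c x y)
  then have "top_proj x = 0" using top_proj_proper_submodule by blast
  then show ?case using step by (simp add: top_proj_add top_proj_scale Sscale_def zero_prod_def)
qed

section \<open>Traces on finite-dimensional subspaces\<close>


definition (in vector_space) finite_dim :: "'b set \<Rightarrow> bool"
  where "finite_dim W \<longleftrightarrow> (\<exists>S. finite S \<and> W = span S)"

lemma (in vector_space) finite_dim_basis:
  assumes "finite_dim W" "independent B" "span B = W" shows "finite B"
proof -
  obtain S where "finite S" "W = span S" using assms(1) unfolding finite_dim_def by blast
  then show ?thesis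
    using independent_span_bound[of S B] assms(2,3) span_superset[of B] by auto
qed

lemma (in vector_space) ex_basis:
  assumes "subspace W" shows "\<exists>B. independent B \<and> span B = W"
proof -
  obtain B where "B \<subseteq> W" "independent B" "W \<subseteq> span B"
    using maximal_independent_subset[of W] by blast
  then show ?thesis using span_minimal[OF _ assms] by blast
qed

text \<open>The matrix identity tr(AB) = tr(BA) for maps between two spaces, with the bases as
  parameters. With equal spans and the identity as one of the maps, it yields independence of the
  basis.\<close>

lemma (in vector_space) trace_commute_bases:
  assumes a: "Vector_Spaces.linear scale scale a" and b: "Vector_Spaces.linear scale scale b"
    and B: "independent B" "finite B" and C: "independent C" "finite C"
    and ab: "a ` span B \<subseteq> span C" "b ` span C \<subseteq> span B"
  shows "(\<Sum>w\<in>C. representation C (a (b w)) w) = (\<Sum>u\<in>B. representation B (b (a u)) u)"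
proof -
  have *: "representation C' (f (g w)) w = (\<Sum>u\<in>B'. representation B' (g w) u * representation C' (f u) w)"
    if f: "Vector_Spaces.linear scale scale f" and B': "independent B'" "finite B'"
      and C': "independent C'" "w \<in> C'" and fg: "f ` span B' \<subseteq> span C'" "g ` span C' \<subseteq> span B'"
    for B' C' f g w
  proof -
    interpret f: Vector_Spaces.linear scale scale f by fact
    have "g w \<in> span B'" using fg(2) span_base[OF C'(2)] by blast
    then have "g w = (\<Sum>u\<in>B'. scale (representation B' (g w) u) u)"
      using sum_representation_eq[OF B'(1) _ B'(2) order_refl] by metis
    then have "f (g w) = (\<Sum>u\<in>B'. scale (representation B' (g w) u) (f u))"
      by (metis (mono_tags, lifting) f.scale f.sum sum.cong)
    moreover have "f u \<in> span C'" if "u \<in> B'" for u using fg(1) span_base[OF that] by blast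
    ultimately show ?thesis
      using C' by (simp add: representation_sum representation_scale span_scale)
  qed
  have "(\<Sum>w\<in>C. representation C (a (b w)) w) =
      (\<Sum>w\<in>C. \<Sum>u\<in>B. representation B (b w) u * representation C (a u) w)"
    by (intro sum.cong refl * a B C ab)
  also have "\<dots> = (\<Sum>u\<in>B. \<Sum>w\<in>C. representation C (a u) w * representation B (b w) u)"
    by (subst sum.swap) (simp add: mult.commute)
  also have "\<dots> = (\<Sum>u\<in>B. representation B (b (a u)) u)"
    by (intro sum.cong refl *[symmetric] b B C ab)
  finally show ?thesis .
qed

text \<open>\<open>trace_on\<close> chooses its basis from W alone, so a single basis serves all f;
  linearity of the trace follows from this.\<close>

lemma (in vector_space) ex_trace_basis:
  assumes "finite_dim W"
  shows "\<exists>B. independent B \<and> span B = W \<and> finite B \<and> (\<forall>f. trace_on W f = (\<Sum>b\<in>B. representation B (f b) b))"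
proof -
  define B where "B = (SOME B. independent B \<and> span B = W)"
  have "subspace W" using assms unfolding finite_dim_def by (auto simp: subspace_span)
  then have "independent B \<and> span B = W" unfolding B_def by (rule someI_ex[OF ex_basis])
  then show ?thesis
    using finite_dim_basis[OF assms] unfolding trace_on_def B_def[symmetric] Let_def by blast
qed

lemma (in vector_space) trace_on_commute:
  assumes "Vector_Spaces.linear scale scale a" "Vector_Spaces.linear scale scale b"
    and "finite_dim U" "finite_dim W" and "a ` U \<subseteq> W" "b ` W \<subseteq> U"
  shows "trace_on W (\<lambda>x. a (b x)) = trace_on U (\<lambda>x. b (a x))"
proof -
  obtain B where B: "independent B" "span B = U" "finite B"
      "\<And>f. trace_on U f = (\<Sum>b\<in>B. representation B (f b) b)"
    using ex_trace_basis[OF assms(3)] by blast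
  obtain C where C: "independent C" "span C = W" "finite C"
      "\<And>f. trace_on W f = (\<Sum>b\<in>C. representation C (f b) b)"
    using ex_trace_basis[OF assms(4)] by blast
  show ?thesis unfolding B(4) C(4)
    by (rule trace_commute_bases[OF assms(1,2) B(1,3) C(1,3)]) (use assms B C in auto)
qed

lemma (in vector_space) trace_on_basis:
  assumes "Vector_Spaces.linear scale scale f" and W: "f ` W \<subseteq> W"
    and B: "independent B" "finite B" "span B = W"
  shows "trace_on W f = (\<Sum>b\<in>B. representation B (f b) b)"
proof -
  have "finite_dim W" using B unfolding finite_dim_def by blast
  then obtain C where C: "independent C" "span C = W" "finite C"
      "\<And>f. trace_on W f = (\<Sum>b\<in>C. representation C (f b) b)"
    using ex_trace_basis by blast
  show ?thesis unfolding C(4)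
    using trace_commute_bases[OF assms(1) linear_id B(1,2) C(1,3)] B C W by (simp add: id_def)
qed

lemma (in vector_space) trace_on_add:
  assumes "finite_dim W" "f ` W \<subseteq> W" "g ` W \<subseteq> W"
  shows "trace_on W (\<lambda>x. f x + g x) = trace_on W f + trace_on W g"
proof -
  obtain B where B: "independent B" "span B = W" "finite B"
      "\<And>f. trace_on W f = (\<Sum>b\<in>B. representation B (f b) b)"
    using ex_trace_basis[OF assms(1)] by blast
  have "f b \<in> span B" "g b \<in> span B" if "b \<in> B" for b
    using assms(2,3) span_base[OF that] B(2) by auto
  then show ?thesis unfolding B(4) using B(1) by (simp add: representation_add sum.distrib)
qed

lemma (in vector_space) trace_on_scale:
  assumes "finite_dim W" "f ` W \<subseteq> W"
  shows "trace_on W (\<lambda>x. scale c (f x)) = c * trace_on W f"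
proof -
  obtain B where B: "independent B" "span B = W" "finite B"
      "\<And>f. trace_on W f = (\<Sum>b\<in>B. representation B (f b) b)"
    using ex_trace_basis[OF assms(1)] by blast
  have "f b \<in> span B" if "b \<in> B" for b
    using assms(2) span_base[OF that] B(2) by auto
  then show ?thesis unfolding B(4) using B(1) by (simp add: representation_scale sum_distrib_left)
qed

lemma (in vector_space) trace_on_zero: "finite_dim W \<Longrightarrow> trace_on W (\<lambda>x. 0) = 0"
  using ex_trace_basis[of W] by (auto simp: representation_zero)

lemma (in vector_space) trace_on_sum:
  assumes W: "finite_dim W" and "\<And>i. i \<in> I \<Longrightarrow> f i ` W \<subseteq> W" and "finite I"
  shows "trace_on W (\<lambda>x. \<Sum>i\<in>I. f i x) = (\<Sum>i\<in>I. trace_on W (f i))"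
  using assms(3,2)
proof (induction I rule: finite_induct)
  case empty
  then show ?case by (simp add: trace_on_zero W)
next
  case (insert i I)
  have sub: "subspace W" using W unfolding finite_dim_def by (auto simp: subspace_span)
  have "(\<lambda>x. \<Sum>i\<in>I. f i x) ` W \<subseteq> W"
    using insert.prems by (auto intro!: subspace_sum[OF sub])
  then show ?case
    using insert by (simp add: trace_on_add[OF W])
qed

lemma (in vector_space) trace_on_cong:
  assumes "finite_dim W" "\<And>x. x \<in> W \<Longrightarrow> f x = g x"
  shows "trace_on W f = trace_on W g"
proof -
  obtain B where B: "independent B" "span B = W" "finite B"
      "\<And>f. trace_on W f = (\<Sum>b\<in>B. representation B (f b) b)"
    using ex_trace_basis[OF assms(1)] by blast
  then show ?thesis unfolding B(4) using assms(2) span_base by (intro sum.cong) auto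
qed

lemma (in vector_space) trace_on_trivial: "trace_on {0} f = 0"
proof -
  have W: "finite_dim {0}" unfolding finite_dim_def by (intro exI[of _ "{}"]) simp
  obtain B where B: "independent B" "span B = {0}"
      "\<And>f. trace_on {0} f = (\<Sum>b\<in>B. representation B (f b) b)"
    using ex_trace_basis[OF W] by blast
  have "B \<subseteq> {0}" using span_superset[of B] by (simp only: B(2))
  moreover have "0 \<notin> B" using dependent_zero B(1) by metis
  ultimately have "B = {}" by auto
  then show ?thesis unfolding B(3) by simp
qed

section \<open>The grading of the irreducible quotient\<close>

abbreviation LL :: "int \<Rightarrow> ramond_L \<Rightarrow> ramond_L" where "LL n \<equiv> Lact (Ugen (Lgen n))"
abbreviation GL :: "int \<Rightarrow> ramond_L \<Rightarrow> ramond_L" where "GL n \<equiv> Lact (Ugen (Ggen n))"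

lemma linear_Lproj: "Vector_Spaces.linear Vscale Lscale Lproj"
  by unfold_locales (transfer; simp)+

lemma Lproj_add: "Lproj (x + y) = Lproj x + Lproj y"
  and Lproj_scale: "Lproj (Vscale k x) = Lscale k (Lproj x)"
  and Lproj_zero [simp]: "Lproj 0 = 0"
  and Lproj_sum: "Lproj (\<Sum>i\<in>I. f i) = (\<Sum>i\<in>I. Lproj (f i))"
  using linear_Lproj
  by (simp_all add: Vector_Spaces.linear_iff_module_hom module_hom.add module_hom.scale
      module_hom.zero module_hom.sum)

lemma Lproj_eq_0_iff: "Lproj x = 0 \<longleftrightarrow> x \<in> max_submodule"
  by transfer (simp add: irr_cong_def)

lemma Lproj_cases: obtains y where "x = Lproj y"
  by (metis Lproj.abs_eq Quotient_abs_rep Quotient_ramond_L)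

lemma Lact_Lproj: "Lact u (Lproj x) = Lproj (Vact u x)"
  by (transfer fixing: u) simp

lemma linear_Lact: "Vector_Spaces.linear Lscale Lscale (Lact u)"
proof unfold_locales
  show "Lact u (x + y) = Lact u x + Lact u y" for x y
    by (rule Lproj_cases[of x], rule Lproj_cases[of y])
       (simp add: Lact_Lproj Vact_add flip: Lproj_add)
  show "Lact u (Lscale k x) = Lscale k (Lact u x)" for x k
    by (rule Lproj_cases[of x]) (simp add: Lact_Lproj Vact_scale flip: Lproj_scale)
qed

abbreviation Llevel :: "int \<Rightarrow> ramond_L set"
  where "Llevel n \<equiv> L0_eigenspace (lowest_weight + of_int n)"

abbreviation verma_basis :: "verma set"
  where "verma_basis \<equiv> {tensor (Umon xs) s | xs s. set xs \<subseteq> ramond_minus}"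

lemma Lproj_verma_basis_span: "x \<in> LV.span (Lproj ` verma_basis)"
proof -
  obtain y where "x = Lproj y" by (rule Lproj_cases)
  then show ?thesis
    using verma_span[of y] module_hom.span_image[of Vscale Lscale Lproj verma_basis] linear_Lproj
    unfolding Vector_Spaces.linear_iff_module_hom by blast
qed

lemma L0_eigenspace_span:
  assumes "x \<in> L0_eigenspace l"
  shows "x \<in> LV.span {b \<in> Lproj ` verma_basis. b \<in> L0_eigenspace l}"
  unfolding L0_eigenspace_def mem_Collect_eq
proof (rule LV.eigenvector_in_span[OF linear_Lact _ Lproj_verma_basis_span])
  show "LL 0 x = Lscale l x" using assms by (simp add: L0_eigenspace_def)
  fix b assume "b \<in> Lproj ` verma_basis"
  then obtain xs s where "b = Lproj (tensor (Umon xs) s)" by blast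
  then show "\<exists>m. LL 0 b = Lscale m b"
    using tensor_Umon_level[of xs s] by (auto simp: Vlevel_def Lact_Lproj Lproj_scale simp del: Vact_tensor)
qed

lemma Lproj_basis_eigenvalue:
  assumes "Lproj (tensor (Umon xs) s) \<in> L0_eigenspace l" "Lproj (tensor (Umon xs) s) \<noteq> 0"
  shows "l = lowest_weight + of_int (word_level xs)"
proof -
  let ?b = "Lproj (tensor (Umon xs) s)"
  have "Lscale l ?b = Lscale (lowest_weight + of_int (word_level xs)) ?b"
    using assms(1) tensor_Umon_level[of xs s]
    by (auto simp: Vlevel_def L0_eigenspace_def Lact_Lproj Lproj_scale simp del: Vact_tensor)
  then show ?thesis using assms(2) LV.scale_right_imp_eq by blast
qed

text \<open>The quotient is spanned by images of monomials, and a nonzero image has eigenvalue h +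
  n; an eigenspace for any other l is spanned by zero vectors.\<close>

lemma L0_eigenvalue:
  assumes "L0_eigenspace l \<noteq> {0}" shows "\<exists>n::nat. l = lowest_weight + of_nat n"
proof (rule ccontr)
  assume no: "\<not> ?thesis"
  have zero: "0 \<in> L0_eigenspace l"
    using module_hom.zero[of Lscale Lscale "LL 0"] linear_Lact
    by (simp add: L0_eigenspace_def Vector_Spaces.linear_iff_module_hom)
  have "{b \<in> Lproj ` verma_basis. b \<in> L0_eigenspace l} \<subseteq> {0}"
  proof clarify
    fix xs s assume *: "set xs \<subseteq> ramond_minus" "Lproj (tensor (Umon xs) s) \<in> L0_eigenspace l"
    show "Lproj (tensor (Umon xs) s) = 0"
    proof (rule ccontr)
      assume "Lproj (tensor (Umon xs) s) \<noteq> 0"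
      then have "l = lowest_weight + of_int (word_level xs)" using Lproj_basis_eigenvalue * by blast
      moreover have "word_level xs = int (nat (word_level xs))" using word_level_minus[OF *(1)] by simp
      ultimately show False using no by (metis of_int_of_nat_eq)
    qed
  qed
  then have "LV.span {b \<in> Lproj ` verma_basis. b \<in> L0_eigenspace l} \<subseteq> {0}"
    by (rule LV.span_minimal) (rule LV.subspace_single_0)
  then have "L0_eigenspace l \<subseteq> {0}" using L0_eigenspace_span by (meson subsetD subsetI)
  then show False using assms zero by blast
qed

text \<open>The quotient acquires no new eigenvectors: by \<open>L0_eigenspace_span\<close> each one
  is a combination of images of monomials with the same eigenvalue.\<close>

lemma Llevel_eq: "Llevel n = Lproj ` Vlevel n"
proof
  show "Lproj ` Vlevel n \<subseteq> Llevel n"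
    by (auto simp: L0_eigenspace_def Vlevel_def Lact_Lproj Lproj_scale)
  have sub: "LV.subspace (Lproj ` Vlevel n)"
    using linear_Lproj subspace_Vlevel
    by (metis Vector_Spaces.linear_iff_module_hom module_hom.subspace_image)
  have "{b \<in> Lproj ` verma_basis. b \<in> Llevel n} \<subseteq> Lproj ` Vlevel n"
  proof clarify
    fix xs s assume *: "Lproj (tensor (Umon xs) s) \<in> Llevel n"
    show "Lproj (tensor (Umon xs) s) \<in> Lproj ` Vlevel n"
    proof (cases "Lproj (tensor (Umon xs) s) = 0")
      case True
      then show ?thesis using LV.subspace_0[OF sub] by simp
    next
      case False
      then have "word_level xs = n" using Lproj_basis_eigenvalue[OF *] by simp
      then show ?thesis using tensor_Umon_level[of xs s] by blast
    qed
  qed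
  then have "LV.span {b \<in> Lproj ` verma_basis. b \<in> Llevel n} \<subseteq> Lproj ` Vlevel n"
    by (rule LV.span_minimal[OF _ sub])
  then show "Llevel n \<subseteq> Lproj ` Vlevel n" using L0_eigenspace_span by (meson subsetD subsetI)
qed

text \<open>Every letter has mode at most -1, which bounds both the length of a word and the size of
  its modes by n.\<close>

lemma finite_words_level: "finite {xs. set xs \<subseteq> ramond_minus \<and> word_level xs = n}"
proof -
  let ?A = "(Lgen ` {- n..0}) \<union> (Ggen ` {- n..0})"
  have "set xs \<subseteq> ?A \<and> length xs \<le> nat n" if "set xs \<subseteq> ramond_minus" "word_level xs = n" for xs
  proof
    show "length xs \<le> nat n" using word_level_minus[OF that(1)] that(2) by simp
    have "- mode g \<le> word_level xs" if "g \<in> set xs" "set xs \<subseteq> ramond_minus" for g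
      using that
    proof (induction xs)
      case (Cons x xs)
      then have x: "mode x < 0" "set xs \<subseteq> ramond_minus" using mode_minus by auto
      have "0 \<le> word_level xs" using word_level_minus[OF x(2)] by simp
      then show ?case using Cons x by (auto simp: word_level_def)
    qed simp
    then have "- n \<le> mode g \<and> mode g \<le> 0 \<and> g \<in> ramond_minus" if "g \<in> set xs" for g
      using that \<open>set xs \<subseteq> ramond_minus\<close> \<open>word_level xs = n\<close> mode_minus[of g] by force
    then show "set xs \<subseteq> ?A"
      by (force simp: ramond_minus_def)
  qed
  then have "{xs. set xs \<subseteq> ramond_minus \<and> word_level xs = n} \<subseteq> {xs. set xs \<subseteq> ?A \<and> length xs \<le> nat n}"
    by blast
  moreover have "finite {xs. set xs \<subseteq> ?A \<and> length xs \<le> nat n}"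
    by (rule finite_lists_length_le) simp
  ultimately show ?thesis by (rule finite_subset)
qed

lemma finite_dim_Llevel: "LV.finite_dim (Llevel n)"
proof -
  define T where "T = (\<lambda>(xs, s). tensor (Umon xs) s) `
      ({xs. set xs \<subseteq> ramond_minus \<and> word_level xs = n} \<times> {v_even, v_odd})"
  have fin: "finite T" unfolding T_def by (intro finite_imageI finite_cartesian_product finite_words_level) simp
  have "tensor (Umon xs) s \<in> V.span T" if "set xs \<subseteq> ramond_minus" "word_level xs = n" for xs s
  proof -
    have "s = Sscale (fst s) v_even + Sscale (snd s) v_odd"
      by (simp add: Sscale_def v_even_def v_odd_def)
    then have "tensor (Umon xs) s = Vscale (fst s) (tensor (Umon xs) v_even) + Vscale (snd s) (tensor (Umon xs) v_odd)"
      by (metis tensor_add_right tensor_scale_right)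
    moreover have "tensor (Umon xs) v_even \<in> T" "tensor (Umon xs) v_odd \<in> T"
      unfolding T_def using that by force+
    ultimately show ?thesis by (simp add: V.span_add V.span_scale V.span_base)
  qed
  then have "{tensor (Umon xs) s | xs s. set xs \<subseteq> ramond_minus \<and> word_level xs = n} \<subseteq> V.span T" by blast
  then have "V.span {tensor (Umon xs) s | xs s. set xs \<subseteq> ramond_minus \<and> word_level xs = n} \<subseteq> V.span T"
    by (rule V.span_minimal) (rule V.subspace_span)
  then have "Vlevel n \<subseteq> V.span T" using Vlevel_span by blast
  moreover have "V.span T \<subseteq> Vlevel n"
    by (rule V.span_minimal[OF _ subspace_Vlevel]) (use tensor_Umon_level in \<open>auto simp: T_def\<close>)
  ultimately have "Llevel n = LV.span (Lproj ` T)"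
    using linear_Lproj module_hom.span_image[of Vscale Lscale Lproj T]
    unfolding Llevel_eq Vector_Spaces.linear_iff_module_hom by auto
  then show ?thesis unfolding LV.finite_dim_def using fin by blast
qed

lemma subspace_Llevel: "LV.subspace (Llevel n)"
  using finite_dim_Llevel[of n] unfolding LV.finite_dim_def by (auto simp: LV.subspace_span)

lemma Lact_Llevel: "x \<in> Llevel n \<Longrightarrow> Lact (Ugen g) x \<in> Llevel (n - mode g)"
  unfolding Llevel_eq using Vact_Vlevel by (auto simp: Lact_Lproj)

lemma Theta_Llevel: "x \<in> Llevel n \<Longrightarrow> Theta x \<in> Llevel n"
  using linear_Theta
  by (simp add: L0_eigenspace_def Theta_Lact[symmetric] Vector_Spaces.linear_iff)

lemma G0_Theta_Llevel: "(\<lambda>x. GL 0 (Theta x)) ` Llevel n \<subseteq> Llevel n"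
proof clarify
  fix x assume "x \<in> Llevel n"
  then show "GL 0 (Theta x) \<in> Llevel n"
    using Lact_Llevel[OF Theta_Llevel, of x n "Ggen 0"] by simp
qed

lemma Llevel_negative: "n < 0 \<Longrightarrow> Llevel n = {0}"
  by (simp add: Llevel_eq Vlevel_negative)

section \<open>The recursion for the traces\<close>

lemma sum_int_symmetric:
  fixes g :: "int \<Rightarrow> 'a::comm_monoid_add"
  shows "(\<Sum>k\<in>{- int n..int n}. g k) = g 0 + (\<Sum>k\<in>{1..n}. g (int k) + g (- int k))"
proof (induction n)
  case (Suc n)
  have "int (Suc n) = int n + 1" by simp
  then have "(\<Sum>k\<in>{- int (Suc n)..int (Suc n)}. g k) = g (- int (Suc n)) + (\<Sum>k\<in>{- int n..int n}. g k) + g (int (Suc n))"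
    using sum_int_Suc[of "int n" g] by (simp only: of_nat_0_le_iff simp_thms)
  then show ?case unfolding Suc by (simp add: add_ac del: of_nat_Suc)
qed simp

text \<open>On level n the cutoff K = n is admissible. The commutators [L_k, G_{-k}] = (3/2) k G_0
  add up to (3/4) n (n + 1) G_0 and cancel the K-part of \<open>null_coeff\<close>. The term L_0 G_0
  contributes h + n, whose h cancels 3/32.\<close>

lemma null_mode_0_level:
  assumes y: "y \<in> Vlevel (int n)"
  shows "null_mode 0 y = (\<Sum>k\<in>{1..n}. Lv (- int k) (Gv (int k) y) + Gv (- int k) (Lv (int k) y)) + Vscale (of_nat n) (Gv 0 y)"
proof (rule V.functional_eqI)
  fix f assume f: "V.functional f"
  note fs = V.functional_simps[OF f]
  have "killed (int n) y"
    unfolding killed_def using Vact_Vlevel[OF y] Vlevel_negative by (metis diff_less_0_iff_less singletonD)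
  then have "null_mode 0 y = null_trunc (int n) 0 y" by (rule null_mode_eq) simp_all
  then have "f (null_mode 0 y) = (\<Sum>k\<in>{- int n..int n}. f (Lv k (Gv (- k) y))) + null_coeff 0 (int n) * f (Gv 0 y)"
    by (simp add: null_trunc_def fs)
  also have "(\<Sum>k\<in>{- int n..int n}. f (Lv k (Gv (- k) y))) =
      f (Lv 0 (Gv 0 y)) + (\<Sum>k\<in>{1..n}. f (Lv (int k) (Gv (- int k) y)) + f (Lv (- int k) (Gv (int k) y)))"
    by (simp add: sum_int_symmetric)
  also have "(\<Sum>k\<in>{1..n}. f (Lv (int k) (Gv (- int k) y)) + f (Lv (- int k) (Gv (int k) y))) =
      (\<Sum>k\<in>{1..n}. (f (Lv (- int k) (Gv (int k) y)) + f (Gv (- int k) (Lv (int k) y))) + 3 / 2 * of_nat k * f (Gv 0 y))"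
  proof (rule sum.cong)
    fix k
    show "f (Lv (int k) (Gv (- int k) y)) + f (Lv (- int k) (Gv (int k) y)) =
      (f (Lv (- int k) (Gv (int k) y)) + f (Gv (- int k) (Lv (int k) y))) + 3 / 2 * of_nat k * f (Gv 0 y)"
      by (simp add: Vact_LG[of "int k" "- int k"] fs)
  qed simp
  also have "\<dots> = (\<Sum>k\<in>{1..n}. f (Lv (- int k) (Gv (int k) y)) + f (Gv (- int k) (Lv (int k) y)))
      + (\<Sum>k\<in>{1..n}. 3 / 2 * of_nat k * f (Gv 0 y))"
    by (simp only: sum.distrib)
  also have "(\<Sum>k\<in>{1..n}. 3 / 2 * of_nat k * f (Gv 0 y)) = 3 / 4 * of_nat n * (of_nat n + 1) * f (Gv 0 y)"
    by (induction n) (simp_all add: field_simps)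
  also have "f (Lv 0 (Gv 0 y)) = (lowest_weight + of_nat n) * f (Gv 0 y)"
    using Vact_Vlevel[OF y, of "Ggen 0"] by (simp add: Vlevel_def fs)
  finally show "f (null_mode 0 y) = f ((\<Sum>k\<in>{1..n}. Lv (- int k) (Gv (int k) y) + Gv (- int k) (Lv (int k) y)) + Vscale (of_nat n) (Gv 0 y))"
    by (simp add: fs null_coeff_def lowest_weight_def algebra_simps)
qed

lemma null_relation:
  assumes "x \<in> Llevel (int n)"
  shows "(\<Sum>k\<in>{1..n}. LL (- int k) (GL (int k) x) + GL (- int k) (LL (int k) x)) + Lscale (of_nat n) (GL 0 x) = 0"
proof -
  obtain y where y: "x = Lproj y" "y \<in> Vlevel (int n)" using assms unfolding Llevel_eq by blast
  have "Lproj (null_mode 0 y) = 0" using null_mode_max_submodule Lproj_eq_0_iff by blast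
  then show ?thesis
    by (simp add: y null_mode_0_level[OF y(2)] Lproj_add Lproj_sum Lproj_scale Lact_Lproj)
qed

definition G0_trace :: "int \<Rightarrow> complex"
  where "G0_trace n = LV.trace_on (Llevel n) (\<lambda>x. GL 0 (Theta x))"

text \<open>One summand of the null relation, traced against Theta. It is kept as a function of n
  and k because cyclicity relates level n to level n - k.\<close>

definition LG_trace :: "int \<Rightarrow> nat \<Rightarrow> complex" where
  "LG_trace n k = LV.trace_on (Llevel n)
     (\<lambda>x. LL (- int k) (GL (int k) (Theta x)) + GL (- int k) (LL (int k) (Theta x)))"

lemma G0_trace_zero: "G0_trace 0 = 1 / 4"
proof -
  let ?e = "Lproj (tensor 1 v_even)" and ?o = "Lproj (tensor 1 v_odd)"
  have lin: "Lscale a ?e + Lscale b ?o = Lproj (tensor 1 (a, b))" for a b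
  proof -
    have "(a, b) = Sscale a v_even + Sscale b v_odd" by (simp add: Sscale_def v_even_def v_odd_def)
    then show ?thesis by (metis Lproj_add Lproj_scale tensor_add_right tensor_scale_right)
  qed
  have zero: "a = 0 \<and> b = 0" if "Lscale a ?e + Lscale b ?o = 0" for a b
    using top_proj_max_submodule[of "tensor 1 (a, b)"] that
    unfolding lin Lproj_eq_0_iff by (simp add: top_proj_top zero_prod_def)
  have neq: "?e \<noteq> ?o" using zero[of 1 "- 1"] by auto
  have o: "?o \<noteq> 0" using zero[of 0 1] by auto
  have "?e \<notin> LV.span {?o}"
  proof
    assume "?e \<in> LV.span {?o}"
    then obtain k where "?e = Lscale k ?o" unfolding LV.span_singleton by blast
    then show False using zero[of 1 "- k"] by simp
  qed
  then have ind: "LV.independent {?e, ?o}" using o neq by (simp add: LV.independent_insert)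
  have Vspan: "LV.span {?e, ?o} = Llevel 0"
  proof
    show "LV.span {?e, ?o} \<subseteq> Llevel 0"
    proof (rule LV.span_minimal[OF _ subspace_Llevel])
      have "Lproj (tensor 1 s) \<in> Llevel 0" for s
        unfolding Llevel_eq using tensor_top_level by blast
      then show "{?e, ?o} \<subseteq> Llevel 0" by blast
    qed
    show "Llevel 0 \<subseteq> LV.span {?e, ?o}"
    proof
      fix x assume "x \<in> Llevel 0"
      then obtain s where "x = Lproj (tensor 1 s)" using Vlevel_zero unfolding Llevel_eq by blast
      then have "x = Lscale (fst s) ?e + Lscale (snd s) ?o" by (simp add: lin)
      then show "x \<in> LV.span {?e, ?o}" by (simp add: LV.span_add LV.span_scale LV.span_base)
    qed
  qed
  have scal: "GL 0 (Theta (Lproj (tensor 1 s))) = Lscale (1 / 8) (Lproj (tensor 1 s))" for s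
  proof -
    have "Sa (Ggen 0) (Sa (Ggen 0) s) = Sscale (1 / 8) s"
      by (cases s) (simp add: Sscale_def central_charge_top)
    then show ?thesis
      by (simp add: Theta_tensor Lact_Lproj Gv_0_top tensor_scale_right Lproj_scale del: Vact_tensor)
  qed
  have "G0_trace 0 = (\<Sum>b\<in>{?e, ?o}. LV.representation {?e, ?o} (GL 0 (Theta b)) b)"
    unfolding G0_trace_def
  proof (rule LV.trace_on_basis)
    show "Vector_Spaces.linear Lscale Lscale (\<lambda>x. GL 0 (Theta x))"
      using Vector_Spaces.linear_compose[OF linear_Theta linear_Lact] by (simp add: o_def)
    show "(\<lambda>x. GL 0 (Theta x)) ` Llevel 0 \<subseteq> Llevel 0" by (rule G0_Theta_Llevel)
  qed (use ind Vspan in auto)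
  also have "\<dots> = (\<Sum>b\<in>{?e, ?o}. 1 / 8)"
    using ind by (intro sum.cong) (auto simp: scal LV.representation_scale LV.span_base LV.representation_basis)
  finally show ?thesis using neq by simp
qed

text \<open>G_k Theta maps level n to level n - k and L_{-k} maps back, so by cyclicity the trace of
  L_{-k} G_k Theta on level n is that of G_k L_{-k} Theta on level n - k, as Theta commutes with all
  modes. Reordering costs (3/2) k G_0 Theta, and the other summand costs the same.\<close>

lemma LG_trace_step:
  "LG_trace n k = LG_trace (n - int k) k + 3 * of_nat k * G0_trace (n - int k)"
proof -
  let ?U = "Llevel (n - int k)" and ?W = "Llevel n"
  have lin: "Vector_Spaces.linear Lscale Lscale (\<lambda>x. Lact u (Theta x))" for u
    using Vector_Spaces.linear_compose[OF linear_Theta linear_Lact] by (simp add: o_def)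
  have TU: "(\<lambda>x. Lact (Ugen a) (Lact (Ugen b) (Theta x))) ` Llevel m \<subseteq> Llevel m" if "mode a + mode b = 0" for a b m
  proof clarify
    fix x assume "x \<in> Llevel m"
    then show "Lact (Ugen a) (Lact (Ugen b) (Theta x)) \<in> Llevel m"
      using Lact_Llevel[OF Lact_Llevel[OF Theta_Llevel], of x m a b] that by (simp add: algebra_simps)
  qed
  have G0U: "(\<lambda>x. GL 0 (Theta x)) ` ?U \<subseteq> ?U"
    by (rule G0_Theta_Llevel)
  have comm: "GL (int k) (LL (- int k) x) = LL (- int k) (GL (int k) x) + Lscale (3 / 2 * of_nat k) (GL 0 x)"
    "LL (int k) (GL (- int k) x) = GL (- int k) (LL (int k) x) + Lscale (3 / 2 * of_nat k) (GL 0 x)" for x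
    by (rule Lproj_cases[of x], simp add: Lact_Lproj Vact_GL[of "int k" "- int k"]
        Vact_LG[of "int k" "- int k"] flip: Lproj_add Lproj_scale)+
  have cyc: "LV.trace_on ?W (\<lambda>x. Lact (Ugen a) (Lact (Ugen b) (Theta x)))
      = LV.trace_on ?U (\<lambda>x. Lact (Ugen b) (Lact (Ugen a) (Theta x)))"
    if "mode a = - int k" "mode b = int k" for a b
  proof -
    have "LV.trace_on ?W (\<lambda>x. Lact (Ugen a) (Lact (Ugen b) (Theta x)))
        = LV.trace_on ?U (\<lambda>x. Lact (Ugen b) (Theta (Lact (Ugen a) x)))"
      by (rule LV.trace_on_commute[OF linear_Lact lin finite_dim_Llevel finite_dim_Llevel])
         (use Lact_Llevel[of _ "n - int k" a] Lact_Llevel[OF Theta_Llevel, of _ n b] that in auto)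
    then show ?thesis by (simp add: Theta_Lact)
  qed
  have step: "LV.trace_on ?W (\<lambda>x. Lact (Ugen a) (Lact (Ugen b) (Theta x))) =
      LV.trace_on ?U (\<lambda>x. Lact (Ugen a) (Lact (Ugen b) (Theta x))) + 3 / 2 * of_nat k * G0_trace (n - int k)"
    if m: "mode a = - int k" "mode b = int k" and
      ab: "\<And>x. Lact (Ugen b) (Lact (Ugen a) x) = Lact (Ugen a) (Lact (Ugen b) x) + Lscale (3 / 2 * of_nat k) (GL 0 x)"
    for a b
  proof -
    have "(\<lambda>x. Lscale (3 / 2 * of_nat k) (GL 0 (Theta x))) ` ?U \<subseteq> ?U"
      using G0U LV.subspace_scale[OF subspace_Llevel] by blast
    then show ?thesis
      unfolding cyc[OF m] ab G0_trace_def
      using LV.trace_on_add[OF finite_dim_Llevel TU[of a b "n - int k"], of "\<lambda>x. Lscale (3 / 2 * of_nat k) (GL 0 (Theta x))"]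
        LV.trace_on_scale[OF finite_dim_Llevel G0U, of "3 / 2 * of_nat k"] m by simp
  qed
  have split: "LG_trace m k = LV.trace_on (Llevel m) (\<lambda>x. LL (- int k) (GL (int k) (Theta x)))
      + LV.trace_on (Llevel m) (\<lambda>x. GL (- int k) (LL (int k) (Theta x)))" for m
    unfolding LG_trace_def by (rule LV.trace_on_add[OF finite_dim_Llevel TU TU]) simp_all
  show ?thesis
    unfolding split using step[of "Lgen (- int k)" "Ggen (int k)"] step[of "Ggen (- int k)" "Lgen (int k)"] comm
    by simp
qed

lemma LG_trace_negative: "n < 0 \<Longrightarrow> LG_trace n k = 0"
  by (simp add: LG_trace_def Llevel_negative LV.trace_on_trivial)

lemma G0_trace_negative: "n < 0 \<Longrightarrow> G0_trace n = 0"
  by (simp add: G0_trace_def Llevel_negative LV.trace_on_trivial)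

text \<open>Theta preserves the level, so the null relation can be applied to Theta x before the
  trace is taken.\<close>

lemma G0_trace_recursion: "of_nat n * G0_trace (int n) = - (\<Sum>k\<in>{1..n}. LG_trace (int n) k)"
proof -
  let ?W = "Llevel (int n)"
  let ?f = "\<lambda>k x. LL (- int k) (GL (int k) (Theta x)) + GL (- int k) (LL (int k) (Theta x))"
  have f: "?f k ` ?W \<subseteq> ?W" for k
  proof clarify
    fix x assume "x \<in> ?W"
    then have T: "Theta x \<in> ?W" by (rule Theta_Llevel)
    show "?f k x \<in> ?W"
      using Lact_Llevel[OF Lact_Llevel[OF T, of "Ggen (int k)"], of "Lgen (- int k)"]
        Lact_Llevel[OF Lact_Llevel[OF T, of "Lgen (int k)"], of "Ggen (- int k)"]
      by (intro LV.subspace_add[OF subspace_Llevel]) simp_all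
  qed
  have g: "(\<lambda>x. GL 0 (Theta x)) ` ?W \<subseteq> ?W"
    by (rule G0_Theta_Llevel)
  then have g': "(\<lambda>x. Lscale (of_nat n) (GL 0 (Theta x))) ` ?W \<subseteq> ?W"
    using LV.subspace_scale[OF subspace_Llevel] by blast
  have s: "(\<lambda>x. \<Sum>k\<in>{1..n}. ?f k x) ` ?W \<subseteq> ?W"
  proof clarify
    fix x assume "x \<in> ?W"
    then show "(\<Sum>k\<in>{1..n}. ?f k x) \<in> ?W"
      using f by (intro LV.subspace_sum[OF subspace_Llevel]) blast
  qed
  have "(\<Sum>k\<in>{1..n}. LG_trace (int n) k) + of_nat n * G0_trace (int n)
      = LV.trace_on ?W (\<lambda>x. \<Sum>k\<in>{1..n}. ?f k x) + LV.trace_on ?W (\<lambda>x. Lscale (of_nat n) (GL 0 (Theta x)))"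
    unfolding LG_trace_def G0_trace_def
    using LV.trace_on_sum[OF finite_dim_Llevel f, of "{1..n}"] LV.trace_on_scale[OF finite_dim_Llevel g] by simp
  also have "\<dots> = LV.trace_on ?W (\<lambda>x. (\<Sum>k\<in>{1..n}. ?f k x) + Lscale (of_nat n) (GL 0 (Theta x)))"
    by (rule LV.trace_on_add[OF finite_dim_Llevel s g', symmetric])
  also have "\<dots> = LV.trace_on ?W (\<lambda>x. 0)"
    using null_relation[OF Theta_Llevel] by (intro LV.trace_on_cong[OF finite_dim_Llevel]) blast
  also have "\<dots> = 0" by (rule LV.trace_on_zero[OF finite_dim_Llevel])
  finally show ?thesis by (simp add: eq_neg_iff_add_eq_0 add.commute)
qed

section \<open>The cube of the Euler product\<close>

text \<open>Unfolded, s n k is 3k times the sum of t (n - jk) over j \<ge> 1, so each t n with n > 0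
  is determined by earlier values and scales with t 0. The bound N accommodates truncated products,
  whose recursion is established up to N.\<close>

lemma recursion_unique:
  fixes t t' :: "nat \<Rightarrow> complex" and s s' :: "nat \<Rightarrow> nat \<Rightarrow> complex"
  assumes s: "\<And>n k. k \<ge> 1 \<Longrightarrow> s n k = (if n < k then 0 else s (n - k) k + 3 * of_nat k * t (n - k))"
    and s': "\<And>n k. k \<ge> 1 \<Longrightarrow> s' n k = (if n < k then 0 else s' (n - k) k + 3 * of_nat k * t' (n - k))"
    and t: "\<And>n. n \<le> N \<Longrightarrow> of_nat n * t n = - (\<Sum>k\<in>{1..n}. s n k)"
    and t': "\<And>n. n \<le> N \<Longrightarrow> of_nat n * t' n = - (\<Sum>k\<in>{1..n}. s' n k)"
    and zero: "t 0 = c * t' 0" and n: "n \<le> N"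
  shows "t n = c * t' n"
  using n
proof (induction n rule: less_induct)
  case (less n)
  have ss: "s m k = c * s' m k" if "k \<ge> 1" "m \<le> n" for m k
    using that(2)
  proof (induction m rule: less_induct)
    case (less m)
    show ?case
    proof (cases "m < k")
      case False
      then have "t (m - k) = c * t' (m - k)" "s (m - k) k = c * s' (m - k) k"
        using \<open>\<And>y. y < n \<Longrightarrow> y \<le> N \<Longrightarrow> t y = c * t' y\<close> less that(1) \<open>n \<le> N\<close> by auto
      then show ?thesis using False s[OF that(1), of m] s'[OF that(1), of m] by (simp add: algebra_simps)
    qed (simp add: s[OF that(1)] s'[OF that(1)])
  qed
  show ?case
  proof (cases "n = 0")
    case True
    then show ?thesis using zero by simp
  next
    case False
    have "of_nat n * t n = c * (of_nat n * t' n)"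
      unfolding t[OF less.prems] t'[OF less.prems] by (simp add: ss sum_distrib_left)
    then show ?thesis using False by simp
  qed
qed

section \<open>Logarithmic derivative of the truncated product\<close>

definition euler_fps :: "nat \<Rightarrow> complex fps"
  where "euler_fps N = (\<Prod>k\<in>{1..N}. (1 - fps_X ^ k) ^ 3)"

text \<open>With P = \<open>euler_fps N\<close>, logarithmic differentiation gives x P' = - P times
  the sum of 3k x^k / (1 - x^k); this is its k-th term without the sign.\<close>

definition lambert_fps :: "nat \<Rightarrow> nat \<Rightarrow> complex fps"
  where "lambert_fps N k = fps_const (3 * of_nat k) * fps_X ^ k * inverse (1 - fps_X ^ k) * euler_fps N"

lemma fps_inverse_one_minus_X_power:
  "k \<ge> 1 \<Longrightarrow> (1 - fps_X ^ k) * inverse (1 - fps_X ^ k :: complex fps) = 1"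
  by (rule inverse_mult_eq_1') (simp add: fps_X_power_nth)

text \<open>Product rule, one factor Q^3 at a time: its derivative 3 Q^2 Q', multiplied by x, is the
  new Lambert term after cancelling Q against its inverse.\<close>

lemma euler_fps_deriv: "fps_X * fps_deriv (euler_fps N) = - (\<Sum>k\<in>{1..N}. lambert_fps N k)"
proof (induction N)
  case 0
  then show ?case by (simp add: euler_fps_def)
next
  case (Suc N)
  define Q :: "complex fps" where "Q = 1 - fps_X ^ Suc N"
  have P: "euler_fps (Suc N) = euler_fps N * Q ^ 3"
    by (simp add: euler_fps_def Q_def)
  have dQ: "fps_X * fps_deriv Q = - (fps_const (of_nat (Suc N)) * fps_X ^ Suc N)"
  proof -
    have "fps_deriv (fps_X ^ Suc N :: complex fps) = fps_const (of_nat (Suc N)) * fps_X ^ N"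
      unfolding fps_deriv_power by (simp del: of_nat_Suc)
    then have "fps_deriv Q = - (fps_const (of_nat (Suc N)) * fps_X ^ N)"
      unfolding Q_def fps_deriv_sub fps_deriv_1 by simp
    then show ?thesis by (simp only: power_Suc mult_minus_right mult.left_commute)
  qed
  have inv: "Q * inverse Q = 1"
    unfolding Q_def by (rule fps_inverse_one_minus_X_power) simp
  have "fps_X * fps_deriv (euler_fps (Suc N)) =
      (fps_X * fps_deriv (euler_fps N)) * Q ^ 3 + euler_fps N * (3 * Q ^ 2 * (fps_X * fps_deriv Q))"
    unfolding P by (simp add: fps_deriv_power algebra_simps power2_eq_square power3_eq_cube)
  also have "\<dots> = - ((\<Sum>k\<in>{1..N}. lambert_fps N k) * Q ^ 3)
      - 3 * fps_const (of_nat (Suc N)) * fps_X ^ Suc N * Q ^ 2 * euler_fps N"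
    unfolding Suc dQ by (simp add: algebra_simps)
  also have "(\<Sum>k\<in>{1..N}. lambert_fps N k) * Q ^ 3 = (\<Sum>k\<in>{1..N}. lambert_fps (Suc N) k)"
    unfolding sum_distrib_right by (rule sum.cong) (simp_all add: lambert_fps_def P mult.assoc)
  also have "3 * fps_const (of_nat (Suc N)) * fps_X ^ Suc N * Q ^ 2 * euler_fps N = lambert_fps (Suc N) (Suc N)"
  proof -
    have "lambert_fps (Suc N) (Suc N) = fps_const (3 * of_nat (Suc N)) * fps_X ^ Suc N * (Q * inverse Q) * Q ^ 2 * euler_fps N"
      unfolding lambert_fps_def P Q_def[symmetric] by (simp only: power3_eq_cube power2_eq_square mult_ac)
    moreover have "fps_const (3 * of_nat (Suc N)) = 3 * fps_const (of_nat (Suc N) :: complex)"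
      by (simp add: numeral_fps_const)
    ultimately show ?thesis unfolding inv by simp
  qed
  finally show ?case by simp
qed

text \<open>Multiplying by 1 - x^k removes the denominator. The resulting recursion is the one that
  cyclicity gives for \<open>LG_trace\<close>.\<close>

lemma lambert_fps_nth:
  assumes "k \<ge> 1"
  shows "fps_nth (lambert_fps N k) n =
    (if n < k then 0 else fps_nth (lambert_fps N k) (n - k) + 3 * of_nat k * fps_nth (euler_fps N) (n - k))"
proof -
  have "(1 - fps_X ^ k) * lambert_fps N k
      = ((1 - fps_X ^ k) * inverse (1 - fps_X ^ k)) * (fps_X ^ k * (fps_const (3 * of_nat k) * euler_fps N))"
    unfolding lambert_fps_def by (simp only: mult_ac)
  then have "(1 - fps_X ^ k) * lambert_fps N k = fps_X ^ k * (fps_const (3 * of_nat k) * euler_fps N)"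
    unfolding fps_inverse_one_minus_X_power[OF assms] by simp
  then have "lambert_fps N k = fps_X ^ k * lambert_fps N k + fps_X ^ k * (fps_const (3 * of_nat k) * euler_fps N)"
    by (simp add: left_diff_distrib diff_eq_eq add.commute)
  then have "fps_nth (lambert_fps N k) n =
      fps_nth (fps_X ^ k * lambert_fps N k + fps_X ^ k * (fps_const (3 * of_nat k) * euler_fps N)) n"
    by metis
  then show ?thesis by (simp add: fps_X_power_mult_nth)
qed

text \<open>The k-th Lambert term is divisible by x^k, so k > n contributes nothing to the
  coefficient n, and n \<le> N ensures that all k \<le> n are present.\<close>

lemma euler_fps_recursion:
  assumes "n \<le> N"
  shows "of_nat n * fps_nth (euler_fps N) n = - (\<Sum>k\<in>{1..n}. fps_nth (lambert_fps N k) n)"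
proof -
  have "of_nat n * fps_nth (euler_fps N) n = fps_nth (fps_X * fps_deriv (euler_fps N)) n"
    by (cases n) (simp_all del: of_nat_Suc)
  also have "\<dots> = - (\<Sum>k\<in>{1..N}. fps_nth (lambert_fps N k) n)"
    unfolding euler_fps_deriv by (simp add: fps_sum_nth)
  also have "(\<Sum>k\<in>{1..N}. fps_nth (lambert_fps N k) n) = (\<Sum>k\<in>{1..n}. fps_nth (lambert_fps N k) n)"
  proof (rule sum.mono_neutral_right)
    show "\<forall>k\<in>{1..N} - {1..n}. fps_nth (lambert_fps N k) n = 0"
    proof
      fix k assume "k \<in> {1..N} - {1..n}"
      then have "k \<ge> 1" "n < k" by auto
      then show "fps_nth (lambert_fps N k) n = 0" by (subst lambert_fps_nth) simp_all
    qed
  qed (use assms in auto)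
  finally show ?thesis .
qed

lemma G0_trace_eq_euler: "n \<le> N \<Longrightarrow> G0_trace (int n) = 1 / 4 * fps_nth (euler_fps N) n"
proof (rule recursion_unique[where t = "\<lambda>n. G0_trace (int n)" and t' = "fps_nth (euler_fps N)"
      and s = "\<lambda>n k. LG_trace (int n) k" and s' = "\<lambda>n k. fps_nth (lambert_fps N k) n"])
  fix n k :: nat assume "k \<ge> 1"
  show "LG_trace (int n) k = (if n < k then 0 else LG_trace (int (n - k)) k + 3 * of_nat k * G0_trace (int (n - k)))"
    by (subst LG_trace_step) (auto simp: LG_trace_negative G0_trace_negative of_nat_diff not_less)
  show "fps_nth (lambert_fps N k) n =
    (if n < k then 0 else fps_nth (lambert_fps N k) (n - k) + 3 * of_nat k * fps_nth (euler_fps N) (n - k))"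
    using \<open>k \<ge> 1\<close> by (rule lambert_fps_nth)
next
  fix n assume "n \<le> N"
  then show "of_nat n * fps_nth (euler_fps N) n = - (\<Sum>k\<in>{1..n}. fps_nth (lambert_fps N k) n)"
    by (rule euler_fps_recursion)
  show "of_nat n * G0_trace (int n) = - (\<Sum>k\<in>{1..n}. LG_trace (int n) k)"
    by (rule G0_trace_recursion)
next
  have "fps_nth (euler_fps N) 0 = 1"
    unfolding euler_fps_def by (induction N) (simp_all add: fps_X_power_nth fps_power_zeroth)
  then show "G0_trace (int 0) = 1 / 4 * fps_nth (euler_fps N) 0" by (simp add: G0_trace_zero)
qed simp_all

section \<open>Convergence of the trace series\<close>

lemma euler_product_uniform_limit:
  assumes r: "0 < r" "r < 1"
  shows "uniform_limit (cball 0 r) (\<lambda>N q. \<Prod>k<N. 1 - q ^ Suc k) (\<lambda>q::complex. prodinf (\<lambda>k. 1 - q ^ (k + 1))) sequentially"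
proof -
  have "uniformly_convergent_on (cball 0 r) (\<lambda>N q::complex. \<Prod>k<N. 1 - q ^ Suc k)"
  proof (rule Infinite_Products.uniformly_convergent_on_prod')
    show "uniformly_convergent_on (cball 0 r) (\<lambda>N q::complex. \<Sum>k<N. norm (1 - q ^ Suc k - 1))"
    proof (rule Weierstrass_m_test_ev[where M = "\<lambda>k. r ^ Suc k", THEN uniformly_convergentI])
      show "summable (\<lambda>k. r ^ Suc k)" using r by (intro summable_Suc_iff[THEN iffD2] summable_geometric) auto
    qed (use r in \<open>auto intro!: always_eventually mult_mono power_mono simp: norm_power norm_mult\<close>)
  qed (auto intro!: continuous_intros)
  then obtain g where g: "uniform_limit (cball 0 r) (\<lambda>N q::complex. \<Prod>k<N. 1 - q ^ Suc k) g sequentially"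
    unfolding uniformly_convergent_on_def by blast
  have eq: "g q = prodinf (\<lambda>k. 1 - q ^ (k + 1))" if q: "q \<in> cball 0 r" for q
  proof -
    have "summable (\<lambda>k. norm (q ^ Suc k))"
      using q r by (intro summable_Suc_iff[THEN iffD2]) (auto simp: norm_power intro!: summable_geometric)
    then have "summable (\<lambda>k. norm ((1 - q ^ Suc k) - 1))" by simp
    then have "convergent_prod (\<lambda>k. 1 - q ^ Suc k)"
      by (intro abs_convergent_prod_imp_convergent_prod summable_imp_abs_convergent_prod)
    then have "(\<lambda>N. \<Prod>k\<le>N. 1 - q ^ Suc k) \<longlonglongrightarrow> prodinf (\<lambda>k. 1 - q ^ Suc k)"
      by (rule convergent_prod_LIMSEQ)
    moreover have "(\<lambda>N. \<Prod>k\<le>N. 1 - q ^ Suc k) \<longlonglongrightarrow> g q"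
      using LIMSEQ_Suc[OF tendsto_uniform_limitI[OF g q]] by (simp add: lessThan_Suc_atMost)
    ultimately show ?thesis using LIMSEQ_unique by fastforce
  qed
  have "uniform_limit (cball 0 r) (\<lambda>N q. \<Prod>k<N. 1 - q ^ Suc k) g sequentially
      \<longleftrightarrow> uniform_limit (cball 0 r) (\<lambda>N q. \<Prod>k<N. 1 - q ^ Suc k) (\<lambda>q::complex. prodinf (\<lambda>k. 1 - q ^ (k + 1))) sequentially"
    by (rule uniform_limit_cong', rule refl, rule eq)
  then show ?thesis using g by (rule iffD1)
qed

text \<open>The cube of the product is holomorphic as a uniform limit of polynomials, and its
  derivatives at 0 are the limits of theirs. For N \<ge> n the n-th coefficient of the N-th
  polynomial is four times the trace on level n, independently of N. The Taylor expansion thus has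
  these coefficients and converges in the disc.\<close>

lemma euler_cube_power_series:
  assumes q: "norm q < 1"
  shows "(\<lambda>n. 4 * G0_trace (int n) * q ^ n) sums (prodinf (\<lambda>k. 1 - q ^ (k + 1)) ^ 3)"
proof -
  obtain r where r: "norm q < r" "r < 1" using q dense by blast
  then have r0: "0 < r" using norm_ge_zero[of q] by linarith
  define g where "g = (\<lambda>q::complex. prodinf (\<lambda>k. 1 - q ^ (k + 1)))"
  define p where "p = (\<lambda>N q::complex. \<Prod>k<N. 1 - q ^ Suc k)"
  have lim: "uniform_limit (cball 0 r) p g sequentially"
    unfolding p_def g_def using euler_product_uniform_limit[OF r0 r(2)] .
  have hol: "p N holomorphic_on A" for N A
    unfolding p_def by (intro holomorphic_intros)
  have "continuous_on (cball 0 r) g \<and> g holomorphic_on ball 0 r"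
    by (rule holomorphic_uniform_limit[OF _ lim])
       (auto intro!: always_eventually hol holomorphic_on_imp_continuous_on)
  then have g: "continuous_on (cball 0 r) g" "g holomorphic_on ball 0 r" by blast+
  \<comment> \<open>Products of uniform limits are uniform when the limits are bounded.\<close>
  have bounded: "bounded (g ` cball 0 r)"
    by (intro compact_imp_bounded compact_continuous_image g) simp
  have lim2: "uniform_limit (cball 0 r) (\<lambda>N x. p N x * p N x) (\<lambda>x. g x * g x) sequentially"
    by (rule uniform_lim_mult[OF lim lim bounded bounded])
  have bounded2: "bounded ((\<lambda>x. g x * g x) ` cball 0 r)"
    by (intro compact_imp_bounded compact_continuous_image continuous_intros g) simp
  have "uniform_limit (cball 0 r) (\<lambda>N x. p N x * p N x * p N x) (\<lambda>x. g x * g x * g x) sequentially"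
    by (rule uniform_lim_mult[OF lim2 lim bounded2 bounded])
  then have lim3: "uniform_limit (ball 0 r) (\<lambda>N x. p N x ^ 3) (\<lambda>x. g x ^ 3) sequentially"
    by (intro uniform_limit_on_subset[OF _ ball_subset_cball]) (simp add: power3_eq_cube)
  have coeff: "(deriv ^^ n) (\<lambda>x. g x ^ 3) 0 / fact n = 4 * G0_trace (int n)" for n
  proof -
    have lim: "(\<lambda>N. (deriv ^^ n) (\<lambda>x. p N x ^ 3) 0) \<longlonglongrightarrow> (deriv ^^ n) (\<lambda>x. g x ^ 3) 0"
      by (rule higher_deriv_complex_uniform_limit[OF lim3])
         (use r0 in \<open>auto intro!: always_eventually holomorphic_intros hol\<close>)
    have "\<forall>\<^sub>F N in sequentially. (deriv ^^ n) (\<lambda>x. p N x ^ 3) 0 = 4 * G0_trace (int n) * fact n"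
      using eventually_ge_at_top[of n]
    proof eventually_elim
      case (elim N)
      have "(\<lambda>x. p N x ^ 3) has_fps_expansion (\<Prod>k<N. 1 - fps_X ^ Suc k) ^ 3"
        unfolding p_def by (intro fps_expansion_intros)
      also have "(\<Prod>k<N. 1 - fps_X ^ Suc k) ^ 3 = euler_fps N"
        unfolding euler_fps_def prod_power_distrib
        by (rule prod.reindex_bij_witness[of _ "\<lambda>k. k - 1" Suc]) auto
      finally have "fps_nth (euler_fps N) n = (deriv ^^ n) (\<lambda>x. p N x ^ 3) 0 / fact n"
        by (rule fps_nth_fps_expansion)
      then show ?case using G0_trace_eq_euler[OF elim] by (simp add: field_simps)
    qed
    then have "(\<lambda>N. (deriv ^^ n) (\<lambda>x. p N x ^ 3) 0) \<longlonglongrightarrow> 4 * G0_trace (int n) * fact n"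
      by (rule tendsto_eventually)
    with lim have "(deriv ^^ n) (\<lambda>x. g x ^ 3) 0 = 4 * G0_trace (int n) * fact n"
      by (rule LIMSEQ_unique)
    then show ?thesis by simp
  qed
  have "(\<lambda>n. (deriv ^^ n) (\<lambda>x. g x ^ 3) 0 / fact n * (q - 0) ^ n) sums (g q ^ 3)"
    by (rule holomorphic_power_series[of _ _ r]) (use r g in \<open>auto intro!: holomorphic_intros\<close>)
  then have "(\<lambda>n. 4 * G0_trace (int n) * q ^ n) sums (g q ^ 3)" by (simp only: coeff diff_zero)
  then show ?thesis unfolding g_def .
qed

text \<open>The unordered sum calls for absolute convergence, which follows from convergence at a
  point r of larger modulus.\<close>

lemma G0_trace_has_sum:
  assumes q: "norm q < 1"
  shows "((\<lambda>n. G0_trace (int n) * q ^ n) has_sum (prodinf (\<lambda>k. 1 - q ^ (k + 1)) ^ 3 / 4)) UNIV"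
proof -
  obtain r where r: "norm q < r" "r < 1" using q dense by blast
  then have "0 \<le> r" using norm_ge_zero[of q] by linarith
  then have "norm (complex_of_real r) < 1" using r by simp
  then have "summable (\<lambda>n. 4 * G0_trace (int n) * of_real r ^ n)"
    using euler_cube_power_series sums_summable by blast
  then have "summable (\<lambda>n. norm (4 * G0_trace (int n) * q ^ n))"
    by (rule powser_insidea) (use r norm_ge_zero[of q] in auto)
  then have "summable (\<lambda>n. (1 / 4) * norm (4 * G0_trace (int n) * q ^ n))" by (rule summable_mult)
  then have "summable (\<lambda>n. norm (G0_trace (int n) * q ^ n))" by (simp add: norm_mult)
  moreover have "(\<lambda>n. G0_trace (int n) * q ^ n) sums (prodinf (\<lambda>k. 1 - q ^ (k + 1)) ^ 3 / 4)"
    using sums_divide[OF euler_cube_power_series[OF q], of 4] by simp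
  ultimately show ?thesis by (rule norm_summable_imp_has_sum)
qed

theorem mainTheorem1:
  fixes \<tau> :: complex
  assumes "Im \<tau> > 0"
  shows "ramond_trace \<tau> = dedekind_eta \<tau> ^ 3 / 4"
proof -
  define q where "q = qpow \<tau> 1"
  have norm_q: "norm q < 1" using assms by (simp add: q_def qpow_def)
  have qpow_add: "qpow \<tau> (a + b) = qpow \<tau> a * qpow \<tau> b" for a b
    by (simp add: qpow_def ring_distribs exp_add)
  have qpow_nat: "qpow \<tau> (of_nat n) = q ^ n" for n
    by (simp add: q_def qpow_def exp_of_nat_mult[symmetric] mult_ac)
  define weight where "weight n = lowest_weight + of_nat n" for n
  define G where "G l = LV.trace_on (L0_eigenspace l) (\<lambda>x. GL 0 (Theta x))" for l
  have G: "G (weight n) = G0_trace (int n)" for n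
    by (simp add: G_def weight_def G0_trace_def)
  \<comment> \<open>Every eigenvalue is a weight h + n, and a weight whose eigenspace is zero
    contributes trace 0.\<close>
  have "ramond_trace \<tau> = (\<Sum>\<^sub>\<infinity>l\<in>range weight. qpow \<tau> (l - central_charge / 24) * G l)"
    unfolding ramond_trace_def G_def
    by (rule infsum_cong_neutral) (use L0_eigenvalue in \<open>auto simp: LV.trace_on_trivial weight_def\<close>)
  also have "\<dots> = (\<Sum>\<^sub>\<infinity>n. qpow \<tau> (weight n - central_charge / 24) * G (weight n))"
    by (subst infsum_reindex) (auto simp: inj_on_def weight_def o_def)
  also have "\<dots> = (\<Sum>\<^sub>\<infinity>n. qpow \<tau> (1 / 8) * (G0_trace (int n) * q ^ n))"
  proof (rule infsum_cong)
    fix n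
    have "weight n - central_charge / 24 = (lowest_weight - central_charge / 24) + of_nat n"
      by (simp add: weight_def)
    also have "\<dots> = 1 / 8 + of_nat n" by (simp only: central_charge_top)
    finally have "weight n - central_charge / 24 = 1 / 8 + of_nat n" .
    then show "qpow \<tau> (weight n - central_charge / 24) * G (weight n) = qpow \<tau> (1 / 8) * (G0_trace (int n) * q ^ n)"
      by (simp add: qpow_add qpow_nat G)
  qed
  also have "\<dots> = qpow \<tau> (1 / 8) * (prodinf (\<lambda>k. 1 - q ^ (k + 1)) ^ 3 / 4)"
    by (rule infsumI[OF has_sum_cmult_right[OF G0_trace_has_sum[OF norm_q]]])
  also have "qpow \<tau> (1 / 8) = qpow \<tau> (1 / 24) ^ 3"
    by (simp add: qpow_def exp_of_nat_mult[symmetric] mult_ac)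
  finally show ?thesis
    by (simp add: dedekind_eta_def q_def power_mult_distrib)
qed

end
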